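(* Let $\lambda\in X_+$ and let $\mathcal{B}(\lambda)_+$ be the set of elements of $\mathcal{B}(\lambda)$ of dominant weight. The function $$c(T)=\varepsilon_1(T)+\varepsilon_2(T)+\varepsilon_{12}(T)+\widehat\varepsilon_{21}(T),\qquad T\in\mathcal{B}(\lambda)_+,$$ is a charge statistic on $\mathcal{B}(\lambda)_+$; that is, for every dominant weight $\mu\le\lambda$, $$K_{\lambda,\mu}(q)=\sum_{T\in\mathcal{B}(\lambda),\ \mathrm{wt}(T)=\mu}q^{c(T)} .$$
   Context: **Root data (type $C_2$).** $X=\mathbb{Z}\varpi_1\oplus\mathbb{Z}\varpi_2$ is the weight lattice of $Sp_4(\mathbb{C})$, $\mu=(\mu_1,\mu_2)=\mu_1\varpi_1+\mu_2\varpi_2$, $X_+=\{\mu:\mu_1,\mu_2\ge 0\}$. Positive roots: $\alpha_1=2\varpi_1-\varpi_2$, $\alpha_2=-2\varpi_1+2\varpi_2$, $\alpha_{12}=2\alpha_1+\alpha_2=2\varpi_1$, $\alpha_{21}=\alpha_1+\alpha_2=\varpi_2$; $\rho=\varpi_1+\varpi_2$. $W$ is the Weyl group, generated by $s_1(\mu)=(-\mu_1,\mu_1+\mu_2)$ and $s_2(\mu)=(\mu_1+2\mu_2,-\mu_2)$. For $\lambda\in X_+$, $\mu\le\lambda$ means $\mu\in\mathrm{Conv}(W\lambda)\cap(\lambda+\mathbb{Z}\Phi)$. **Kostka–Foulkes polynomials.** $K_{\lambda,\mu}(q)=\sum_{w\in W}(-1)^{\ell(w)}P_q(w(\lambda+\rho)-(\mu+\rho))$,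 where $\sum_\nu P_q(\nu)e^\nu=\prod_{\beta\in\Phi_+}(1-qe^\beta)^{-1}$. **Crystals.** $\mathcal{B}(\lambda)$ is the (normal) crystal of the irreducible $\mathfrak{sp}_4$-module of highest weight $\lambda$, with operators $e_i,f_i$ ($i=1,2$), $\varepsilon_i(T)=\max\{k:e_i^k(T)\ne0\}$; $s_1$ acts on it by reversing each $f_1$-string. The modified operator is $e_{12}=s_1e_2s_1$ and $\varepsilon_{12}(T)=\max\{k:e_{12}^k(T)\neq0\}=\varepsilon_2(s_1(T))$. For $T\in\mathcal{B}(\lambda)$, $\mathrm{str}_2(T)=(a,b,c,d)$ is the adapted string for $s_2s_1s_2s_1$: $a=\varepsilon_2(T)$, $b=\varepsilon_1(e_2^aT)$, $c=\varepsilon_2(e_1^be_2^aT)$, $d=\varepsilon_1(e_2^ce_1^be_2^aT)$; it determines $T$. There is an injective weight-preserving map $\Phi:\mathcal{B}(\lambda)\to\mathcal{B}(\lambda+2\varpi_1)$ with $\mathrm{str}_2(\Phi(T))=\mathrm{str}_2(T)+(0,1,1,1)$. Principal preatom: $\mathcal{P}(\kappa)=\mathcal{B}(\kappa)\setminus\Phi(\mathcal{B}(\kappa-2\varpi_1))$ if $\kappa_1\ge2$, and $\mathcal{P}(\kappa)=\mathcal{B}(\kappa)$ if $\kappa_1\le 1$. Each $T\in\mathcal{B}(\lambda)$ is $\Phi^p(T')$ for a unique $p\ge0$ and $T'\in\mathcal{P}(\lambda-2p\varpi_1)$. **Atoms.** For $T\in\mathcal{P}(\kappa)$ with $\mathrm{str}_2(T)=(a,b,c,d)$,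 $\Psi(T)\in\mathcal{P}(\kappa+\varpi_2)$ is the element with $\mathrm{str}_2=(a,b+1,c+1,d)$ if $d\in\{0,\kappa_1\}$ and $(a,b,c+1,d+1)$ otherwise. $\overline\Psi(T)=\Psi(T)$ if $\mathrm{wt}(T)_1\le0$ and $\overline\Psi(T)=s_1\Psi(s_1T)$ if $\mathrm{wt}(T)_1\ge0$; $\overline\Psi$ is injective and weight preserving. With $\mathcal{P}(\nu)=\emptyset$ for $\nu$ not dominant, put $\mathcal{A}(\kappa)=\mathcal{P}(\kappa)\setminus\overline\Psi(\mathcal{P}(\kappa-\varpi_2))$ if $\kappa_1>0$ and $\mathcal{A}(\kappa)=\mathcal{P}(\kappa)\setminus\overline\Psi^2(\mathcal{P}(\kappa-2\varpi_2))$ if $\kappa_1=0$. Every $T'\in\mathcal{P}(\kappa)$ is $\overline\Psi^a(U)$ for a unique $a\ge0$ ($a$ even if $\kappa_1=0$) and $U\in\mathcal{A}(\kappa-a\varpi_2)$. For $T=\Phi^p(\overline\Psi^a(U))\in\mathcal{B}(\lambda)$ with $U\in\mathcal{A}(\zeta)$, $\zeta=\lambda-2p\varpi_1-a\varpi_2$, we say that $T$ lies in (a copy of) the atom $\mathcal{A}(\zeta)$, and for $T$ of dominant weight $\widehat\varepsilon_{21}(T)$ is the largest integer $k$ such that $\mathrm{wt}(T)+k\alpha_{21}\le\zeta$. *)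

theory Defs
  imports "HOL-Analysis.Analysis" "HOL-Computational_Algebra.Polynomial"
begin

section \<open>Root data of type C2\<close>

text \<open>A weight is the pair of its coordinates with respect to the fundamental weights.\<close>

type_synonym weight = "int \<times> int"

definition scale :: "int \<Rightarrow> weight \<Rightarrow> weight" where
  "scale k \<mu> = (k * fst \<mu>, k * snd \<mu>)"

definition dominant :: "weight \<Rightarrow> bool" where
  "dominant \<mu> \<longleftrightarrow> 0 \<le> fst \<mu> \<and> 0 \<le> snd \<mu>"

definition \<alpha>1 :: weight where "\<alpha>1 = (2, -1)"
definition \<alpha>2 :: weight where "\<alpha>2 = (-2, 2)"
definition \<alpha>12 :: weight where "\<alpha>12 = (2, 0)"
definition \<alpha>21 :: weight where "\<alpha>21 = (0, 1)"
definition \<rho> :: weight where "\<rho> = (1, 1)"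

definition pos_roots :: "weight set" where
  "pos_roots = {\<alpha>1, \<alpha>2, \<alpha>12, \<alpha>21}"

fun refl1 :: "weight \<Rightarrow> weight" where "refl1 (a, b) = (- a, a + b)"
fun refl2 :: "weight \<Rightarrow> weight" where "refl2 (a, b) = (a + 2 * b, - b)"

definition weyl_group :: "(weight \<Rightarrow> weight) set" where
  "weyl_group = {foldr (\<circ>) ws id | ws. set ws \<subseteq> {refl1, refl2}}"

definition weyl_length :: "(weight \<Rightarrow> weight) \<Rightarrow> nat" where
  "weyl_length w =
    (LEAST n. \<exists>ws. set ws \<subseteq> {refl1, refl2} \<and> length ws = n \<and> w = foldr (\<circ>) ws id)"

definition weight_to_real :: "weight \<Rightarrow> real \<times> real" where
  "weight_to_real \<mu> = (of_int (fst \<mu>), of_int (snd \<mu>))"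

definition weight_le :: "weight \<Rightarrow> weight \<Rightarrow> bool" where
  "weight_le \<mu> \<kappa> \<longleftrightarrow>
     weight_to_real \<mu> \<in> convex hull (weight_to_real ` (\<lambda>w. w \<kappa>) ` weyl_group) \<and>
     (\<exists>m n. \<mu> = \<kappa> + scale m \<alpha>1 + scale n \<alpha>2)"


section \<open>Kostka--Foulkes polynomials\<close>

definition kostant_partitions :: "weight \<Rightarrow> (weight \<Rightarrow> nat) set" where
  "kostant_partitions \<nu> =
     {m. (\<forall>\<beta>. \<beta> \<notin> pos_roots \<longrightarrow> m \<beta> = 0) \<and>
         (\<Sum>\<beta>\<in>pos_roots. scale (int (m \<beta>)) \<beta>) = \<nu>}"

text \<open>The coefficient of \<open>e\<^sup>\<nu>\<close> in the product over the positive roots \<open>\<beta>\<close> of the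
  geometric series \<open>1 + q e\<^sup>\<beta> + q\<^sup>2 e\<^sup>2\<^sup>\<beta> + \<dots>\<close>.\<close>

definition q_kostant :: "weight \<Rightarrow> int poly" where
  "q_kostant \<nu> = (\<Sum>m\<in>kostant_partitions \<nu>. monom 1 (\<Sum>\<beta>\<in>pos_roots. m \<beta>))"

definition kostka_foulkes :: "weight \<Rightarrow> weight \<Rightarrow> int poly" where
  "kostka_foulkes \<kappa> \<mu> =
     (\<Sum>w\<in>weyl_group. (-1) ^ weyl_length w * q_kostant (w (\<kappa> + \<rho>) - (\<mu> + \<rho>)))"

lemma finite_kostant_partitions: "finite (kostant_partitions \<nu>)"
proof -
  define h where "h = nat (2 * fst \<nu> + 3 * snd \<nu>)"
  have "m \<beta> \<le> h" if "m \<in> kostant_partitions \<nu>" "\<beta> \<in> pos_roots" for m \<beta>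
  proof -
    from that(1) have "(\<Sum>\<beta>\<in>pos_roots. scale (int (m \<beta>)) \<beta>) = \<nu>"
      by (simp add: kostant_partitions_def)
    then have "\<nu> = (2 * int (m \<alpha>1) - 2 * int (m \<alpha>2) + 2 * int (m \<alpha>12),
                     - int (m \<alpha>1) + 2 * int (m \<alpha>2) + int (m \<alpha>21))"
      by (auto simp: pos_roots_def scale_def \<alpha>1_def \<alpha>2_def \<alpha>12_def \<alpha>21_def)
    then have "h = m \<alpha>1 + 2 * m \<alpha>2 + 4 * m \<alpha>12 + 3 * m \<alpha>21"
      by (simp add: h_def)
    with that(2) show ?thesis by (auto simp: pos_roots_def)
  qed
  then have "kostant_partitions \<nu> \<subseteq>
      {m. \<forall>\<beta>. (\<beta> \<in> pos_roots \<longrightarrow> m \<beta> \<in> {..h}) \<and> (\<beta> \<notin> pos_roots \<longrightarrow> m \<beta> = 0)}"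
    by (auto simp: kostant_partitions_def)
  moreover have "finite pos_roots" by (simp add: pos_roots_def)
  ultimately show ?thesis
    using finite_set_of_finite_funs[of pos_roots "{..h}" 0] finite_subset by blast
qed


section \<open>Crystals\<close>

text \<open>Partial operators: \<open>None\<close> plays the role of \<open>0\<close>.\<close>

primrec iter :: "('a \<Rightarrow> 'a option) \<Rightarrow> nat \<Rightarrow> 'a \<Rightarrow> 'a option" where
  "iter g 0 T = Some T"
| "iter g (Suc k) T = Option.bind (iter g k T) g"

definition max_iter :: "('a \<Rightarrow> 'a option) \<Rightarrow> 'a \<Rightarrow> nat" where
  "max_iter g T = (GREATEST k. iter g k T \<noteq> None)"

text \<open>The crystals of the two fundamental representations. The letters \<open>U\<close> form the
  crystal of the vector representation,
    \<open>U1 \<rightarrow>\<^sub>1 U2 \<rightarrow>\<^sub>2 U3 \<rightarrow>\<^sub>1 U4\<close>,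
  and the letters \<open>V\<close> that of the 5-dimensional one,
    \<open>V1 \<rightarrow>\<^sub>2 V2 \<rightarrow>\<^sub>1 V3 \<rightarrow>\<^sub>1 V4 \<rightarrow>\<^sub>2 V5\<close>.\<close>

datatype idx = I1 | I2

datatype letter = U1 | U2 | U3 | U4 | V1 | V2 | V3 | V4 | V5

fun letter_wt :: "letter \<Rightarrow> weight" where
  "letter_wt U1 = (1, 0)"
| "letter_wt U2 = (-1, 1)"
| "letter_wt U3 = (1, -1)"
| "letter_wt U4 = (-1, 0)"
| "letter_wt V1 = (0, 1)"
| "letter_wt V2 = (2, -1)"
| "letter_wt V3 = (0, 0)"
| "letter_wt V4 = (-2, 1)"
| "letter_wt V5 = (0, -1)"

fun letter_f :: "idx \<Rightarrow> letter \<Rightarrow> letter option" where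
  "letter_f I1 U1 = Some U2"
| "letter_f I2 U2 = Some U3"
| "letter_f I1 U3 = Some U4"
| "letter_f I2 V1 = Some V2"
| "letter_f I1 V2 = Some V3"
| "letter_f I1 V3 = Some V4"
| "letter_f I2 V4 = Some V5"
| "letter_f _ _ = None"

fun letter_e :: "idx \<Rightarrow> letter \<Rightarrow> letter option" where
  "letter_e I1 U2 = Some U1"
| "letter_e I2 U3 = Some U2"
| "letter_e I1 U4 = Some U3"
| "letter_e I2 V2 = Some V1"
| "letter_e I1 V3 = Some V2"
| "letter_e I1 V4 = Some V3"
| "letter_e I2 V5 = Some V4"
| "letter_e _ _ = None"

definition letter_eps :: "idx \<Rightarrow> letter \<Rightarrow> nat" where
  "letter_eps i = max_iter (letter_e i)"

definition letter_phi :: "idx \<Rightarrow> letter \<Rightarrow> nat" where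
  "letter_phi i = max_iter (letter_f i)"

text \<open>A word \<open>[x\<^sub>1, \<dots>, x\<^sub>n]\<close> stands for \<open>x\<^sub>1 \<otimes> \<dots> \<otimes> x\<^sub>n\<close>, and the crystal structure is given by
  Kashiwara's tensor product rule:
  \<open>f\<^sub>i\<close> acts on the left factor of \<open>x \<otimes> y\<close> iff \<open>\<phi>\<^sub>i(x) > \<epsilon>\<^sub>i(y)\<close>,
  \<open>e\<^sub>i\<close> acts on the left factor iff \<open>\<phi>\<^sub>i(x) \<ge> \<epsilon>\<^sub>i(y)\<close>, and
  \<open>\<epsilon>\<^sub>i(x \<otimes> y) = \<epsilon>\<^sub>i(x) + max 0 (\<epsilon>\<^sub>i(y) - \<phi>\<^sub>i(x))\<close>; the subtraction below is the truncated one.\<close>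

type_synonym word = "letter list"

fun tensor_eps :: "idx \<Rightarrow> word \<Rightarrow> nat" where
  "tensor_eps i [] = 0"
| "tensor_eps i (x # y) = letter_eps i x + (tensor_eps i y - letter_phi i x)"

fun cr_e :: "idx \<Rightarrow> word \<Rightarrow> word option" where
  "cr_e i [] = None"
| "cr_e i (x # y) =
     (if letter_phi i x \<ge> tensor_eps i y
      then map_option (\<lambda>x'. x' # y) (letter_e i x)
      else map_option (\<lambda>y'. x # y') (cr_e i y))"

fun cr_f :: "idx \<Rightarrow> word \<Rightarrow> word option" where
  "cr_f i [] = None"
| "cr_f i (x # y) =
     (if letter_phi i x > tensor_eps i y
      then map_option (\<lambda>x'. x' # y) (letter_f i x)
      else map_option (\<lambda>y'. x # y') (cr_f i y))"

definition wt :: "word \<Rightarrow> weight" where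
  "wt T = sum_list (map letter_wt T)"

text \<open>The crystal of the irreducible module of highest weight \<open>\<kappa>\<close> (for dominant \<open>\<kappa>\<close>), realized
  as the connected component of the highest weight element
  \<open>U1 \<otimes> \<dots> \<otimes> U1 \<otimes> V1 \<otimes> \<dots> \<otimes> V1\<close>, with \<open>\<kappa>\<^sub>1\<close> factors \<open>U1\<close> and \<open>\<kappa>\<^sub>2\<close> factors \<open>V1\<close>.\<close>

inductive_set crystal :: "weight \<Rightarrow> word set" for \<kappa> :: weight where
  highest: "replicate (nat (fst \<kappa>)) U1 @ replicate (nat (snd \<kappa>)) V1 \<in> crystal \<kappa>"
| lower: "T \<in> crystal \<kappa> \<Longrightarrow> cr_f i T = Some T' \<Longrightarrow> T' \<in> crystal \<kappa>"
| raise: "T \<in> crystal \<kappa> \<Longrightarrow> cr_e i T = Some T' \<Longrightarrow> T' \<in> crystal \<kappa>"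

definition crystal_dom :: "weight \<Rightarrow> word set" where
  "crystal_dom \<kappa> = {T \<in> crystal \<kappa>. dominant (wt T)}"

definition eps :: "idx \<Rightarrow> word \<Rightarrow> nat" where
  "eps i = max_iter (cr_e i)"

definition phi :: "idx \<Rightarrow> word \<Rightarrow> nat" where
  "phi i = max_iter (cr_f i)"

text \<open>Reversal of the 1-strings: an element in position \<open>\<epsilon>\<^sub>1\<close> from the top of its string is sent
  to the one in position \<open>\<epsilon>\<^sub>1\<close> from the bottom.\<close>

definition s1 :: "word \<Rightarrow> word" where
  "s1 T = (if eps I1 T \<le> phi I1 T
           then the (iter (cr_f I1) (phi I1 T - eps I1 T) T)
           else the (iter (cr_e I1) (eps I1 T - phi I1 T) T))"

definition e12 :: "word \<Rightarrow> word option" where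
  "e12 T = map_option s1 (cr_e I2 (s1 T))"

definition eps12 :: "word \<Rightarrow> nat" where
  "eps12 = max_iter e12"

definition e_top :: "idx \<Rightarrow> word \<Rightarrow> word" where
  "e_top i T = the (iter (cr_e i) (eps i T) T)"

definition str2 :: "word \<Rightarrow> nat \<times> nat \<times> nat \<times> nat" where
  "str2 T =
     (eps I2 T,
      eps I1 (e_top I2 T),
      eps I2 (e_top I1 (e_top I2 T)),
      eps I1 (e_top I2 (e_top I1 (e_top I2 T))))"


section \<open>Preatoms and atoms\<close>

text \<open>The maps below take the highest weight \<open>\<kappa>\<close> of their source as an additional argument.\<close>

definition Phi :: "weight \<Rightarrow> word \<Rightarrow> word" where
  "Phi \<kappa> T = (THE T'. T' \<in> crystal (\<kappa> + (2, 0)) \<and> str2 T' = str2 T + (0, 1, 1, 1))"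

primrec Phi_pow :: "nat \<Rightarrow> weight \<Rightarrow> word \<Rightarrow> word" where
  "Phi_pow 0 \<kappa> T = T"
| "Phi_pow (Suc p) \<kappa> T = Phi (\<kappa> + (2 * int p, 0)) (Phi_pow p \<kappa> T)"

definition preatom :: "weight \<Rightarrow> word set" where
  "preatom \<kappa> =
     (if \<not> dominant \<kappa> then {}
      else if fst \<kappa> \<ge> 2 then crystal \<kappa> - Phi (\<kappa> - (2, 0)) ` crystal (\<kappa> - (2, 0))
      else crystal \<kappa>)"

definition Psi :: "weight \<Rightarrow> word \<Rightarrow> word" where
  "Psi \<kappa> T =
     (case str2 T of (a, b, c, d) \<Rightarrow>
        THE T'. T' \<in> preatom (\<kappa> + (0, 1)) \<and>
          str2 T' = (if d = 0 \<or> int d = fst \<kappa>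
                     then (a, b + 1, c + 1, d) else (a, b, c + 1, d + 1)))"

text \<open>If the first coordinate of \<open>wt T\<close> is \<open>0\<close>, then \<open>s1\<close> fixes both \<open>T\<close> and \<open>Psi \<kappa> T\<close>, so
  it is immaterial which case such elements are assigned to.\<close>

definition Psi_bar :: "weight \<Rightarrow> word \<Rightarrow> word" where
  "Psi_bar \<kappa> T = (if fst (wt T) \<le> 0 then Psi \<kappa> T else s1 (Psi \<kappa> (s1 T)))"

primrec Psi_bar_pow :: "nat \<Rightarrow> weight \<Rightarrow> word \<Rightarrow> word" where
  "Psi_bar_pow 0 \<kappa> T = T"
| "Psi_bar_pow (Suc a) \<kappa> T = Psi_bar (\<kappa> + (0, int a)) (Psi_bar_pow a \<kappa> T)"

definition atom :: "weight \<Rightarrow> word set" where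
  "atom \<kappa> =
     (if fst \<kappa> > 0
      then preatom \<kappa> - Psi_bar (\<kappa> - (0, 1)) ` preatom (\<kappa> - (0, 1))
      else preatom \<kappa> - Psi_bar_pow 2 (\<kappa> - (0, 2)) ` preatom (\<kappa> - (0, 2)))"

text \<open>The element \<open>T\<close> of the crystal of highest weight \<open>\<kappa>\<close> lies in a copy of the atom of
  highest weight \<open>\<zeta>\<close>. The maps \<open>Psi_bar\<close> do not change the first coordinate of the highest
  weight, so the parity condition may be read off from \<open>\<zeta>\<close>.\<close>

definition lies_in_atom :: "weight \<Rightarrow> word \<Rightarrow> weight \<Rightarrow> bool" where
  "lies_in_atom \<kappa> T \<zeta> \<longleftrightarrow>
     (\<exists>p a U. \<zeta> = \<kappa> - (2 * int p, int a) \<and> (fst \<zeta> = 0 \<longrightarrow> even a) \<and> U \<in> atom \<zeta> \<and>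
        T = Phi_pow p (\<kappa> - (2 * int p, 0)) (Psi_bar_pow a \<zeta> U))"

definition atom_weight :: "weight \<Rightarrow> word \<Rightarrow> weight" where
  "atom_weight \<kappa> T = (THE \<zeta>. lies_in_atom \<kappa> T \<zeta>)"

definition eps21_hat :: "weight \<Rightarrow> word \<Rightarrow> int" where
  "eps21_hat \<kappa> T = (GREATEST k. weight_le (wt T + scale k \<alpha>21) (atom_weight \<kappa> T))"

definition charge :: "weight \<Rightarrow> word \<Rightarrow> int" where
  "charge \<kappa> T = int (eps I1 T) + int (eps I2 T) + int (eps12 T) + eps21_hat \<kappa> T"

text \<open>A charge statistic takes nonnegative values, so that \<open>nat\<close> loses nothing in the exponent.\<close>

definition charge_statistic :: "weight \<Rightarrow> (word \<Rightarrow> int) \<Rightarrow> bool" where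
  "charge_statistic \<kappa> c \<longleftrightarrow>
     (\<forall>T\<in>crystal_dom \<kappa>. 0 \<le> c T) \<and>
     (\<forall>\<mu>. dominant \<mu> \<and> weight_le \<mu> \<kappa> \<longrightarrow>
        kostka_foulkes \<kappa> \<mu> = (\<Sum>T | T \<in> crystal \<kappa> \<and> wt T = \<mu>. monom 1 (nat (c T))))"

end

theory Submission
  imports Defs
begin

text \<open>Adapted strings identify the crystal of highest weight \<open>\<kappa>\<close> with the lattice points of an
  explicit polytope; a normal form of the words in the crystal turns this into a computation with
  the tensor product rule. In string coordinates all maps involved are piecewise linear. For \<open>T\<close> of
  dominant weight \<open>\<mu>\<close> one reads off the string of \<open>s1 T\<close> the pair \<open>(p, x)\<close> for which \<open>T\<close> lies in a
  copy of the atom of highest weight \<open>\<kappa> - 2p\<varpi>\<^sub>1 - x\<varpi>\<^sub>2\<close>. Each atom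
  contains every weight at most once, and the charge of \<open>T\<close> is \<open>ht(\<kappa> - \<mu>) - 2p - x\<close>.

  On the other side, the \<open>q\<close>-analogue of the Kostant partition function at \<open>\<nu>\<close> is the sum of
  \<open>q\<close> to the power \<open>ht(\<nu>) - 2i - j\<close> over the multiplicities \<open>i\<close>, \<open>j\<close> of \<open>\<alpha>12\<close> and \<open>\<alpha>21\<close>. For dominant
  \<open>\<mu>\<close> only \<open>1\<close>, \<open>s\<^sub>1\<close> and \<open>s\<^sub>2\<close> contribute to the Kostka--Foulkes polynomial, and the last two terms
  remove from the first exactly the pairs \<open>(i, j)\<close> that do not occur as some \<open>(p, x)\<close>.\<close>

subsection \<open>Iteration of partial operators\<close>

text \<open>Behind the agreement of the two index sets stands that
  \<open>\<alpha>12 = (2, 0)\<close> and \<open>\<alpha>21 = (0, 1)\<close> are multiples of the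
  fundamental weights: taking \<open>i\<close> copies of the one and \<open>j\<close> of the other
  off \<open>\<kappa>\<close> leaves \<open>\<zeta> = \<kappa> - (2 * i, j)\<close>, a candidate for
  the highest weight of an atom. What survives the cancellation are the dominant
  \<open>\<zeta>\<close>, with \<open>j\<close> even on the wall where the first coordinate of
  \<open>\<zeta>\<close> vanishes. This is the parity produced by removing the image of the square
  of \<open>Psi_bar\<close> there. The exponent equals the height of \<open>\<zeta> - \<mu>\<close>
  plus \<open>p + x\<close>, so each \<open>Phi\<close> and each \<open>Psi_bar\<close> contributes
  one power of \<open>q\<close>. The string of \<open>s1 T\<close> is the right coordinate because
  at dominant weights \<open>Psi_bar\<close> is the conjugate of \<open>Psi\<close> by
  \<open>s1\<close>, and \<open>Psi\<close> only translates strings. The main obstacle is that the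
  crystal is given as a connected component of words, so its strings become known only after the
  tensor product rule has been evaluated on all of it.\<close>

lemma iter_None: "iter g k T = None \<Longrightarrow> k \<le> l \<Longrightarrow> iter g l T = None"
  by (induction l) (auto simp: le_Suc_eq)

text \<open>\<open>None\<close> is absorbing for \<open>iter\<close>, so the first failure bounds
  every success, and \<open>GREATEST\<close> reduces to a check at two consecutive values.\<close>

lemma max_iter_eqI:
  assumes "iter g n T \<noteq> None" and "iter g (Suc n) T = None"
  shows "max_iter g T = n"
  unfolding max_iter_def
proof (rule Greatest_equality)
  show "k \<le> n" if "iter g k T \<noteq> None" for k
    using that assms(2) iter_None[of g "Suc n" T k] by (meson not_less_eq_eq)
qed (fact assms(1))

subsection \<open>The crystal operators on words in block form\<close>

lemma letter_eps_simps [simp]: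
  "letter_eps I1 U1 = 0" "letter_eps I1 U2 = 1" "letter_eps I1 U3 = 0" "letter_eps I1 U4 = 1"
  "letter_eps I1 V1 = 0" "letter_eps I1 V2 = 0" "letter_eps I1 V3 = 1" "letter_eps I1 V4 = 2"
  "letter_eps I1 V5 = 0"
  "letter_eps I2 U1 = 0" "letter_eps I2 U2 = 0" "letter_eps I2 U3 = 1" "letter_eps I2 U4 = 0"
  "letter_eps I2 V1 = 0" "letter_eps I2 V2 = 1" "letter_eps I2 V3 = 0" "letter_eps I2 V4 = 0"
  "letter_eps I2 V5 = 1"
  unfolding letter_eps_def by (rule max_iter_eqI; simp add: numeral_2_eq_2)+

lemma letter_phi_simps [simp]:
  "letter_phi I1 U1 = 1" "letter_phi I1 U2 = 0" "letter_phi I1 U3 = 1" "letter_phi I1 U4 = 0"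
  "letter_phi I1 V1 = 0" "letter_phi I1 V2 = 2" "letter_phi I1 V3 = 1" "letter_phi I1 V4 = 0"
  "letter_phi I1 V5 = 0"
  "letter_phi I2 U1 = 0" "letter_phi I2 U2 = 1" "letter_phi I2 U3 = 0" "letter_phi I2 U4 = 0"
  "letter_phi I2 V1 = 1" "letter_phi I2 V2 = 0" "letter_phi I2 V3 = 0" "letter_phi I2 V4 = 1"
  "letter_phi I2 V5 = 0"
  unfolding letter_phi_def by (rule max_iter_eqI; simp add: numeral_2_eq_2)+

lemma letter_e_None: "letter_eps i x = 0 \<Longrightarrow> letter_e i x = None"
  by (cases i; cases x) auto

lemma cr_e_None: "tensor_eps i y = 0 \<Longrightarrow> cr_e i y = None"
  by (cases y) (auto simp: letter_e_None)

text \<open>A letter at an end of its \<open>i\<close>-string has \<open>letter_eps\<close> or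
  \<open>letter_phi\<close> equal to 0, and then a whole power of it can be evaluated at once. The
  one letter in the middle of a string is \<open>V3\<close>; accordingly the block lemmas below
  admit at most one \<open>V3\<close>.\<close>

lemma tensor_eps_replicate_phi:
  "letter_eps i x = 0 \<Longrightarrow>
     tensor_eps i (replicate n x @ y) = tensor_eps i y - n * letter_phi i x"
  by (induction n) auto

lemma tensor_eps_replicate_eps:
  "letter_phi i x = 0 \<Longrightarrow>
     tensor_eps i (replicate n x @ y) = n * letter_eps i x + tensor_eps i y"
  by (induction n) auto

lemma cr_e_replicate_phi:
  "letter_eps i x = 0 \<Longrightarrow>
     cr_e i (replicate n x @ y) =
       (if n * letter_phi i x < tensor_eps i y
        then map_option (\<lambda>z. replicate n x @ z) (cr_e i y) else None)"
proof (induction n)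
  case 0 then show ?case by (cases "tensor_eps i y = 0"; cases "cr_e i y") (auto simp: cr_e_None)
next
  case (Suc n)
  then show ?case
    by (auto simp: letter_e_None tensor_eps_replicate_phi option.map_comp comp_def)
qed

lemma cr_e_replicate_eps:
  "letter_phi i x = 0 \<Longrightarrow>
     cr_e i (replicate n x @ y) =
       (if 0 < tensor_eps i y then map_option (\<lambda>z. replicate n x @ z) (cr_e i y)
        else if n = 0 then None
        else map_option (\<lambda>x'. replicate (n - 1) x @ x' # y) (letter_e i x))"
proof (induction n)
  case 0 then show ?case by (cases "tensor_eps i y = 0"; cases "cr_e i y") (auto simp: cr_e_None)
next
  case (Suc n)
  show ?case
  proof (cases "letter_eps i x = 0")
    case True
    then show ?thesis using Suc
      by (auto simp: letter_e_None tensor_eps_replicate_phi option.map_comp comp_def)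
  next
    case False
    then show ?thesis using Suc
      by (cases n) (auto simp: tensor_eps_replicate_eps option.map_comp comp_def)
  qed
qed

lemma cr_f_replicate_eps:
  "letter_phi i x = 0 \<Longrightarrow>
     cr_f i (replicate n x @ y) = map_option (\<lambda>z. replicate n x @ z) (cr_f i y)"
proof (induction n)
  case 0 then show ?case by (cases "cr_f i y") auto
next
  case (Suc n) then show ?case by (cases "cr_f i y") auto
qed

lemma cr_f_replicate_phi:
  "letter_eps i x = 0 \<Longrightarrow>
     cr_f i (replicate n x @ y) =
       (if tensor_eps i y < n * letter_phi i x
        then map_option (\<lambda>x'. x' # replicate (n - 1) x @ y) (letter_f i x)
        else map_option (\<lambda>z. replicate n x @ z) (cr_f i y))"
proof (induction n)
  case 0 then show ?case by (cases "cr_f i y") auto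
next
  case (Suc n)
  then show ?case
    by (auto simp: tensor_eps_replicate_phi option.map_comp comp_def)
qed

text \<open>Within the \<open>U\<close> part and within the \<open>V\<close> part the letters run
  from lowest to highest, so an operator changes a letter at the border of two neighbouring blocks
  and the shape survives.\<close>

definition blocks :: "nat \<Rightarrow> nat \<Rightarrow> nat \<Rightarrow> nat \<Rightarrow> nat \<Rightarrow> nat \<Rightarrow> nat \<Rightarrow> nat \<Rightarrow> nat \<Rightarrow> word" where
  "blocks u4 u3 u2 u1 v5 v4 v3 v2 v1 =
     replicate u4 U4 @ replicate u3 U3 @ replicate u2 U2 @ replicate u1 U1 @
     replicate v5 V5 @ replicate v4 V4 @ replicate v3 V3 @ replicate v2 V2 @ replicate v1 V1"

lemma tensor_eps_replicate_Nil:
  "letter_eps i x = 0 \<Longrightarrow> tensor_eps i (replicate n x) = 0"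
  using tensor_eps_replicate_phi[of i x n "[]"] by simp

lemma tensor_eps_replicate_Nil':
  "letter_phi i x = 0 \<Longrightarrow> tensor_eps i (replicate n x) = n * letter_eps i x"
  using tensor_eps_replicate_eps[of i x n "[]"] by simp

lemma cr_f_replicate_Nil:
  "letter_eps i x = 0 \<Longrightarrow>
     cr_f i (replicate n x) =
       (if 0 < n * letter_phi i x
        then map_option (\<lambda>x'. x' # replicate (n - 1) x) (letter_f i x) else None)"
  using cr_f_replicate_phi[of i x n "[]"] by simp

lemmas block_simps =
  tensor_eps_replicate_phi tensor_eps_replicate_eps cr_e_replicate_phi cr_e_replicate_eps
  cr_f_replicate_phi cr_f_replicate_eps tensor_eps_replicate_Nil cr_f_replicate_Nil
  tensor_eps_replicate_Nil'

text \<open>The truncated \<open>v5 + (v2 - v4)\<close> is \<open>tensor_eps I2\<close> of the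
  \<open>V\<close> part; the letters \<open>U2\<close> act as long as they outnumber it. For
  \<open>I1\<close> the same role is played by \<open>2 * v4 + v3\<close>, which first meets the
  \<open>U1\<close>.\<close>

lemma cr_f_I2_blocks:
  assumes "v3 \<le> 1"
  shows "cr_f I2 (blocks u4 u3 u2 u1 v5 v4 v3 v2 v1) =
    (if v5 + (v2 - v4) < u2 then Some (blocks u4 (u3 + 1) (u2 - 1) u1 v5 v4 v3 v2 v1)
     else if v2 < v4 then Some (blocks u4 u3 u2 u1 (v5 + 1) (v4 - 1) v3 v2 v1)
     else if 0 < v1 then Some (blocks u4 u3 u2 u1 v5 v4 v3 (v2 + 1) (v1 - 1))
     else None)"
  unfolding blocks_def by (auto simp: block_simps replicate_app_Cons_same)

lemma cr_e_I2_blocks: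
  assumes "v3 \<le> 1"
  shows "cr_e I2 (blocks u4 u3 u2 u1 v5 v4 v3 v2 v1) =
    (if u2 < v5 + (v2 - v4)
     then if v4 < v2 then Some (blocks u4 u3 u2 u1 v5 v4 v3 (v2 - 1) (v1 + 1))
          else Some (blocks u4 u3 u2 u1 (v5 - 1) (v4 + 1) v3 v2 v1)
     else if 0 < u3 then Some (blocks u4 (u3 - 1) (u2 + 1) u1 v5 v4 v3 v2 v1)
     else None)"
  unfolding blocks_def by (auto simp: block_simps replicate_app_Cons_same)

lemma cr_f_I1_blocks:
  assumes "v3 \<le> 1"
  shows "cr_f I1 (blocks u4 u3 u2 u1 v5 v4 v3 v2 v1) =
    (if u2 + (2 * v4 + v3 - u1) < u3 then Some (blocks (u4 + 1) (u3 - 1) u2 u1 v5 v4 v3 v2 v1)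
     else if 2 * v4 + v3 < u1 then Some (blocks u4 u3 (u2 + 1) (u1 - 1) v5 v4 v3 v2 v1)
     else if v3 = 1 then Some (blocks u4 u3 u2 u1 v5 (v4 + 1) 0 v2 v1)
     else if 0 < v2 then Some (blocks u4 u3 u2 u1 v5 v4 1 (v2 - 1) v1)
     else None)"
proof -
  consider "v3 = 0" | "v3 = 1" using assms by linarith
  then show ?thesis
    by cases (auto simp: blocks_def block_simps replicate_app_Cons_same)
qed

lemma cr_e_I1_blocks:
  assumes "v3 \<le> 1"
  shows "cr_e I1 (blocks u4 u3 u2 u1 v5 v4 v3 v2 v1) =
    (if u3 < u2 + (2 * v4 + v3 - u1)
     then if u1 < 2 * v4 + v3
          then if v3 = 1 then Some (blocks u4 u3 u2 u1 v5 v4 0 (v2 + 1) v1)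
               else Some (blocks u4 u3 u2 u1 v5 (v4 - 1) 1 v2 v1)
          else Some (blocks u4 u3 (u2 - 1) (u1 + 1) v5 v4 v3 v2 v1)
     else if 0 < u4 then Some (blocks (u4 - 1) (u3 + 1) u2 u1 v5 v4 v3 v2 v1)
     else None)"
proof -
  consider "v3 = 0" | "v3 = 1" using assms by linarith
  then show ?thesis
    by cases (auto simp: blocks_def block_simps replicate_app_Cons_same)
qed

subsection \<open>The string polytope\<close>

type_synonym str = "int \<times> int \<times> int \<times> int"

text \<open>The string polytope for the reduced word \<open>s2 s1 s2 s1\<close>:
  \<open>0 \<le> a\<close> and \<open>0 \<le> d \<le> c \<le> b\<close> cut out the string cone, and
  each further bound limits a number of lowering steps by the coordinate of the weight reached so
  far, starting from \<open>\<kappa>\<close>.\<close>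

definition strs :: "weight \<Rightarrow> str set" where
  "strs \<kappa> = {(a, b, c, d). 0 \<le> a \<and> 0 \<le> d \<and> d \<le> c \<and> c \<le> b \<and> d \<le> fst \<kappa> \<and> c \<le> snd \<kappa> + d \<and>
     b \<le> fst \<kappa> - 2 * d + 2 * c \<and> a \<le> snd \<kappa> - 2 * c + b + d}"

text \<open>The word \<open>f\<^sub>2\<^sup>a f\<^sub>1\<^sup>b f\<^sub>2\<^sup>c f\<^sub>1\<^sup>d\<close> applied to the highest weight word, computed block by block:
  \<open>t\<close> of the last \<open>a\<close> steps change letters \<open>U2\<close> or \<open>V4\<close>, the remaining ones letters \<open>V1\<close>.\<close>

fun str_word :: "weight \<Rightarrow> str \<Rightarrow> word" where
  "str_word (l, m) (a, b, c, d) =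
    (let t = min a (b - c); r = max 0 (b - l); u3 = min t (l - d); v5 = t - u3 in
     blocks (nat d) (nat u3) (nat (min b l - d - u3)) (nat (l - b)) (nat v5) (nat (r div 2 - v5))
       (nat (r mod 2)) (nat (c - d - (r + 1) div 2 + (a - t))) (nat (m - c + d - (a - t))))"

text \<open>The value at \<open>I1\<close> is the first entry of the string for the other reduced
  word \<open>s1 s2 s1 s2\<close>; the maximum of three linear forms is the rank two transition map
  between the two words.\<close>

fun str_eps :: "idx \<Rightarrow> str \<Rightarrow> int" where
  "str_eps I1 (a, b, c, d) = max d (max (2 * c - b) (b - 2 * a))"
| "str_eps I2 (a, b, c, d) = a"

fun str_wt :: "weight \<Rightarrow> str \<Rightarrow> weight" where
  "str_wt (l, m) (a, b, c, d) = (l - 2 * (b + d) + 2 * (a + c), m + b + d - 2 * (a + c))"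

definition str_phi :: "weight \<Rightarrow> idx \<Rightarrow> str \<Rightarrow> int" where
  "str_phi \<kappa> i s = str_eps i s + (case i of I1 \<Rightarrow> fst (str_wt \<kappa> s) | I2 \<Rightarrow> snd (str_wt \<kappa> s))"

text \<open>Each branch at \<open>I1\<close> decreases by one a linear form that attains the maximum
  in \<open>str_eps\<close>. Ties are resolved in opposite orders here and in
  \<open>str_lower\<close>, which makes the two maps inverse to each other.\<close>

fun str_raise :: "idx \<Rightarrow> str \<Rightarrow> str" where
  "str_raise I1 (a, b, c, d) =
     (if d < b - 2 * a \<and> 2 * c - b < b - 2 * a then (a, b - 1, c, d)
      else if d < 2 * c - b then (a + 1, b - 1, c - 1, d)
      else (a + 1, b, c - 1, d - 1))"
| "str_raise I2 (a, b, c, d) = (a - 1, b, c, d)"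

fun str_lower :: "idx \<Rightarrow> str \<Rightarrow> str" where
  "str_lower I1 (a, b, c, d) =
     (if d \<le> b - 2 * a \<and> 2 * c - b \<le> b - 2 * a then (a, b + 1, c, d)
      else if d \<le> 2 * c - b then (a - 1, b + 1, c + 1, d)
      else (a - 1, b, c + 1, d + 1))"
| "str_lower I2 (a, b, c, d) = (a + 1, b, c, d)"

lemma blocks_eqI:
  "u4 = u4' \<Longrightarrow> u3 = u3' \<Longrightarrow> u2 = u2' \<Longrightarrow> u1 = u1' \<Longrightarrow> v5 = v5' \<Longrightarrow> v4 = v4' \<Longrightarrow> v3 = v3' \<Longrightarrow>
   v2 = v2' \<Longrightarrow> v1 = v1' \<Longrightarrow>
   blocks u4 u3 u2 u1 v5 v4 v3 v2 v1 = blocks u4' u3' u2' u1' v5' v4' v3' v2' v1'"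
  by simp

lemma str_raise_in_strs:
  assumes "s \<in> strs \<kappa>" "0 < str_eps i s"
  shows "str_raise i s \<in> strs \<kappa>"
  using assms by (cases s; cases i) (auto simp: strs_def)

lemma str_lower_in_strs:
  assumes "s \<in> strs \<kappa>" "0 < str_phi \<kappa> i s"
  shows "str_lower i s \<in> strs \<kappa>"
  using assms by (cases s; cases i; cases \<kappa>) (auto simp: strs_def str_phi_def)

text \<open>Integer lengths keep the case analysis inside linear arithmetic, away from truncated
  subtraction.\<close>

definition iblocks :: "int \<Rightarrow> int \<Rightarrow> int \<Rightarrow> int \<Rightarrow> int \<Rightarrow> int \<Rightarrow> int \<Rightarrow> int \<Rightarrow> int \<Rightarrow> word" where
  "iblocks u4 u3 u2 u1 v5 v4 v3 v2 v1 =
     blocks (nat u4) (nat u3) (nat u2) (nat u1) (nat v5) (nat v4) (nat v3) (nat v2) (nat v1)"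

text \<open>The graph of \<open>str_word\<close>, with \<open>min\<close>, \<open>max\<close>,
  \<open>div\<close> and \<open>mod\<close> replaced by disjunctions of linear conditions. The last
  clause records that letters \<open>V4\<close> become \<open>V5\<close> only after every available
  \<open>U2\<close> has become \<open>U3\<close>.\<close>

definition block_counts :: "weight \<Rightarrow> str \<Rightarrow> int \<Rightarrow> int \<Rightarrow> int \<Rightarrow> int \<Rightarrow> int \<Rightarrow> int \<Rightarrow> int \<Rightarrow> int \<Rightarrow> int \<Rightarrow> bool"
  where "block_counts \<kappa> s u4 u3 u2 u1 v5 v4 v3 v2 v1 \<longleftrightarrow>
    (case (\<kappa>, s) of ((l, m), (a, b, c, d)) \<Rightarrow>
      0 \<le> u4 \<and> 0 \<le> u3 \<and> 0 \<le> u2 \<and> 0 \<le> u1 \<and> 0 \<le> v5 \<and> 0 \<le> v4 \<and> 0 \<le> v2 \<and> 0 \<le> v1 \<and>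
      (v3 = 0 \<or> v3 = 1) \<and> u4 = d \<and> u4 + u3 + u2 + u1 = l \<and> v5 + v4 + v3 + v2 + v1 = m \<and>
      (b \<le> l \<and> u1 = l - b \<and> v5 = 0 \<and> v4 = 0 \<and> v3 = 0 \<or>
       l \<le> b \<and> u1 = 0 \<and> 2 * (v4 + v5) + v3 = b - l) \<and>
      (a \<le> b - c \<and> u3 + v5 = a \<and> v1 = m - c + d \<or>
       b - c \<le> a \<and> u3 + v5 = b - c \<and> v1 = m - c + d - (a - b + c)) \<and>
      (v5 = 0 \<or> u3 = l - d))"

lemma str_word_eqI:
  assumes "block_counts \<kappa> s u4 u3 u2 u1 v5 v4 v3 v2 v1"
  shows "str_word \<kappa> s = iblocks u4 u3 u2 u1 v5 v4 v3 v2 v1"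
proof -
  obtain l m a b c d where eq: "\<kappa> = (l, m)" "s = (a, b, c, d)"
    by (cases \<kappa>; cases s) auto
  define R where "R = max 0 (b - l)"
  define t where "t = min a (b - c)"
  have u: "0 \<le> u3" "0 \<le> u2" "0 \<le> u1" "0 \<le> v5"
      "v3 = 0 \<or> v3 = 1" "u4 = d" "u4 + u3 + u2 + u1 = l" "v5 + v4 + v3 + v2 + v1 = m"
      "b \<le> l \<and> u1 = l - b \<and> v5 = 0 \<and> v4 = 0 \<and> v3 = 0 \<or>
       l \<le> b \<and> u1 = 0 \<and> 2 * (v4 + v5) + v3 = b - l"
      "a \<le> b - c \<and> u3 + v5 = a \<and> v1 = m - c + d \<or>
       b - c \<le> a \<and> u3 + v5 = b - c \<and> v1 = m - c + d - (a - b + c)"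
      "v5 = 0 \<or> u3 = l - d"
    using assms by (simp_all add: block_counts_def eq)
  have R: "R = 2 * (v4 + v5) + v3"
    using u(9) unfolding R_def by auto
  then have div: "R div 2 = v4 + v5" "R mod 2 = v3" "(R + 1) div 2 = v3 + v4 + v5"
    using u(5) by presburger+
  have t: "t = u3 + v5" "v1 = m - c + d - (a - t)"
    using u(10) unfolding t_def by auto
  have u3: "min t (l - d) = u3" using u(1-7,11) t by auto
  have "min b l = l - u1" "nat (l - b) = nat u1" using u(9) by auto
  then show ?thesis
    unfolding eq str_word.simps Let_def t_def[symmetric] R_def[symmetric] u3 div iblocks_def
    using u(6-8) t by (intro blocks_eqI) auto
qed

lemma block_counts_exist:
  assumes "s \<in> strs \<kappa>"
  obtains u4 u3 u2 u1 v5 v4 v3 v2 v1 where "block_counts \<kappa> s u4 u3 u2 u1 v5 v4 v3 v2 v1"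
proof -
  obtain l m a b c d where eq: "\<kappa> = (l, m)" "s = (a, b, c, d)"
    by (cases \<kappa>; cases s) auto
  have s: "0 \<le> a" "0 \<le> d" "d \<le> c" "c \<le> b" "d \<le> l" "c \<le> m + d"
     "b \<le> l - 2 * d + 2 * c" "a \<le> m - 2 * c + b + d"
    using assms by (simp_all add: strs_def eq)
  define R where "R = max 0 (b - l)"
  define t where "t = min a (b - c)"
  define u3 where "u3 = min t (l - d)"
  \<comment> \<open>Of the \<open>b\<close> steps by \<open>f1\<close>, the \<open>R\<close> steps
    beyond the \<open>U\<close> letters act on letters \<open>V2\<close>: every two of them produce
    a \<open>V4\<close>, and an odd last one leaves the single \<open>V3\<close>. Later
    \<open>t - u3\<close> of these \<open>V4\<close> are lowered to \<open>V5\<close>.\<close>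
  define h where "h = R div 2"
  define k where "k = R mod 2"
  have t: "0 \<le> t" "t = a \<and> a \<le> b - c \<or> t = b - c \<and> b - c \<le> a" using s by (auto simp: t_def)
  have u3: "0 \<le> u3" "u3 = t \<and> t \<le> l - d \<or> u3 = l - d \<and> l - d \<le> t"
    using s t by (auto simp: u3_def)
  have R: "R = 0 \<and> b \<le> l \<or> R = b - l \<and> l < b" by (auto simp: R_def)
  have hk: "R = 2 * h + k" "k = 0 \<or> k = 1" by (auto simp: h_def k_def)
  show ?thesis
    by (rule that[of d u3 "min b l - d - u3" "max 0 (l - b)" "t - u3"
          "h - (t - u3)" k "c - d + (a - t) - k - h" "m - c + d - (a - t)"])
      (simp only: block_counts_def eq prod.case; intro conjI; (use s t u3 R hk in \<open>smt (verit)\<close>))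
qed

section \<open>The crystal operators in string coordinates\<close>

lemma nat_minus_1: "nat (x - 1) = nat x - 1"
  by linarith

lemma cr_e_I2_iblocks:
  assumes "0 \<le> u3" "0 \<le> u2" "0 \<le> v5" "0 \<le> v4" "v3 = 0 \<or> v3 = 1" "0 \<le> v2" "0 \<le> v1"
  shows "cr_e I2 (iblocks u4 u3 u2 u1 v5 v4 v3 v2 v1) =
    (if u2 < v5 + v2 - v4 \<and> v4 < v2 then Some (iblocks u4 u3 u2 u1 v5 v4 v3 (v2 - 1) (v1 + 1))
     else if u2 < v5 \<and> v2 \<le> v4 then Some (iblocks u4 u3 u2 u1 (v5 - 1) (v4 + 1) v3 v2 v1)
     else if 0 < u3 then Some (iblocks u4 (u3 - 1) (u2 + 1) u1 v5 v4 v3 v2 v1)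
     else None)"
proof -
  have "nat v3 \<le> 1" using assms by auto
  have "nat u2 < nat v5 + (nat v2 - nat v4) \<longleftrightarrow>
      u2 < v5 + v2 - v4 \<and> v4 < v2 \<or> u2 < v5 \<and> v2 \<le> v4"
    using assms by linarith
  then show ?thesis
    using assms unfolding iblocks_def cr_e_I2_blocks[OF \<open>nat v3 \<le> 1\<close>]
    by (auto simp: nat_add_distrib nat_minus_1)
qed

lemma cr_f_I2_iblocks:
  assumes "0 \<le> u3" "0 \<le> u2" "0 \<le> v5" "0 \<le> v4" "v3 = 0 \<or> v3 = 1" "0 \<le> v2" "0 \<le> v1"
  shows "cr_f I2 (iblocks u4 u3 u2 u1 v5 v4 v3 v2 v1) =
    (if v5 < u2 \<and> v5 + v2 - v4 < u2 then Some (iblocks u4 (u3 + 1) (u2 - 1) u1 v5 v4 v3 v2 v1)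
     else if v2 < v4 then Some (iblocks u4 u3 u2 u1 (v5 + 1) (v4 - 1) v3 v2 v1)
     else if 0 < v1 then Some (iblocks u4 u3 u2 u1 v5 v4 v3 (v2 + 1) (v1 - 1))
     else None)"
proof -
  have "nat v3 \<le> 1" using assms by auto
  have "nat v5 + (nat v2 - nat v4) < nat u2 \<longleftrightarrow> v5 < u2 \<and> v5 + v2 - v4 < u2"
    using assms by linarith
  then show ?thesis
    using assms unfolding iblocks_def cr_f_I2_blocks[OF \<open>nat v3 \<le> 1\<close>]
    by (auto simp: nat_add_distrib nat_minus_1)
qed

lemma cr_e_I1_iblocks:
  assumes "0 \<le> u4" "0 \<le> u3" "0 \<le> u2" "0 \<le> u1" "0 \<le> v4" "v3 = 0 \<or> v3 = 1" "0 \<le> v2"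
  shows "cr_e I1 (iblocks u4 u3 u2 u1 v5 v4 v3 v2 v1) =
    (if u3 < u2 + 2 * v4 + v3 - u1 \<and> u1 < 2 * v4 + v3
     then if v3 = 1 then Some (iblocks u4 u3 u2 u1 v5 v4 0 (v2 + 1) v1)
          else Some (iblocks u4 u3 u2 u1 v5 (v4 - 1) 1 v2 v1)
     else if u3 < u2 \<and> 2 * v4 + v3 \<le> u1
     then Some (iblocks u4 u3 (u2 - 1) (u1 + 1) v5 v4 v3 v2 v1)
     else if 0 < u4 then Some (iblocks (u4 - 1) (u3 + 1) u2 u1 v5 v4 v3 v2 v1)
     else None)"
proof -
  have "nat v3 \<le> 1" using assms by auto
  have "nat u3 < nat u2 + (2 * nat v4 + nat v3 - nat u1) \<longleftrightarrow>
      u3 < u2 + 2 * v4 + v3 - u1 \<and> u1 < 2 * v4 + v3 \<or> u3 < u2 \<and> 2 * v4 + v3 \<le> u1"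
    using assms by linarith
  moreover have "nat u1 < 2 * nat v4 + nat v3 \<longleftrightarrow> u1 < 2 * v4 + v3" "nat v3 = 1 \<longleftrightarrow> v3 = 1"
    using assms by linarith+
  ultimately show ?thesis
    using assms(1-5,7) unfolding iblocks_def cr_e_I1_blocks[OF \<open>nat v3 \<le> 1\<close>]
    by (auto simp: nat_add_distrib nat_minus_1)
qed

lemma cr_f_I1_iblocks:
  assumes "0 \<le> u4" "0 \<le> u3" "0 \<le> u2" "0 \<le> u1" "0 \<le> v4" "v3 = 0 \<or> v3 = 1" "0 \<le> v2"
  shows "cr_f I1 (iblocks u4 u3 u2 u1 v5 v4 v3 v2 v1) =
    (if u2 < u3 \<and> u2 + 2 * v4 + v3 - u1 < u3
     then Some (iblocks (u4 + 1) (u3 - 1) u2 u1 v5 v4 v3 v2 v1)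
     else if 2 * v4 + v3 < u1 then Some (iblocks u4 u3 (u2 + 1) (u1 - 1) v5 v4 v3 v2 v1)
     else if v3 = 1 then Some (iblocks u4 u3 u2 u1 v5 (v4 + 1) 0 v2 v1)
     else if 0 < v2 then Some (iblocks u4 u3 u2 u1 v5 v4 1 (v2 - 1) v1)
     else None)"
proof -
  have "nat v3 \<le> 1" using assms by auto
  have "nat u2 + (2 * nat v4 + nat v3 - nat u1) < nat u3 \<longleftrightarrow>
      u2 < u3 \<and> u2 + 2 * v4 + v3 - u1 < u3"
    using assms by linarith
  moreover have "2 * nat v4 + nat v3 < nat u1 \<longleftrightarrow> 2 * v4 + v3 < u1" "nat v3 = 1 \<longleftrightarrow> v3 = 1"
    using assms by linarith+
  ultimately show ?thesis
    using assms(1-5,7) unfolding iblocks_def cr_f_I1_blocks[OF \<open>nat v3 \<le> 1\<close>]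
    by (auto simp: nat_add_distrib nat_minus_1)
qed

text \<open>Each branch of the tensor product rule changes two block lengths by one. It suffices
  that the new lengths satisfy \<open>block_counts\<close> for the raised string, which is linear
  arithmetic branch by branch; \<open>str_word_eqI\<close> then identifies the words.\<close>

lemma cr_e_str_word:
  assumes "s \<in> strs \<kappa>"
  shows "cr_e i (str_word \<kappa> s) =
    (if 0 < str_eps i s then Some (str_word \<kappa> (str_raise i s)) else None)"
proof -
  obtain l m a b c d where eq: "\<kappa> = (l, m)" "s = (a, b, c, d)"
    by (cases \<kappa>; cases s) auto
  have s: "0 \<le> a" "0 \<le> d" "d \<le> c" "c \<le> b" "d \<le> l" "c \<le> m + d"
     "b \<le> l - 2 * d + 2 * c" "a \<le> m - 2 * c + b + d"
    using assms by (simp_all add: strs_def eq)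
  obtain u4 u3 u2 u1 v5 v4 v3 v2 v1 where u: "block_counts \<kappa> s u4 u3 u2 u1 v5 v4 v3 v2 v1"
    using block_counts_exist[OF assms] by blast
  note w = str_word_eqI[OF u] and rel = u[unfolded block_counts_def eq prod.case]
  show ?thesis
  proof (cases i)
    case I2
    have 1: "0 < a \<and> block_counts \<kappa> (a - 1, b, c, d) u4 u3 u2 u1 v5 v4 v3 (v2 - 1) (v1 + 1)"
      if "u2 < v5 + v2 - v4" "v4 < v2"
      unfolding block_counts_def eq prod.case using that s rel by (smt (verit))
    have 2: "0 < a \<and> block_counts \<kappa> (a - 1, b, c, d) u4 u3 u2 u1 (v5 - 1) (v4 + 1) v3 v2 v1"
      if "u2 < v5" "v2 \<le> v4"
      unfolding block_counts_def eq prod.case using that s rel by (smt (verit))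
    have 3: "0 < a \<and> block_counts \<kappa> (a - 1, b, c, d) u4 (u3 - 1) (u2 + 1) u1 v5 v4 v3 v2 v1"
      if "\<not> (u2 < v5 + v2 - v4 \<and> v4 < v2)" "\<not> (u2 < v5 \<and> v2 \<le> v4)" "0 < u3"
      unfolding block_counts_def eq prod.case using that s rel by (smt (verit))
    have 4: "\<not> 0 < a"
      if "\<not> (u2 < v5 + v2 - v4 \<and> v4 < v2)" "\<not> (u2 < v5 \<and> v2 \<le> v4)" "\<not> 0 < u3"
      using that s rel by (smt (verit))
    have "cr_e I2 (str_word \<kappa> s) =
    (if u2 < v5 + v2 - v4 \<and> v4 < v2 then Some (iblocks u4 u3 u2 u1 v5 v4 v3 (v2 - 1) (v1 + 1))
     else if u2 < v5 \<and> v2 \<le> v4 then Some (iblocks u4 u3 u2 u1 (v5 - 1) (v4 + 1) v3 v2 v1)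
     else if 0 < u3 then Some (iblocks u4 (u3 - 1) (u2 + 1) u1 v5 v4 v3 v2 v1)
     else None)"
      unfolding w using rel by (intro cr_e_I2_iblocks) auto
    then show ?thesis
      using 1 2 3 4 unfolding I2
      by (auto simp: eq str_word_eqI simp del: str_word.simps)
  next
    case I1
    obtain a' b' c' d' where s': "str_raise I1 s = (a', b', c', d')"
      by (cases "str_raise I1 s")
    have r: "d < b - 2 * a \<and> a < b - c \<and> a' = a \<and> b' = b - 1 \<and> c' = c \<and> d' = d \<or>
      b - c \<le> a \<and> d < 2 * c - b \<and> a' = a + 1 \<and> b' = b - 1 \<and> c' = c - 1 \<and> d' = d \<or>
      b - 2 * a \<le> d \<and> 2 * c - b \<le> d \<and> a' = a + 1 \<and> b' = b \<and> c' = c - 1 \<and> d' = d - 1"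
      using s' by (auto simp: eq split: if_splits)
    define P where "P \<longleftrightarrow> (0 < d \<or> 0 < 2 * c - b \<or> 0 < b - 2 * a)"
    have 1: "P \<and> str_word \<kappa> (a', b', c', d') = iblocks u4 u3 u2 u1 v5 v4 0 (v2 + 1) v1"
      if "u3 < u2 + 2 * v4 + v3 - u1" "u1 < 2 * v4 + v3" "v3 = 1"
    proof -
      have "P \<and> block_counts \<kappa> (a', b', c', d') u4 u3 u2 u1 v5 v4 0 (v2 + 1) v1"
        unfolding P_def block_counts_def eq prod.case using that s rel r by (smt (z3))
      then show ?thesis using str_word_eqI by blast
    qed
    have 2: "P \<and> str_word \<kappa> (a', b', c', d') = iblocks u4 u3 u2 u1 v5 (v4 - 1) 1 v2 v1"
      if "u3 < u2 + 2 * v4 + v3 - u1" "u1 < 2 * v4 + v3" "v3 \<noteq> 1"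
    proof -
      have "P \<and> block_counts \<kappa> (a', b', c', d') u4 u3 u2 u1 v5 (v4 - 1) 1 v2 v1"
        unfolding P_def block_counts_def eq prod.case using that s rel r by (smt (z3))
      then show ?thesis using str_word_eqI by blast
    qed
    have 3: "P \<and> str_word \<kappa> (a', b', c', d') = iblocks u4 u3 (u2 - 1) (u1 + 1) v5 v4 v3 v2 v1"
      if "u3 < u2" "2 * v4 + v3 \<le> u1"
    proof -
      have "P \<and> block_counts \<kappa> (a', b', c', d') u4 u3 (u2 - 1) (u1 + 1) v5 v4 v3 v2 v1"
        unfolding P_def block_counts_def eq prod.case using that s rel r by (smt (z3))
      then show ?thesis using str_word_eqI by blast
    qed
    have 4: "P \<and> str_word \<kappa> (a', b', c', d') = iblocks (u4 - 1) (u3 + 1) u2 u1 v5 v4 v3 v2 v1"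
      if "\<not> (u3 < u2 + 2 * v4 + v3 - u1 \<and> u1 < 2 * v4 + v3)" "\<not> (u3 < u2 \<and> 2 * v4 + v3 \<le> u1)" "0 < u4"
    proof -
      have "P \<and> block_counts \<kappa> (a', b', c', d') (u4 - 1) (u3 + 1) u2 u1 v5 v4 v3 v2 v1"
        unfolding P_def block_counts_def eq prod.case using that s rel r by (smt (z3))
      then show ?thesis using str_word_eqI by blast
    qed
    have 5: "\<not> P"
      if "\<not> (u3 < u2 + 2 * v4 + v3 - u1 \<and> u1 < 2 * v4 + v3)" "\<not> (u3 < u2 \<and> 2 * v4 + v3 \<le> u1)" "\<not> 0 < u4"
      unfolding P_def using that s rel r by (smt (z3))
    have "cr_e I1 (str_word \<kappa> s) =
    (if u3 < u2 + 2 * v4 + v3 - u1 \<and> u1 < 2 * v4 + v3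
     then if v3 = 1 then Some (iblocks u4 u3 u2 u1 v5 v4 0 (v2 + 1) v1)
          else Some (iblocks u4 u3 u2 u1 v5 (v4 - 1) 1 v2 v1)
     else if u3 < u2 \<and> 2 * v4 + v3 \<le> u1
     then Some (iblocks u4 u3 (u2 - 1) (u1 + 1) v5 v4 v3 v2 v1)
     else if 0 < u4 then Some (iblocks (u4 - 1) (u3 + 1) u2 u1 v5 v4 v3 v2 v1)
     else None)"
      unfolding w using rel by (intro cr_e_I1_iblocks) auto
    moreover have "(0 < str_eps I1 s) = P"
      by (auto simp: eq less_max_iff_disj P_def)
    moreover note 1 2 3 4 5
    ultimately show ?thesis
      unfolding I1 s' by (auto simp del: str_word.simps str_eps.simps str_raise.simps str_lower.simps)
  qed
qed

lemma cr_f_str_word: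
  assumes "s \<in> strs \<kappa>"
  shows "cr_f i (str_word \<kappa> s) =
    (if 0 < str_phi \<kappa> i s then Some (str_word \<kappa> (str_lower i s)) else None)"
proof -
  obtain l m a b c d where eq: "\<kappa> = (l, m)" "s = (a, b, c, d)"
    by (cases \<kappa>; cases s) auto
  have s: "0 \<le> a" "0 \<le> d" "d \<le> c" "c \<le> b" "d \<le> l" "c \<le> m + d"
     "b \<le> l - 2 * d + 2 * c" "a \<le> m - 2 * c + b + d"
    using assms by (simp_all add: strs_def eq)
  obtain u4 u3 u2 u1 v5 v4 v3 v2 v1 where u: "block_counts \<kappa> s u4 u3 u2 u1 v5 v4 v3 v2 v1"
    using block_counts_exist[OF assms] by blast
  note w = str_word_eqI[OF u] and rel = u[unfolded block_counts_def eq prod.case]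
  show ?thesis
  proof (cases i)
    case I2
    have 1: "0 < a + (m + b + d - 2 * (a + c)) \<and> block_counts \<kappa> (a + 1, b, c, d) u4 (u3 + 1) (u2 - 1) u1 v5 v4 v3 v2 v1"
      if "v5 < u2" "v5 + v2 - v4 < u2"
      unfolding block_counts_def eq prod.case using that s rel by (smt (verit))
    have 2: "0 < a + (m + b + d - 2 * (a + c)) \<and> block_counts \<kappa> (a + 1, b, c, d) u4 u3 u2 u1 (v5 + 1) (v4 - 1) v3 v2 v1"
      if "\<not> (v5 < u2 \<and> v5 + v2 - v4 < u2)" "v2 < v4"
      unfolding block_counts_def eq prod.case using that s rel by (smt (verit))
    have 3: "0 < a + (m + b + d - 2 * (a + c)) \<and> block_counts \<kappa> (a + 1, b, c, d) u4 u3 u2 u1 v5 v4 v3 (v2 + 1) (v1 - 1)"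
      if "\<not> (v5 < u2 \<and> v5 + v2 - v4 < u2)" "\<not> v2 < v4" "0 < v1"
      unfolding block_counts_def eq prod.case using that s rel by (smt (verit))
    have 4: "\<not> 0 < a + (m + b + d - 2 * (a + c))"
      if "\<not> (v5 < u2 \<and> v5 + v2 - v4 < u2)" "\<not> v2 < v4" "\<not> 0 < v1"
      using that s rel by (smt (verit))
    have "cr_f I2 (str_word \<kappa> s) =
    (if v5 < u2 \<and> v5 + v2 - v4 < u2 then Some (iblocks u4 (u3 + 1) (u2 - 1) u1 v5 v4 v3 v2 v1)
     else if v2 < v4 then Some (iblocks u4 u3 u2 u1 (v5 + 1) (v4 - 1) v3 v2 v1)
     else if 0 < v1 then Some (iblocks u4 u3 u2 u1 v5 v4 v3 (v2 + 1) (v1 - 1))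
     else None)"
      unfolding w using rel by (intro cr_f_I2_iblocks) auto
    then show ?thesis
      using 1 2 3 4 unfolding I2
      by (auto simp: str_phi_def eq str_word_eqI simp del: str_word.simps)
  next
    case I1
    obtain a' b' c' d' where s': "str_lower I1 s = (a', b', c', d')"
      by (cases "str_lower I1 s")
    have r: "d \<le> b - 2 * a \<and> a \<le> b - c \<and> a' = a \<and> b' = b + 1 \<and> c' = c \<and> d' = d \<or>
      b - c < a \<and> d \<le> 2 * c - b \<and> a' = a - 1 \<and> b' = b + 1 \<and> c' = c + 1 \<and> d' = d \<or>
      b - 2 * a < d \<and> 2 * c - b < d \<and> a' = a - 1 \<and> b' = b \<and> c' = c + 1 \<and> d' = d + 1"
      using s' by (auto simp: eq split: if_splits)
    define x where "x = l - 2 * (b + d) + 2 * (a + c)"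
    define P where "P \<longleftrightarrow> (0 < d + x \<or> 0 < 2 * c - b + x \<or> 0 < b - 2 * a + x)"
    have 1: "P \<and> str_word \<kappa> (a', b', c', d') = iblocks (u4 + 1) (u3 - 1) u2 u1 v5 v4 v3 v2 v1"
      if "u2 < u3" "u2 + 2 * v4 + v3 - u1 < u3"
    proof -
      have "P \<and> block_counts \<kappa> (a', b', c', d') (u4 + 1) (u3 - 1) u2 u1 v5 v4 v3 v2 v1"
        unfolding P_def block_counts_def eq prod.case using that s rel r x_def by (smt (z3))
      then show ?thesis using str_word_eqI by blast
    qed
    have 2: "P \<and> str_word \<kappa> (a', b', c', d') = iblocks u4 u3 (u2 + 1) (u1 - 1) v5 v4 v3 v2 v1"
      if "\<not> (u2 < u3 \<and> u2 + 2 * v4 + v3 - u1 < u3)" "2 * v4 + v3 < u1"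
    proof -
      have "P \<and> block_counts \<kappa> (a', b', c', d') u4 u3 (u2 + 1) (u1 - 1) v5 v4 v3 v2 v1"
        unfolding P_def block_counts_def eq prod.case using that s rel r x_def by (smt (z3))
      then show ?thesis using str_word_eqI by blast
    qed
    have 3: "P \<and> str_word \<kappa> (a', b', c', d') = iblocks u4 u3 u2 u1 v5 (v4 + 1) 0 v2 v1"
      if "\<not> (u2 < u3 \<and> u2 + 2 * v4 + v3 - u1 < u3)" "\<not> 2 * v4 + v3 < u1" "v3 = 1"
    proof -
      have "P \<and> block_counts \<kappa> (a', b', c', d') u4 u3 u2 u1 v5 (v4 + 1) 0 v2 v1"
        unfolding P_def block_counts_def eq prod.case using that s rel r x_def by (smt (z3))
      then show ?thesis using str_word_eqI by blast
    qed
    have 4: "P \<and> str_word \<kappa> (a', b', c', d') = iblocks u4 u3 u2 u1 v5 v4 1 (v2 - 1) v1"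
      if "\<not> (u2 < u3 \<and> u2 + 2 * v4 + v3 - u1 < u3)" "\<not> 2 * v4 + v3 < u1" "v3 \<noteq> 1" "0 < v2"
    proof -
      have "P \<and> block_counts \<kappa> (a', b', c', d') u4 u3 u2 u1 v5 v4 1 (v2 - 1) v1"
        unfolding P_def block_counts_def eq prod.case using that s rel r x_def by (smt (z3))
      then show ?thesis using str_word_eqI by blast
    qed
    have 5: "\<not> P"
      if "\<not> (u2 < u3 \<and> u2 + 2 * v4 + v3 - u1 < u3)" "\<not> 2 * v4 + v3 < u1" "v3 \<noteq> 1" "\<not> 0 < v2"
      unfolding P_def using that s rel r x_def by (smt (z3))
    have "cr_f I1 (str_word \<kappa> s) =
    (if u2 < u3 \<and> u2 + 2 * v4 + v3 - u1 < u3
     then Some (iblocks (u4 + 1) (u3 - 1) u2 u1 v5 v4 v3 v2 v1)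
     else if 2 * v4 + v3 < u1 then Some (iblocks u4 u3 (u2 + 1) (u1 - 1) v5 v4 v3 v2 v1)
     else if v3 = 1 then Some (iblocks u4 u3 u2 u1 v5 (v4 + 1) 0 v2 v1)
     else if 0 < v2 then Some (iblocks u4 u3 u2 u1 v5 v4 1 (v2 - 1) v1)
     else None)"
      unfolding w using rel by (intro cr_f_I1_iblocks) auto
    moreover have "(0 < str_phi \<kappa> I1 s) = P"
      by (auto simp: eq str_phi_def x_def max_def P_def)
    moreover note 1 2 3 4 5
    ultimately show ?thesis
      unfolding I1 s' by (auto simp del: str_word.simps str_eps.simps str_raise.simps str_lower.simps)
  qed
qed

declare str_word.simps [simp del]

lemma wt_append [simp]: "wt (x @ y) = wt x + wt y"
  by (simp add: wt_def)

lemma wt_replicate [simp]: "wt (replicate n x) = scale (int n) (letter_wt x)"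
  by (induction n) (auto simp: wt_def scale_def zero_prod_def algebra_simps prod_eq_iff)

lemma wt_str_word:
  assumes "s \<in> strs \<kappa>"
  shows "wt (str_word \<kappa> s) = str_wt \<kappa> s"
proof -
  obtain l m a b c d where eq: "\<kappa> = (l, m)" "s = (a, b, c, d)"
    by (cases \<kappa>; cases s) auto
  obtain u4 u3 u2 u1 v5 v4 v3 v2 v1 where u: "block_counts \<kappa> s u4 u3 u2 u1 v5 v4 v3 v2 v1"
    using block_counts_exist[OF assms] by blast
  note rel = u[unfolded block_counts_def eq prod.case]
  have "wt (str_word \<kappa> s) = (u1 - u2 + u3 - u4 + 2 * v2 - 2 * v4, u2 - u3 + v1 - v2 + v4 - v5)"
    using rel unfolding str_word_eqI[OF u] iblocks_def blocks_def
    by (auto simp: scale_def)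
  also have "\<dots> = str_wt \<kappa> s"
    using rel unfolding eq str_wt.simps by (simp; smt (verit))
  finally show ?thesis .
qed

section \<open>Powers of the string operators\<close>

lemma str_eps_nonneg: "s \<in> strs \<kappa> \<Longrightarrow> 0 \<le> str_eps i s"
  by (cases s; cases i) (auto simp: strs_def)

lemma str_phi_nonneg: "s \<in> strs \<kappa> \<Longrightarrow> 0 \<le> str_phi \<kappa> i s"
  by (cases s; cases i; cases \<kappa>) (auto simp: strs_def str_phi_def)

lemma str_eps_raise:
  "s \<in> strs \<kappa> \<Longrightarrow> 0 < str_eps i s \<Longrightarrow> str_eps i (str_raise i s) = str_eps i s - 1"
  by (cases s; cases i; auto simp: strs_def max_def; presburger)

lemma str_eps_lower:
  "str_eps i (str_lower i s) = str_eps i s + 1"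
  by (cases s; cases i; auto simp: max_def; presburger)

lemma str_lower_raise:
  "s \<in> strs \<kappa> \<Longrightarrow> 0 < str_eps i s \<Longrightarrow> str_lower i (str_raise i s) = s"
  by (cases s; cases i; auto simp: strs_def; presburger)

lemma str_raise_lower: "str_raise i (str_lower i s) = s"
  by (cases s; cases i; auto; presburger)

lemma scale_Suc: "scale (int (Suc k)) \<beta> = scale (int k) \<beta> + \<beta>"
  by (simp add: scale_def prod_eq_iff algebra_simps)

definition simple_root :: "idx \<Rightarrow> weight" where
  "simple_root i = (case i of I1 \<Rightarrow> \<alpha>1 | I2 \<Rightarrow> \<alpha>2)"

lemma str_wt_raise: "str_wt \<kappa> (str_raise i s) = str_wt \<kappa> s + simple_root i"
  by (cases s; cases i; cases \<kappa>) (auto simp: simple_root_def \<alpha>1_def \<alpha>2_def)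

lemma str_wt_lower: "str_wt \<kappa> (str_lower i s) = str_wt \<kappa> s - simple_root i"
  by (cases s; cases i; cases \<kappa>) (auto simp: simple_root_def \<alpha>1_def \<alpha>2_def)

lemma str_phi_raise:
  "s \<in> strs \<kappa> \<Longrightarrow> 0 < str_eps i s \<Longrightarrow> str_phi \<kappa> i (str_raise i s) = str_phi \<kappa> i s + 1"
  by (cases i) (simp_all add: str_phi_def str_eps_raise str_wt_raise simple_root_def \<alpha>1_def \<alpha>2_def del: str_raise.simps)

lemma str_phi_lower: "str_phi \<kappa> i (str_lower i s) = str_phi \<kappa> i s - 1"
  by (cases i) (simp_all add: str_phi_def str_eps_lower str_wt_lower simple_root_def \<alpha>1_def \<alpha>2_def del: str_lower.simps)

declare str_raise.simps [simp del] str_lower.simps [simp del]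

lemma funpow_raise:
  assumes "s \<in> strs \<kappa>"
  shows "int k \<le> str_eps i s \<Longrightarrow>
    (str_raise i ^^ k) s \<in> strs \<kappa> \<and> str_eps i ((str_raise i ^^ k) s) = str_eps i s - int k \<and>
    str_phi \<kappa> i ((str_raise i ^^ k) s) = str_phi \<kappa> i s + int k \<and>
    str_wt \<kappa> ((str_raise i ^^ k) s) = str_wt \<kappa> s + scale (int k) (simple_root i) \<and>
    (str_lower i ^^ k) ((str_raise i ^^ k) s) = s"
proof (induction k)
  case 0 then show ?case using assms by (simp add: scale_def zero_prod_def)
next
  case (Suc k)
  let ?t = "(str_raise i ^^ k) s"
  have "(str_lower i ^^ Suc k) ((str_raise i ^^ Suc k) s) = (str_lower i ^^ k) (str_lower i (str_raise i ?t))"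
    by (simp only: funpow_Suc_right comp_apply) (simp add: funpow_swap1)
  moreover have t: "?t \<in> strs \<kappa>" "0 < str_eps i ?t" using Suc by auto
  ultimately show ?case
    using Suc str_eps_raise[OF t] str_phi_raise[OF t] str_lower_raise[OF t] str_raise_in_strs[OF t]
    by (simp add: str_wt_raise scale_Suc del: of_nat_Suc)
qed

lemma funpow_lower:
  assumes "s \<in> strs \<kappa>"
  shows "int k \<le> str_phi \<kappa> i s \<Longrightarrow>
    (str_lower i ^^ k) s \<in> strs \<kappa> \<and> str_eps i ((str_lower i ^^ k) s) = str_eps i s + int k \<and>
    str_phi \<kappa> i ((str_lower i ^^ k) s) = str_phi \<kappa> i s - int k \<and>
    str_wt \<kappa> ((str_lower i ^^ k) s) = str_wt \<kappa> s - scale (int k) (simple_root i) \<and>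
    (str_raise i ^^ k) ((str_lower i ^^ k) s) = s"
proof (induction k)
  case 0 then show ?case using assms by (simp add: scale_def zero_prod_def)
next
  case (Suc k)
  let ?t = "(str_lower i ^^ k) s"
  have "(str_raise i ^^ Suc k) ((str_lower i ^^ Suc k) s) = (str_raise i ^^ k) (str_raise i (str_lower i ?t))"
    by (simp only: funpow_Suc_right comp_apply) (simp add: funpow_swap1)
  then show ?case
    using Suc by (simp add: str_lower_in_strs str_eps_lower str_phi_lower str_wt_lower str_raise_lower
        scale_Suc del: of_nat_Suc)
qed

lemma iter_cr_e:
  assumes "s \<in> strs \<kappa>"
  shows "iter (cr_e i) k (str_word \<kappa> s) =
    (if int k \<le> str_eps i s then Some (str_word \<kappa> ((str_raise i ^^ k) s)) else None)"
proof (induction k)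
  case 0 then show ?case using str_eps_nonneg[OF assms] by simp
next
  case (Suc k)
  show ?case using funpow_raise[OF assms, of k i] by (auto simp: Suc cr_e_str_word)
qed

lemma iter_cr_f:
  assumes "s \<in> strs \<kappa>"
  shows "iter (cr_f i) k (str_word \<kappa> s) =
    (if int k \<le> str_phi \<kappa> i s then Some (str_word \<kappa> ((str_lower i ^^ k) s)) else None)"
proof (induction k)
  case 0 then show ?case using str_phi_nonneg[OF assms] by simp
next
  case (Suc k)
  show ?case using funpow_lower[OF assms, of k i] by (auto simp: Suc cr_f_str_word)
qed

lemma eps_str_word:
  assumes "s \<in> strs \<kappa>"
  shows "int (eps i (str_word \<kappa> s)) = str_eps i s"
proof -
  have "eps i (str_word \<kappa> s) = nat (str_eps i s)"
    unfolding eps_def using str_eps_nonneg[OF assms, of i]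
    by (intro max_iter_eqI) (auto simp: iter_cr_e[OF assms] simp del: iter.simps)
  then show ?thesis using str_eps_nonneg[OF assms] by simp
qed

lemma phi_str_word:
  assumes "s \<in> strs \<kappa>"
  shows "int (phi i (str_word \<kappa> s)) = str_phi \<kappa> i s"
proof -
  have "phi i (str_word \<kappa> s) = nat (str_phi \<kappa> i s)"
    unfolding phi_def using str_phi_nonneg[OF assms, of i]
    by (intro max_iter_eqI) (auto simp: iter_cr_f[OF assms] simp del: iter.simps)
  then show ?thesis using str_phi_nonneg[OF assms] by simp
qed

lemma e_top_str_word:
  assumes "s \<in> strs \<kappa>" "int k = str_eps i s"
  shows "e_top i (str_word \<kappa> s) = str_word \<kappa> ((str_raise i ^^ k) s)"
proof -
  have "eps i (str_word \<kappa> s) = k" using eps_str_word[OF assms(1), of i] assms(2) by simp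
  then show ?thesis using assms by (simp add: e_top_def iter_cr_e)
qed

subsection \<open>The crystal is the set of lattice points of the string polytope\<close>

lemma zero_in_strs: "dominant \<kappa> \<Longrightarrow> (0, 0, 0, 0) \<in> strs \<kappa>"
  by (auto simp: dominant_def strs_def)

lemma str_word_zero:
  assumes "dominant \<kappa>"
  shows "str_word \<kappa> (0, 0, 0, 0) =
    replicate (nat (fst \<kappa>)) U1 @ replicate (nat (snd \<kappa>)) V1"
proof -
  have "block_counts \<kappa> (0, 0, 0, 0) 0 0 0 (fst \<kappa>) 0 0 0 0 (snd \<kappa>)"
    using assms by (cases \<kappa>) (auto simp: block_counts_def dominant_def)
  then show ?thesis by (simp add: str_word_eqI iblocks_def blocks_def)
qed

lemma str_eps_zero:
  assumes "s \<in> strs \<kappa>" "\<And>i. str_eps i s = 0"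
  shows "s = (0, 0, 0, 0)"
  using assms(1) assms(2)[of I1] assms(2)[of I2] by (cases s) (auto simp: strs_def)

text \<open>The words of strings contain the highest weight word and are closed under both
  operators. Conversely, a nonzero string can be raised; this decreases the sum of its entries, and
  the inverse lowering step stays inside the crystal.\<close>

lemma crystal_eq:
  assumes "dominant \<kappa>"
  shows "crystal \<kappa> = str_word \<kappa> ` strs \<kappa>"
proof
  show "crystal \<kappa> \<subseteq> str_word \<kappa> ` strs \<kappa>"
  proof
    fix T assume "T \<in> crystal \<kappa>"
    then show "T \<in> str_word \<kappa> ` strs \<kappa>"
    proof (induction rule: crystal.induct)
      case highest
      then show ?case using str_word_zero[OF assms] zero_in_strs[OF assms] by (metis image_eqI)
    next
      case (lower T i T')
      then show ?case
        by (auto simp: cr_f_str_word split: if_splits intro!: imageI str_lower_in_strs)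
    next
      case (raise T i T')
      then show ?case
        by (auto simp: cr_e_str_word split: if_splits intro!: imageI str_raise_in_strs)
    qed
  qed
  have "str_word \<kappa> s \<in> crystal \<kappa>" if "s \<in> strs \<kappa>" for s
    using that
  proof (induction "case s of (a, b, c, d) \<Rightarrow> nat (a + b + c + d)" arbitrary: s rule: less_induct)
    case less
    show ?case
    proof (cases "\<forall>i. str_eps i s = 0")
      case True
      then have "s = (0, 0, 0, 0)" using str_eps_zero[OF less.prems] by blast
      then show ?thesis using str_word_zero[OF assms] crystal.highest by simp
    next
      case False
      then obtain i where i: "0 < str_eps i s"
        using str_eps_nonneg[OF less.prems] by (metis order_le_less)
      let ?s' = "str_raise i s"
      have s': "?s' \<in> strs \<kappa>" using str_raise_in_strs[OF less.prems i] .
      have "(case ?s' of (a, b, c, d) \<Rightarrow> nat (a + b + c + d)) <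
          (case s of (a, b, c, d) \<Rightarrow> nat (a + b + c + d))"
        using less.prems i
        by (cases s; cases i) (auto simp: str_raise.simps strs_def)
      then have "str_word \<kappa> ?s' \<in> crystal \<kappa>" using less.hyps s' by blast
      moreover have "cr_f i (str_word \<kappa> ?s') = Some (str_word \<kappa> s)"
        using s' str_phi_nonneg[OF less.prems, of i] str_phi_raise[OF less.prems i]
        by (simp add: cr_f_str_word str_lower_raise[OF less.prems i])
      ultimately show ?thesis using crystal.lower by blast
    qed
  qed
  then show "str_word \<kappa> ` strs \<kappa> \<subseteq> crystal \<kappa>" by blast
qed

lemma str2_str_word:
  assumes "(a, b, c, d) \<in> strs \<kappa>"
  shows "str2 (str_word \<kappa> (a, b, c, d)) = (nat a, nat b, nat c, nat d)"
proof -
  have s: "0 \<le> a" "0 \<le> d" "d \<le> c" "c \<le> b" using assms by (auto simp: strs_def)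
  have I2: "(str_raise I2 ^^ n) (x, y, z, w) = (x - int n, y, z, w)" for n x y z w
    by (induction n) (auto simp: str_raise.simps)
  \<comment> \<open>The \<open>b\<close> raising steps from \<open>(0, b, c, d)\<close> pass through
    the three branches of \<open>str_raise\<close> in turn, for \<open>b - c\<close>,
    \<open>c - d\<close> and \<open>d\<close> steps, and end in \<open>(c, d, 0, 0)\<close>.\<close>
  have 1: "(str_raise I1 ^^ n) (0, b, c, d) = (0, b - int n, c, d)" if "int n \<le> b - c" for n
    using that s by (induction n) (auto simp: str_raise.simps)
  have 2: "(str_raise I1 ^^ n) (0, c, c, d) = (int n, c - int n, c - int n, d)"
    if "int n \<le> c - d" for n
    using that s by (induction n) (auto simp: str_raise.simps)
  have 3: "(str_raise I1 ^^ n) (c - d, d, d, d) = (c - d + int n, d, d - int n, d - int n)"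
    if "int n \<le> d" for n
    using that s by (induction n) (auto simp: str_raise.simps)
  have 4: "(str_raise I1 ^^ n) (0, d, 0, 0) = (0, d - int n, 0, 0)" if "int n \<le> d" for n
    using that s by (induction n) (auto simp: str_raise.simps)
  have "nat b = nat d + (nat (c - d) + nat (b - c))" using s by linarith
  then have b: "(str_raise I1 ^^ nat b) (0, b, c, d) = (c, d, 0, 0)"
    using s by (simp only: funpow_add comp_apply) (simp add: 1 2 3)
  have in1: "(0, b, c, d) \<in> strs \<kappa>"
    using funpow_raise[OF assms, of "nat a" I2] s by (simp add: I2)
  have in2: "(c, d, 0, 0) \<in> strs \<kappa>"
    using funpow_raise[OF in1, of "nat b" I1] s by (simp add: b)
  have in3: "(0, d, 0, 0) \<in> strs \<kappa>"
    using funpow_raise[OF in2, of "nat c" I2] s by (simp add: I2)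
  have t1: "e_top I2 (str_word \<kappa> (a, b, c, d)) = str_word \<kappa> (0, b, c, d)"
    using e_top_str_word[OF assms, of "nat a" I2] s by (simp add: I2)
  have t2: "e_top I1 (str_word \<kappa> (0, b, c, d)) = str_word \<kappa> (c, d, 0, 0)"
    using e_top_str_word[OF in1, of "nat b" I1] s by (simp add: b)
  have t3: "e_top I2 (str_word \<kappa> (c, d, 0, 0)) = str_word \<kappa> (0, d, 0, 0)"
    using e_top_str_word[OF in2, of "nat c" I2] s by (simp add: I2)
  have "int (eps I2 (str_word \<kappa> (a, b, c, d))) = a" "int (eps I1 (str_word \<kappa> (0, b, c, d))) = b"
    "int (eps I2 (str_word \<kappa> (c, d, 0, 0))) = c" "int (eps I1 (str_word \<kappa> (0, d, 0, 0))) = d"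
    using s by (simp_all add: eps_str_word assms in1 in2 in3)
  then show ?thesis
    unfolding str2_def t1 t2 t3 by auto
qed

lemma inj_on_str_word: "inj_on (str_word \<kappa>) (strs \<kappa>)"
proof (rule inj_onI)
  fix s s' assume "s \<in> strs \<kappa>" "s' \<in> strs \<kappa>" "str_word \<kappa> s = str_word \<kappa> s'"
  moreover obtain a b c d a' b' c' d' where s: "s = (a, b, c, d)" "s' = (a', b', c', d')"
    by (metis prod_cases4)
  ultimately have "(nat a, nat b, nat c, nat d) = (nat a', nat b', nat c', nat d')"
    using str2_str_word[of a b c d \<kappa>] str2_str_word[of a' b' c' d' \<kappa>] by simp
  moreover have "0 \<le> a" "0 \<le> b" "0 \<le> c" "0 \<le> d" "0 \<le> a'" "0 \<le> b'" "0 \<le> c'" "0 \<le> d'"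
    using \<open>s \<in> strs \<kappa>\<close> \<open>s' \<in> strs \<kappa>\<close> by (simp_all add: s strs_def)
  ultimately show "s = s'" by (simp add: s eq_nat_nat_iff)
qed

subsection \<open>The reflection \<open>s1\<close>\<close>

text \<open>The first weight coordinate is \<open>\<phi>\<^sub>1 - \<epsilon>\<^sub>1\<close>, so
  reversing the 1-string means going that many steps down, or up if it is negative.\<close>

definition str_s1 :: "weight \<Rightarrow> str \<Rightarrow> str" where
  "str_s1 \<kappa> s =
     (if 0 \<le> fst (str_wt \<kappa> s) then (str_lower I1 ^^ nat (fst (str_wt \<kappa> s))) s
      else (str_raise I1 ^^ nat (- fst (str_wt \<kappa> s))) s)"

lemma weight_add_Suc:
  fixes \<kappa> :: weight
  shows "\<kappa> + (0, int n) + (0, 1) = \<kappa> + (0, int (Suc n))"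
    and "\<kappa> + (2 * int n, 0) + (2, 0) = \<kappa> + (2 * int (Suc n), 0)"
  by (cases \<kappa>; simp)+

lemma str_phi_I1: "str_phi \<kappa> I1 s = str_eps I1 s + fst (str_wt \<kappa> s)"
  by (simp add: str_phi_def)

lemma str_s1:
  assumes "s \<in> strs \<kappa>"
  shows str_s1_in_strs: "str_s1 \<kappa> s \<in> strs \<kappa>"
    and str_eps_s1: "str_eps I1 (str_s1 \<kappa> s) = str_phi \<kappa> I1 s"
    and str_wt_s1: "str_wt \<kappa> (str_s1 \<kappa> s) = refl1 (str_wt \<kappa> s)"
    and str_s1_s1: "str_s1 \<kappa> (str_s1 \<kappa> s) = s"
    and s1_str_word: "s1 (str_word \<kappa> s) = str_word \<kappa> (str_s1 \<kappa> s)"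
proof -
  obtain x y where wt: "str_wt \<kappa> s = (x, y)" by fastforce
  have pe: "str_phi \<kappa> I1 s = str_eps I1 s + x" by (simp add: str_phi_I1 wt)
  note nonneg = str_eps_nonneg[OF assms, of I1] str_phi_nonneg[OF assms, of I1]
  have low: "int (nat x) \<le> str_phi \<kappa> I1 s" if "0 \<le> x" using nonneg pe that by simp
  have rai: "int (nat (- x)) \<le> str_eps I1 s" if "x < 0" using nonneg pe that by simp
  note fl = funpow_lower[OF assms low] and fr = funpow_raise[OF assms rai]
  show 1: "str_s1 \<kappa> s \<in> strs \<kappa>"
    using fl fr by (auto simp: str_s1_def wt)
  show "str_eps I1 (str_s1 \<kappa> s) = str_phi \<kappa> I1 s"
    using fl fr by (auto simp: str_s1_def wt pe)
  show 2: "str_wt \<kappa> (str_s1 \<kappa> s) = refl1 (str_wt \<kappa> s)"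
    using fl fr by (auto simp: str_s1_def wt simple_root_def \<alpha>1_def scale_def)
  show "str_s1 \<kappa> (str_s1 \<kappa> s) = s"
    unfolding str_s1_def[of _ "str_s1 \<kappa> s"] 2 using fl fr by (auto simp: str_s1_def wt)
  have "int (eps I1 (str_word \<kappa> s)) = str_eps I1 s" "int (phi I1 (str_word \<kappa> s)) = str_phi \<kappa> I1 s"
    using eps_str_word phi_str_word assms by blast+
  then have "eps I1 (str_word \<kappa> s) \<le> phi I1 (str_word \<kappa> s) \<longleftrightarrow> 0 \<le> x"
    "phi I1 (str_word \<kappa> s) - eps I1 (str_word \<kappa> s) = nat x"
    "eps I1 (str_word \<kappa> s) - phi I1 (str_word \<kappa> s) = nat (- x)"
    using pe by linarith+
  then show "s1 (str_word \<kappa> s) = str_word \<kappa> (str_s1 \<kappa> s)"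
    using low rai by (auto simp: s1_def str_s1_def wt iter_cr_f[OF assms] iter_cr_e[OF assms])
qed

lemma eps12_str_word:
  assumes "s \<in> strs \<kappa>"
  shows "int (eps12 (str_word \<kappa> s)) = str_eps I2 (str_s1 \<kappa> s)"
proof -
  let ?t = "str_s1 \<kappa> s"
  have t: "?t \<in> strs \<kappa>" using str_s1_in_strs[OF assms] .
  have e12: "e12 (str_word \<kappa> (str_s1 \<kappa> t)) =
      (if 0 < str_eps I2 t then Some (str_word \<kappa> (str_s1 \<kappa> (str_raise I2 t))) else None)"
    if "t \<in> strs \<kappa>" for t
    using that str_raise_in_strs[OF that, of I2]
    by (simp add: e12_def s1_str_word str_s1_in_strs str_s1_s1 cr_e_str_word)
  have iter: "iter e12 k (str_word \<kappa> s) =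
    (if int k \<le> str_eps I2 ?t then Some (str_word \<kappa> (str_s1 \<kappa> ((str_raise I2 ^^ k) ?t))) else None)" for k
  proof (induction k)
    case 0
    then show ?case using str_eps_nonneg[OF t, of I2] str_s1_s1[OF assms] by simp
  next
    case (Suc k)
    show ?case
    proof (cases "int k \<le> str_eps I2 ?t")
      case True
      then have f: "(str_raise I2 ^^ k) ?t \<in> strs \<kappa>"
        "str_eps I2 ((str_raise I2 ^^ k) ?t) = str_eps I2 ?t - int k"
        using funpow_raise[OF t, of k I2] by auto
      show ?thesis
        using f True by (auto simp: Suc e12)
    next
      case False
      then show ?thesis by (simp add: Suc)
    qed
  qed
  have "eps12 (str_word \<kappa> s) = nat (str_eps I2 ?t)"
    unfolding eps12_def using str_eps_nonneg[OF t, of I2]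
    by (intro max_iter_eqI) (auto simp: iter simp del: iter.simps)
  then show ?thesis using str_eps_nonneg[OF t, of I2] by simp
qed

text \<open>While \<open>b - 2 * a\<close> is the strict maximum only \<open>b\<close> drops; this
  lasts for \<open>max 0 (min (b - a - c) (b - 2 * a - d))\<close> steps. The other two branches
  raise \<open>a\<close> by one and never lead back to the first.\<close>

lemma str_eps_I2_funpow_raise:
  "str_eps I2 ((str_raise I1 ^^ n) (a, b, c, d)) =
     a + max 0 (int n - max 0 (min (b - a - c) (b - 2 * a - d)))"
proof (induction n arbitrary: a b c d)
  case 0
  have "max 0 (0 - max 0 z) = 0" for z :: int by simp
  then show ?case by (simp only: funpow_0 str_eps.simps of_nat_0)
next
  case (Suc n)
  show ?case
  proof (cases "d < b - 2 * a \<and> 2 * c - b < b - 2 * a")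
    case True
    then have "min (b - a - c) (b - 2 * a - d) = min (b - 1 - a - c) (b - 1 - 2 * a - d) + 1"
      "1 \<le> min (b - a - c) (b - 2 * a - d)" by auto
    with True show ?thesis
      by (simp only: funpow_Suc_right comp_apply str_raise.simps Suc.IH if_True simp_thms)
  next
    case False
    define t where "t = str_raise I1 (a, b, c, d)"
    obtain b' c' d' where t: "t = (a + 1, b', c', d')" "b' - (a + 1) - c' \<le> b - a - c"
      "b' - 2 * (a + 1) - d' \<le> b - 2 * a - d"
      using False by (cases "d < 2 * c - b") (auto simp: t_def str_raise.simps)
    have 0: "min (b - a - c) (b - 2 * a - d) \<le> 0" using False by auto
    then have "max 0 (min (b - a - c) (b - 2 * a - d)) = 0" by (rule max_absorb1)
    moreover have "min (b' - (a + 1) - c') (b' - 2 * (a + 1) - d') \<le> 0"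
      using 0 t(2,3) by auto
    then have "max 0 (min (b' - (a + 1) - c') (b' - 2 * (a + 1) - d')) = 0" by (rule max_absorb1)
    moreover have "str_eps I2 ((str_raise I1 ^^ Suc n) (a, b, c, d)) = str_eps I2 ((str_raise I1 ^^ n) t)"
      by (simp only: funpow_Suc_right comp_apply t_def)
    ultimately show ?thesis
      by (simp only: t(1) Suc.IH)
  qed
qed

subsection \<open>The embeddings \<open>Phi\<close> and the preatoms\<close>

definition shift :: "int \<Rightarrow> str \<Rightarrow> str" where
  "shift p s = (case s of (a, b, c, d) \<Rightarrow> (a, b + p, c + p, d + p))"

lemma shift_simp [simp]: "shift p (a, b, c, d) = (a, b + p, c + p, d + p)"
  by (simp add: shift_def)

lemma shift_in_strs:
  "s \<in> strs \<kappa> \<Longrightarrow> 0 \<le> p \<Longrightarrow> shift p s \<in> strs (\<kappa> + (2 * p, 0))"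
  by (cases s; cases \<kappa>) (auto simp: strs_def)

lemma str_wt_shift: "str_wt (\<kappa> + (2 * p, 0)) (shift p s) = str_wt \<kappa> s"
  by (cases s; cases \<kappa>) auto

lemma str_raise_shift: "str_raise I1 (shift p s) = shift p (str_raise I1 s)"
  by (cases s) (auto simp: str_raise.simps)

lemma str_lower_shift: "str_lower I1 (shift p s) = shift p (str_lower I1 s)"
  by (cases s) (auto simp: str_lower.simps)

lemma str_s1_shift: "str_s1 (\<kappa> + (2 * p, 0)) (shift p s) = shift p (str_s1 \<kappa> s)"
proof -
  have "(str_raise I1 ^^ n) (shift p s) = shift p ((str_raise I1 ^^ n) s)"
    "(str_lower I1 ^^ n) (shift p s) = shift p ((str_lower I1 ^^ n) s)" for n
    by (induction n) (simp_all add: str_raise_shift str_lower_shift)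
  then show ?thesis by (simp add: str_s1_def str_wt_shift)
qed

text \<open>Strings determine elements, so the definite descriptions behind \<open>Phi\<close> and
  \<open>Psi\<close> can be evaluated once the target string is known to be admissible.\<close>

lemma the_str_word:
  assumes "dominant \<kappa>" "(a, b, c, d) \<in> strs \<kappa>" "str_word \<kappa> (a, b, c, d) \<in> S" "S \<subseteq> crystal \<kappa>"
  shows "(THE T. T \<in> S \<and> str2 T = (nat a, nat b, nat c, nat d)) = str_word \<kappa> (a, b, c, d)"
proof (rule the_equality)
  show "str_word \<kappa> (a, b, c, d) \<in> S \<and> str2 (str_word \<kappa> (a, b, c, d)) = (nat a, nat b, nat c, nat d)"
    using assms str2_str_word by blast
next
  fix T assume T: "T \<in> S \<and> str2 T = (nat a, nat b, nat c, nat d)"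
  then obtain a' b' c' d' where s': "(a', b', c', d') \<in> strs \<kappa>" "T = str_word \<kappa> (a', b', c', d')"
    using assms(1,4) crystal_eq by fast
  have "(nat a', nat b', nat c', nat d') = (nat a, nat b, nat c, nat d)"
    using T s' str2_str_word by metis
  moreover have "0 \<le> a" "0 \<le> b" "0 \<le> c" "0 \<le> d" "0 \<le> a'" "0 \<le> b'" "0 \<le> c'" "0 \<le> d'"
    using s'(1) assms(2) by (simp_all add: strs_def)
  ultimately show "T = str_word \<kappa> (a, b, c, d)"
    by (simp add: s'(2) eq_nat_nat_iff)
qed

lemma Phi_str_word:
  assumes "dominant \<kappa>" "s \<in> strs \<kappa>"
  shows "Phi \<kappa> (str_word \<kappa> s) = str_word (\<kappa> + (2, 0)) (shift 1 s)"
proof -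
  obtain a b c d where s: "s = (a, b, c, d)" by (cases s) auto
  have in': "(a, b + 1, c + 1, d + 1) \<in> strs (\<kappa> + (2, 0))"
    using shift_in_strs[OF assms(2), of 1] by (simp add: s)
  have dom: "dominant (\<kappa> + (2, 0))" using assms(1) by (auto simp: dominant_def)
  have "str2 (str_word \<kappa> s) + (0, 1, 1, 1) = (nat a, nat (b + 1), nat (c + 1), nat (d + 1))"
    using str2_str_word[of a b c d \<kappa>] assms(2) by (auto simp: s strs_def nat_add_distrib)
  then show ?thesis
    using the_str_word[OF dom in', of "crystal (\<kappa> + (2, 0))"] in' crystal_eq[OF dom]
    by (simp add: Phi_def s)
qed

lemma Phi_pow_str_word:
  assumes "dominant \<kappa>" "s \<in> strs \<kappa>"
  shows "Phi_pow p \<kappa> (str_word \<kappa> s) = str_word (\<kappa> + (2 * int p, 0)) (shift (int p) s)"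
proof (induction p)
  case 0 then show ?case by (cases s; cases \<kappa>) simp
next
  case (Suc p)
  have "dominant (\<kappa> + (2 * int p, 0))" using assms(1) by (auto simp: dominant_def)
  moreover have "shift 1 (shift (int p) s) = shift (int (Suc p)) s" by (cases s) simp
  ultimately show ?case
    using Phi_str_word[of "\<kappa> + (2 * int p, 0)" "shift (int p) s"] shift_in_strs[OF assms(2), of "int p"]
    by (simp add: Suc weight_add_Suc del: of_nat_Suc)
qed

text \<open>Three inequalities of the polytope are not invariant under \<open>shift\<close>:
  \<open>0 \<le> d\<close>, \<open>d \<le> fst \<kappa>\<close> and the upper bound on
  \<open>b\<close>. \<open>Phi\<close> cannot be undone exactly when one of them is an
  equality.\<close>

definition pre_strs :: "weight \<Rightarrow> str set" where
  "pre_strs \<kappa> = {(a, b, c, d). (a, b, c, d) \<in> strs \<kappa> \<and>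
     (d = 0 \<or> d = fst \<kappa> \<or> b = fst \<kappa> - 2 * d + 2 * c)}"

lemma pre_strs_subset: "pre_strs \<kappa> \<subseteq> strs \<kappa>"
  by (auto simp: pre_strs_def)

lemma pre_strs_eq:
  assumes "2 \<le> fst \<kappa>"
  shows "pre_strs \<kappa> = strs \<kappa> - shift 1 ` strs (\<kappa> - (2, 0))"
proof -
  obtain l m where [simp]: "\<kappa> = (l, m)" by fastforce
  have *: "(a, b, c, d) \<in> shift 1 ` strs (\<kappa> - (2, 0)) \<longleftrightarrow>
     (a, b, c, d) \<in> strs \<kappa> \<and> \<not> (d = 0 \<or> d = l \<or> b = l - 2 * d + 2 * c)" for a b c d
  proof -
    have "(a, b, c, d) \<in> shift 1 ` strs (\<kappa> - (2, 0)) \<longleftrightarrow> (a, b - 1, c - 1, d - 1) \<in> strs (\<kappa> - (2, 0))"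
      by (force simp: image_iff)
    also have "\<dots> \<longleftrightarrow> (a, b, c, d) \<in> strs \<kappa> \<and> \<not> (d = 0 \<or> d = l \<or> b = l - 2 * d + 2 * c)"
      by (simp add: strs_def) linarith
    finally show ?thesis .
  qed
  have "s \<in> pre_strs \<kappa> \<longleftrightarrow> s \<in> strs \<kappa> \<and> s \<notin> shift 1 ` strs (\<kappa> - (2, 0))" for s
  proof (cases s)
    case (fields a b c d)
    show ?thesis unfolding fields * by (auto simp: pre_strs_def)
  qed
  then show ?thesis by blast
qed

lemma pre_strs_eq_strs: "fst \<kappa> < 2 \<Longrightarrow> pre_strs \<kappa> = strs \<kappa>"
  by (auto simp: pre_strs_def strs_def)

lemma preatom_eq:
  assumes "dominant \<kappa>"
  shows "preatom \<kappa> = str_word \<kappa> ` pre_strs \<kappa>"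
proof (cases "2 \<le> fst \<kappa>")
  case True
  have dom: "dominant (\<kappa> - (2, 0))" using assms True by (auto simp: dominant_def)
  have [simp]: "\<kappa> - (2, 0) + (2, 0) = \<kappa>" by (cases \<kappa>) simp
  have sub: "shift 1 ` strs (\<kappa> - (2, 0)) \<subseteq> strs \<kappa>"
    using shift_in_strs[of _ "\<kappa> - (2, 0)" 1] by auto
  have "Phi (\<kappa> - (2, 0)) ` crystal (\<kappa> - (2, 0)) = str_word \<kappa> ` shift 1 ` strs (\<kappa> - (2, 0))"
    unfolding crystal_eq[OF dom] image_image
    by (intro image_cong) (auto simp: Phi_str_word[OF dom])
  then show ?thesis
    using True assms sub inj_on_image_set_diff[OF inj_on_str_word[of \<kappa>], of "strs \<kappa>"]
    by (simp add: preatom_def crystal_eq pre_strs_eq)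
next
  case False
  then show ?thesis using assms by (simp add: preatom_def crystal_eq pre_strs_eq_strs)
qed

text \<open>The involution \<open>str_s1\<close> commutes with \<open>shift\<close>, so it preserves
  the image of \<open>shift\<close> and hence the complement.\<close>

lemma str_s1_in_pre_strs:
  assumes "s \<in> pre_strs \<kappa>"
  shows "str_s1 \<kappa> s \<in> pre_strs \<kappa>"
proof (cases "2 \<le> fst \<kappa>")
  case True
  have s: "s \<in> strs \<kappa>" using assms pre_strs_subset by blast
  have [simp]: "\<kappa> - (2, 0) + (2, 0) = \<kappa>" by (cases \<kappa>) simp
  have "s \<in> shift 1 ` strs (\<kappa> - (2, 0))" if *: "str_s1 \<kappa> s \<in> shift 1 ` strs (\<kappa> - (2, 0))"
  proof -
    obtain t where t: "t \<in> strs (\<kappa> - (2, 0))" "str_s1 \<kappa> s = shift 1 t" using * by blast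
    have "s = str_s1 \<kappa> (shift 1 t)" using t str_s1_s1[OF s] by simp
    also have "\<dots> = shift 1 (str_s1 (\<kappa> - (2, 0)) t)"
      using str_s1_shift[of "\<kappa> - (2, 0)" 1 t] by simp
    finally show ?thesis using str_s1_in_strs[OF t(1)] by blast
  qed
  then show ?thesis using assms str_s1_in_strs[OF s] True by (auto simp: pre_strs_eq)
next
  case False
  then show ?thesis using assms by (simp add: pre_strs_eq_strs str_s1_in_strs)
qed

subsection \<open>The maps \<open>Psi\<close> and the atoms\<close>

fun str_Psi :: "weight \<Rightarrow> str \<Rightarrow> str" where
  "str_Psi \<kappa> (a, b, c, d) =
     (if d = 0 \<or> d = fst \<kappa> then (a, b + 1, c + 1, d) else (a, b, c + 1, d + 1))"

primrec str_Psi_pow :: "nat \<Rightarrow> weight \<Rightarrow> str \<Rightarrow> str" where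
  "str_Psi_pow 0 \<kappa> s = s"
| "str_Psi_pow (Suc n) \<kappa> s = str_Psi (\<kappa> + (0, int n)) (str_Psi_pow n \<kappa> s)"

lemma str_Psi_in_pre_strs: "s \<in> pre_strs \<kappa> \<Longrightarrow> str_Psi \<kappa> s \<in> pre_strs (\<kappa> + (0, 1))"
  by (cases s; cases \<kappa>) (auto simp: pre_strs_def strs_def)

lemma str_wt_Psi: "str_wt (\<kappa> + (0, 1)) (str_Psi \<kappa> s) = str_wt \<kappa> s"
  by (cases s; cases \<kappa>) auto

lemma str_Psi_pow_in_pre_strs:
  assumes "s \<in> pre_strs \<kappa>"
  shows "str_Psi_pow n \<kappa> s \<in> pre_strs (\<kappa> + (0, int n))"
proof (induction n)
  case 0 then show ?case using assms by (cases \<kappa>) simp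
next
  case (Suc n)
  then show ?case using str_Psi_in_pre_strs[OF Suc] by (simp add: weight_add_Suc del: of_nat_Suc)
qed

lemma str_wt_Psi_pow: "str_wt (\<kappa> + (0, int n)) (str_Psi_pow n \<kappa> s) = str_wt \<kappa> s"
proof (induction n)
  case 0 then show ?case by (cases \<kappa>) simp
next
  case (Suc n)
  then show ?case using str_wt_Psi[of "\<kappa> + (0, int n)"] Suc
    by (simp add: weight_add_Suc del: of_nat_Suc)
qed

lemma Psi_str_word:
  assumes "dominant \<kappa>" "s \<in> pre_strs \<kappa>"
  shows "Psi \<kappa> (str_word \<kappa> s) = str_word (\<kappa> + (0, 1)) (str_Psi \<kappa> s)"
proof -
  obtain a b c d where s: "s = (a, b, c, d)" by (cases s) auto
  have in': "str_Psi \<kappa> (a, b, c, d) \<in> pre_strs (\<kappa> + (0, 1))"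
    using str_Psi_in_pre_strs[OF assms(2)] by (simp add: s)
  have dom: "dominant (\<kappa> + (0, 1))" using assms(1) by (auto simp: dominant_def)
  have str: "(a, b, c, d) \<in> strs \<kappa>" using assms(2) subsetD[OF pre_strs_subset] by (auto simp: s)
  then have nn: "0 \<le> a" "0 \<le> b" "0 \<le> c" "0 \<le> d" by (auto simp: strs_def)
  have sub: "preatom (\<kappa> + (0, 1)) \<subseteq> crystal (\<kappa> + (0, 1))"
    unfolding preatom_eq[OF dom] crystal_eq[OF dom] using pre_strs_subset by blast
  obtain a' b' c' d' where s': "str_Psi \<kappa> (a, b, c, d) = (a', b', c', d')"
    by (cases "str_Psi \<kappa> (a, b, c, d)") auto
  have eq: "(if nat d = 0 \<or> int (nat d) = fst \<kappa> then (nat a, nat b + 1, nat c + 1, nat d)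
      else (nat a, nat b, nat c + 1, nat d + 1)) = (nat a', nat b', nat c', nat d')"
    using s' nn by (auto split: if_splits)
  have "(THE T. T \<in> preatom (\<kappa> + (0, 1)) \<and> str2 T = (nat a', nat b', nat c', nat d')) =
      str_word (\<kappa> + (0, 1)) (a', b', c', d')"
    using in' subsetD[OF pre_strs_subset]
    by (intro the_str_word[OF dom _ _ sub]) (auto simp: preatom_eq[OF dom] s' simp del: str_Psi.simps)
  then show ?thesis
    by (simp only: Psi_def s str2_str_word[OF str] prod.case eq s')
qed

text \<open>Since \<open>Psi_bar\<close> is the conjugate of \<open>Psi\<close> by \<open>s1\<close> on elements with nonnegative first weight
  coordinate, such elements are described by the string of their image under \<open>s1\<close>.\<close>

lemma Psi_bar_str_word:
  assumes "dominant \<kappa>" "s \<in> pre_strs \<kappa>" "fst (str_wt \<kappa> s) \<le> 0"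
  shows "Psi_bar \<kappa> (str_word \<kappa> (str_s1 \<kappa> s)) =
    str_word (\<kappa> + (0, 1)) (str_s1 (\<kappa> + (0, 1)) (str_Psi \<kappa> s))"
proof -
  have str: "s \<in> strs \<kappa>" using assms(2) pre_strs_subset by blast
  have str': "str_Psi \<kappa> s \<in> strs (\<kappa> + (0, 1))"
    using str_Psi_in_pre_strs[OF assms(2)] pre_strs_subset by blast
  have wt: "wt (str_word \<kappa> (str_s1 \<kappa> s)) = refl1 (str_wt \<kappa> s)"
    using str by (simp add: wt_str_word str_s1_in_strs str_wt_s1)
  obtain x y where xy: "str_wt \<kappa> s = (x, y)" by fastforce
  show ?thesis
  proof (cases "x = 0")
    case True
    then have "str_s1 \<kappa> s = s" "str_s1 (\<kappa> + (0, 1)) (str_Psi \<kappa> s) = str_Psi \<kappa> s"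
      using xy by (simp_all add: str_s1_def str_wt_Psi)
    then show ?thesis
      using True wt xy Psi_str_word[OF assms(1,2)] by (simp add: Psi_bar_def)
  next
    case False
    then have "\<not> fst (wt (str_word \<kappa> (str_s1 \<kappa> s))) \<le> 0"
      using assms(3) wt xy by simp
    then show ?thesis
      by (simp add: Psi_bar_def s1_str_word[OF str_s1_in_strs[OF str]] str_s1_s1[OF str]
          Psi_str_word[OF assms(1,2)] s1_str_word[OF str'])
  qed
qed

lemma Psi_bar_pow_str_word:
  assumes "dominant \<kappa>" "s \<in> pre_strs \<kappa>" "fst (str_wt \<kappa> s) \<le> 0"
  shows "Psi_bar_pow n \<kappa> (str_word \<kappa> (str_s1 \<kappa> s)) =
    str_word (\<kappa> + (0, int n)) (str_s1 (\<kappa> + (0, int n)) (str_Psi_pow n \<kappa> s))"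
proof (induction n)
  case 0 then show ?case by (cases \<kappa>) simp
next
  case (Suc n)
  have "dominant (\<kappa> + (0, int n))" using assms(1) by (auto simp: dominant_def)
  from Psi_bar_str_word[OF this str_Psi_pow_in_pre_strs[OF assms(2)]] show ?case
    using assms(3) by (simp add: Suc weight_add_Suc str_wt_Psi_pow del: of_nat_Suc)
qed

section \<open>Undoing \<open>Psi\<close> on strings\<close>

definition low :: "weight \<Rightarrow> str \<Rightarrow> bool" where
  "low \<kappa> s \<longleftrightarrow> dominant (refl1 (str_wt \<kappa> s))"

lemma low_fst: "low \<kappa> s \<Longrightarrow> fst (str_wt \<kappa> s) \<le> 0"
  by (cases "str_wt \<kappa> s") (auto simp: low_def dominant_def)

text \<open>On strings of nonpositive first weight coordinate, \<open>depth\<close> counts how often \<open>Psi\<close> can be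
  undone; if \<open>\<kappa>\<^sub>1 = 0\<close>, only even numbers of steps are admitted.\<close>

fun depth :: "weight \<Rightarrow> str \<Rightarrow> int" where
  "depth (l, m) (a, b, c, d) =
     (if l = 0 then 2 * ((2 * c - b) div 2)
      else if d = 0 then min c (l + 2 * c - b) else l - d + 2 * c - b - 1)"

lemma strs_dominant: "s \<in> strs \<kappa> \<Longrightarrow> dominant \<kappa>"
  by (cases s) (auto simp: strs_def dominant_def)

lemma depth_nonneg: "s \<in> pre_strs \<kappa> \<Longrightarrow> 0 \<le> depth \<kappa> s"
  by (cases s; cases \<kappa>) (auto simp: pre_strs_def strs_def)

text \<open>\<open>Psi\<close> keeps \<open>d = 0\<close>, where both arguments of the minimum grow
  by one. Strings with \<open>d > 0\<close> form chains of their own, on which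
  \<open>l - d + 2 * c - b\<close> grows by one and is at least 1; this explains the final
  \<open>- 1\<close> in \<open>depth\<close>.\<close>

lemma depth_Psi:
  "s \<in> pre_strs \<kappa> \<Longrightarrow> 0 < fst \<kappa> \<Longrightarrow> depth (\<kappa> + (0, 1)) (str_Psi \<kappa> s) = depth \<kappa> s + 1"
  by (cases s; cases \<kappa>) (auto simp: pre_strs_def strs_def)

lemma str_Psi_pow_0:
  assumes "fst \<kappa> = 0"
  shows "str_Psi_pow n \<kappa> (a, b, c, 0) = (a, b + int n, c + int n, 0)"
  using assms by (induction n) auto

lemma depth_Psi_pow:
  assumes "s \<in> pre_strs \<kappa>" "fst \<kappa> = 0 \<longrightarrow> even n"
  shows "depth (\<kappa> + (0, int n)) (str_Psi_pow n \<kappa> s) = depth \<kappa> s + int n"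
proof (cases "fst \<kappa> = 0")
  case True
  obtain a b c d m where eq: "s = (a, b, c, d)" "\<kappa> = (0, m)"
    using True by (cases s; cases \<kappa>) auto
  have "d = 0" using assms(1) by (auto simp: eq pre_strs_def strs_def)
  then show ?thesis
    using assms(2) by (auto simp: eq str_Psi_pow_0 elim!: evenE)
next
  case False
  have "fst \<kappa> > 0" using False assms(1) by (cases s) (auto simp: pre_strs_def strs_def)
  then show ?thesis
  proof (induction n)
    case 0 then show ?case by (cases \<kappa>) simp
  next
    case (Suc n)
    then show ?case
      using depth_Psi[OF str_Psi_pow_in_pre_strs[OF assms(1)], of n]
      by (simp add: weight_add_Suc del: of_nat_Suc)
  qed
qed

lemma ex_str_Psi:
  assumes "s \<in> pre_strs \<kappa>" "low \<kappa> s" "0 < fst \<kappa>" "0 < depth \<kappa> s"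
  shows "\<exists>v\<in>pre_strs (\<kappa> - (0, 1)). str_Psi (\<kappa> - (0, 1)) v = s"
proof -
  obtain l m a b c d where eq: "\<kappa> = (l, m)" "s = (a, b, c, d)"
    by (cases \<kappa>; cases s) auto
  have s: "0 \<le> a" "0 \<le> d" "d \<le> c" "c \<le> b" "d \<le> l" "c \<le> m + d"
     "b \<le> l - 2 * d + 2 * c" "a \<le> m - 2 * c + b + d" "d = 0 \<or> d = l \<or> b = l - 2 * d + 2 * c"
    using assms(1) by (auto simp: pre_strs_def strs_def eq)
  have low: "b + d \<le> l + m" "0 < l" using assms(2,3) by (auto simp: eq low_def dominant_def)
  have dep: "0 < (if d = 0 then min c (l + 2 * c - b) else l - d + 2 * c - b - 1)"
    using assms(4) low by (simp add: eq split: if_splits)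
  show ?thesis
  \<comment> \<open>At \<open>d = l\<close> both branches of \<open>Psi\<close> arrive: if the bound
    on \<open>b\<close> is tight the string came from \<open>d = l - 1\<close>, otherwise from
    \<open>d = l\<close>. When \<open>d\<close> is to be decreased, positive depth gives
    \<open>2 \<le> d\<close>, and the bound \<open>c \<le> m + d - 1\<close> comes from
    \<open>b + d \<le> l + m\<close>.\<close>
  proof (cases "d = 0 \<or> d = l \<and> b \<noteq> l - 2 * d + 2 * c")
    case True
    then have "(a, b - 1, c - 1, d) \<in> pre_strs (\<kappa> - (0, 1))"
      using s low dep by (auto simp: pre_strs_def strs_def eq split: if_splits)
    moreover have "str_Psi (\<kappa> - (0, 1)) (a, b - 1, c - 1, d) = s" using True by (auto simp: eq)
    ultimately show ?thesis by blast
  next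
    case False
    then have "(a, b, c - 1, d - 1) \<in> pre_strs (\<kappa> - (0, 1))"
      using s low dep by (auto simp: pre_strs_def strs_def eq split: if_splits)
    moreover have "str_Psi (\<kappa> - (0, 1)) (a, b, c - 1, d - 1) = s"
      using False s low dep by (auto simp: eq split: if_splits)
    ultimately show ?thesis by blast
  qed
qed

lemma ex_str_Psi_pow_2:
  assumes "s \<in> pre_strs \<kappa>" "fst \<kappa> = 0" "0 < depth \<kappa> s"
  shows "\<exists>v\<in>pre_strs (\<kappa> - (0, 2)). str_Psi_pow 2 (\<kappa> - (0, 2)) v = s"
proof -
  obtain m a b c d where eq: "\<kappa> = (0, m)" "s = (a, b, c, d)"
    using assms(2) by (cases \<kappa>; cases s) auto
  have "d = 0" "2 \<le> 2 * c - b" using assms by (auto simp: eq pre_strs_def strs_def)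
  then have "(a, b - 2, c - 2, 0) \<in> pre_strs (\<kappa> - (0, 2))"
    using assms(1) by (auto simp: eq pre_strs_def strs_def)
  moreover have "str_Psi_pow 2 (\<kappa> - (0, 2)) (a, b - 2, c - 2, 0) = s"
    using str_Psi_pow_0[of "\<kappa> - (0, 2)" 2] by (simp add: eq \<open>d = 0\<close>)
  ultimately show ?thesis by blast
qed

section \<open>Images of \<open>Psi_bar\<close> and membership in atoms\<close>

lemma Psi_bar_in_preatom:
  assumes "dominant \<kappa>" "V \<in> preatom \<kappa>"
  shows "Psi_bar \<kappa> V \<in> preatom (\<kappa> + (0, 1)) \<and> wt (Psi_bar \<kappa> V) = wt V"
proof -
  have dom: "dominant (\<kappa> + (0, 1))" using assms(1) by (auto simp: dominant_def)
  obtain v where v: "v \<in> pre_strs \<kappa>" "V = str_word \<kappa> v"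
    using assms preatom_eq by blast
  then have str: "v \<in> strs \<kappa>" using pre_strs_subset by blast
  have Psi: "str_Psi \<kappa> v \<in> pre_strs (\<kappa> + (0, 1))" using str_Psi_in_pre_strs[OF v(1)] .
  then have PsiS: "str_Psi \<kappa> v \<in> strs (\<kappa> + (0, 1))" using pre_strs_subset by blast
  show ?thesis
  proof (cases "fst (wt V) \<le> 0")
    case True
    then show ?thesis
      using Psi PsiS str
      by (simp add: Psi_bar_def v(2) Psi_str_word[OF assms(1) v(1)] preatom_eq[OF dom] wt_str_word str_wt_Psi)
  next
    case False
    define u where "u = str_s1 \<kappa> v"
    have u: "u \<in> pre_strs \<kappa>" using str_s1_in_pre_strs[OF v(1)] by (simp add: u_def)
    have uv: "str_s1 \<kappa> u = v" using str_s1_s1[OF str] by (simp add: u_def)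
    have wtu: "str_wt \<kappa> u = refl1 (wt V)" using str_wt_s1[OF str] str by (simp add: u_def v(2) wt_str_word)
    then have "fst (str_wt \<kappa> u) \<le> 0" using False by (cases "wt V") auto
    from Psi_bar_str_word[OF assms(1) u this]
    have eq: "Psi_bar \<kappa> V = str_word (\<kappa> + (0, 1)) (str_s1 (\<kappa> + (0, 1)) (str_Psi \<kappa> u))"
      by (simp add: uv v(2))
    have P: "str_Psi \<kappa> u \<in> pre_strs (\<kappa> + (0, 1))" using str_Psi_in_pre_strs[OF u] .
    then have PS: "str_Psi \<kappa> u \<in> strs (\<kappa> + (0, 1))" using pre_strs_subset by blast
    have "wt (Psi_bar \<kappa> V) = refl1 (refl1 (wt V))"
      unfolding eq using wt_str_word[OF str_s1_in_strs[OF PS]] str_wt_s1[OF PS]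
      by (simp add: str_wt_Psi wtu)
    then show ?thesis
      using str_s1_in_pre_strs[OF P] by (cases "wt V") (simp add: eq preatom_eq[OF dom])
  qed
qed

lemma Psi_bar_pow_in_preatom:
  assumes "dominant \<kappa>" "V \<in> preatom \<kappa>"
  shows "Psi_bar_pow n \<kappa> V \<in> preatom (\<kappa> + (0, int n)) \<and> wt (Psi_bar_pow n \<kappa> V) = wt V"
proof (induction n)
  case 0 then show ?case using assms by (cases \<kappa>) simp
next
  case (Suc n)
  have "dominant (\<kappa> + (0, int n))" using assms(1) by (auto simp: dominant_def)
  from Psi_bar_in_preatom[OF this] Suc show ?case
    by (simp add: weight_add_Suc del: of_nat_Suc)
qed

text \<open>\<open>Psi_bar\<close> preserves weights, so a preimage of an element with nonnegative
  first coordinate lies itself in the range where \<open>Psi_bar\<close> is the conjugate of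
  \<open>Psi\<close>. Injectivity of \<open>str_word\<close> and \<open>str_s1\<close> then moves
  the equation to strings.\<close>

lemma Psi_bar_eqD:
  assumes "dominant \<kappa>" "V \<in> preatom \<kappa>" "s \<in> pre_strs (\<kappa> + (0, 1))"
    and "fst (str_wt (\<kappa> + (0, 1)) s) \<le> 0"
    and eq: "Psi_bar \<kappa> V = str_word (\<kappa> + (0, 1)) (str_s1 (\<kappa> + (0, 1)) s)"
  obtains v where "v \<in> pre_strs \<kappa>" "V = str_word \<kappa> (str_s1 \<kappa> v)" "str_Psi \<kappa> v = s"
    "fst (str_wt \<kappa> v) \<le> 0"
proof -
  let ?\<kappa>' = "\<kappa> + (0, 1)"
  obtain v0 where v0: "v0 \<in> pre_strs \<kappa>" "V = str_word \<kappa> v0"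
    using assms preatom_eq by blast
  then have str0: "v0 \<in> strs \<kappa>" using pre_strs_subset by blast
  define v where "v = str_s1 \<kappa> v0"
  have v: "v \<in> pre_strs \<kappa>" "str_s1 \<kappa> v = v0"
    using str_s1_in_pre_strs[OF v0(1)] str_s1_s1[OF str0] by (simp_all add: v_def)
  have s: "s \<in> strs ?\<kappa>'" using assms(3) pre_strs_subset by blast
  have "wt V = wt (Psi_bar \<kappa> V)" using Psi_bar_in_preatom[OF assms(1,2)] by simp
  also have "\<dots> = refl1 (str_wt ?\<kappa>' s)"
    unfolding eq using s by (simp add: wt_str_word str_s1_in_strs str_wt_s1)
  finally have "wt V = refl1 (str_wt ?\<kappa>' s)" .
  moreover have "str_wt \<kappa> v = refl1 (wt V)"
    using str0 str_wt_s1[OF str0] by (simp add: v_def v0(2) wt_str_word)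
  ultimately have le: "fst (str_wt \<kappa> v) \<le> 0"
    using assms(4) by (cases "str_wt ?\<kappa>' s") simp
  have P: "str_Psi \<kappa> v \<in> strs ?\<kappa>'" using str_Psi_in_pre_strs[OF v(1)] pre_strs_subset by blast
  have "str_word ?\<kappa>' (str_s1 ?\<kappa>' s) = str_word ?\<kappa>' (str_s1 ?\<kappa>' (str_Psi \<kappa> v))"
    using Psi_bar_str_word[OF assms(1) v(1) le] by (simp add: v v0(2) flip: eq)
  then have "str_s1 ?\<kappa>' s = str_s1 ?\<kappa>' (str_Psi \<kappa> v)"
    using inj_onD[OF inj_on_str_word] str_s1_in_strs s P by blast
  then have "str_Psi \<kappa> v = s" using str_s1_s1 s P by metis
  then show ?thesis using that v v0(2) le by auto
qed

lemma preatom_dominant: "V \<in> preatom \<kappa> \<Longrightarrow> dominant \<kappa>"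
  by (auto simp: preatom_def split: if_splits)

lemma weight_diff_add:
  fixes \<kappa> :: weight
  shows "\<kappa> - (0, x) + (0, x) = \<kappa>" "\<kappa> - (x, 0) + (x, 0) = \<kappa>"
    "\<kappa> - (0, 2) + (0, 1) = \<kappa> - (0, 1)"
  by (cases \<kappa>; simp)+

lemma pow_2_simps:
  "Psi_bar_pow 2 \<kappa> V = Psi_bar (\<kappa> + (0, 1)) (Psi_bar \<kappa> V)"
  "str_Psi_pow 2 \<kappa> v = str_Psi (\<kappa> + (0, 1)) (str_Psi \<kappa> v)"
  by (cases \<kappa>; simp add: eval_nat_numeral del: str_Psi.simps)+

text \<open>Elements of the removed image have positive depth, since \<open>Psi\<close> raises a
  depth that is never negative; conversely positive depth lets \<open>Psi\<close>, or its square on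
  the wall \<open>fst \<kappa> = 0\<close>, be undone.\<close>

lemma str_word_in_atom_iff:
  assumes s: "s \<in> pre_strs \<kappa>" "low \<kappa> s"
  shows "str_word \<kappa> (str_s1 \<kappa> s) \<in> atom \<kappa> \<longleftrightarrow> depth \<kappa> s = 0"
proof -
  let ?T = "str_word \<kappa> (str_s1 \<kappa> s)"
  have str: "s \<in> strs \<kappa>" using s pre_strs_subset by blast
  then have dom: "dominant \<kappa>" using strs_dominant by blast
  have pre: "?T \<in> preatom \<kappa>" using str_s1_in_pre_strs[OF s(1)] by (simp add: preatom_eq[OF dom])
  have le: "fst (str_wt \<kappa> s) \<le> 0" using low_fst[OF s(2)] .
  show ?thesis
  proof (cases "0 < fst \<kappa>")
    case True
    let ?\<kappa> = "\<kappa> - (0, 1)"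
    have "?T \<in> Psi_bar ?\<kappa> ` preatom ?\<kappa> \<longleftrightarrow> 0 < depth \<kappa> s"
    proof
      assume "?T \<in> Psi_bar ?\<kappa> ` preatom ?\<kappa>"
      then obtain V where V: "V \<in> preatom ?\<kappa>" "Psi_bar ?\<kappa> V = ?T" by auto
      obtain v where v: "v \<in> pre_strs ?\<kappa>" "str_Psi ?\<kappa> v = s"
        using Psi_bar_eqD[OF preatom_dominant[OF V(1)] V(1), unfolded weight_diff_add, OF s(1) le V(2)]
        by blast
      then show "0 < depth \<kappa> s"
        using depth_Psi[OF v(1)] depth_nonneg[OF v(1)] True by (simp add: weight_diff_add)
    next
      assume "0 < depth \<kappa> s"
      then obtain v where v: "v \<in> pre_strs ?\<kappa>" "str_Psi ?\<kappa> v = s"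
        using ex_str_Psi[OF s True] by blast
      then have dom': "dominant ?\<kappa>" using strs_dominant pre_strs_subset by blast
      have "fst (str_wt ?\<kappa> v) \<le> 0"
        using le str_wt_Psi[of ?\<kappa> v] v by (simp add: weight_diff_add)
      from Psi_bar_str_word[OF dom' v(1) this]
      have "Psi_bar ?\<kappa> (str_word ?\<kappa> (str_s1 ?\<kappa> v)) = ?T"
        by (simp add: weight_diff_add v)
      moreover have "str_word ?\<kappa> (str_s1 ?\<kappa> v) \<in> preatom ?\<kappa>"
        using str_s1_in_pre_strs[OF v(1)] by (simp add: preatom_eq[OF dom'])
      ultimately show "?T \<in> Psi_bar ?\<kappa> ` preatom ?\<kappa>" by (metis image_eqI)
    qed
    then show ?thesis using True pre depth_nonneg[OF s(1)] by (auto simp: atom_def)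
  next
    case False
    then have 0: "fst \<kappa> = 0" using dom by (simp add: dominant_def)
    let ?\<kappa> = "\<kappa> - (0, 2)"
    have 2: "Psi_bar_pow 2 ?\<kappa> V = Psi_bar (\<kappa> - (0, 1)) (Psi_bar ?\<kappa> V)" for V
      by (simp add: pow_2_simps weight_diff_add)
    have 3: "str_Psi_pow 2 ?\<kappa> v = str_Psi (\<kappa> - (0, 1)) (str_Psi ?\<kappa> v)" for v
      by (simp add: pow_2_simps weight_diff_add)
    have "?T \<in> Psi_bar_pow 2 ?\<kappa> ` preatom ?\<kappa> \<longleftrightarrow> 0 < depth \<kappa> s"
    proof
      assume "?T \<in> Psi_bar_pow 2 ?\<kappa> ` preatom ?\<kappa>"
      then obtain V where V: "V \<in> preatom ?\<kappa>" "Psi_bar (\<kappa> - (0, 1)) (Psi_bar ?\<kappa> V) = ?T"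
        by (auto simp: 2)
      note domV = preatom_dominant[OF V(1)]
      have V': "Psi_bar ?\<kappa> V \<in> preatom (\<kappa> - (0, 1))"
        using Psi_bar_in_preatom[OF domV V(1)] by (simp add: weight_diff_add)
      obtain v where v: "v \<in> pre_strs (\<kappa> - (0, 1))" "str_Psi (\<kappa> - (0, 1)) v = s"
          "Psi_bar ?\<kappa> V = str_word (\<kappa> - (0, 1)) (str_s1 (\<kappa> - (0, 1)) v)"
          "fst (str_wt (\<kappa> - (0, 1)) v) \<le> 0"
        using Psi_bar_eqD[OF preatom_dominant[OF V'] V', unfolded weight_diff_add, OF s(1) le V(2)]
        by blast
      obtain w where w: "w \<in> pre_strs ?\<kappa>" "str_Psi ?\<kappa> w = v"
        using Psi_bar_eqD[OF domV V(1), unfolded weight_diff_add, OF v(1,4,3)] by blast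
      have "str_Psi_pow 2 ?\<kappa> w = s" using v w 3 by simp
      then show "0 < depth \<kappa> s"
        using depth_Psi_pow[OF w(1), of 2] depth_nonneg[OF w(1)] by (simp add: weight_diff_add)
    next
      assume "0 < depth \<kappa> s"
      then obtain v where v: "v \<in> pre_strs ?\<kappa>" "str_Psi_pow 2 ?\<kappa> v = s"
        using ex_str_Psi_pow_2[OF s(1) 0] by blast
      then have dom': "dominant ?\<kappa>" using strs_dominant pre_strs_subset by blast
      have "fst (str_wt ?\<kappa> v) \<le> 0"
        using le str_wt_Psi_pow[of ?\<kappa> 2 v] v by (simp add: weight_diff_add)
      from Psi_bar_pow_str_word[OF dom' v(1) this, of 2]
      have "Psi_bar_pow 2 ?\<kappa> (str_word ?\<kappa> (str_s1 ?\<kappa> v)) = ?T"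
        by (simp add: weight_diff_add v)
      moreover have "str_word ?\<kappa> (str_s1 ?\<kappa> v) \<in> preatom ?\<kappa>"
        using str_s1_in_pre_strs[OF v(1)] by (simp add: preatom_eq[OF dom'])
      ultimately show "?T \<in> Psi_bar_pow 2 ?\<kappa> ` preatom ?\<kappa>" by (metis image_eqI)
    qed
    then show ?thesis using False pre depth_nonneg[OF s(1)] by (auto simp: atom_def)
  qed
qed

lemma ex_str_Psi_pow_depth:
  assumes "s \<in> pre_strs \<kappa>" "low \<kappa> s"
  shows "\<exists>u. u \<in> pre_strs (\<kappa> - (0, depth \<kappa> s)) \<and> depth (\<kappa> - (0, depth \<kappa> s)) u = 0 \<and>
    str_Psi_pow (nat (depth \<kappa> s)) (\<kappa> - (0, depth \<kappa> s)) u = s"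
  using assms
proof (induction "nat (depth \<kappa> s)" arbitrary: \<kappa> s rule: less_induct)
  case less
  note s = less.prems
  show ?case
  proof (cases "depth \<kappa> s = 0")
    case True
    then show ?thesis using s by (intro exI[of _ s]) (cases \<kappa>; simp)
  next
    case False
    then have pos: "0 < depth \<kappa> s" using depth_nonneg[OF s(1)] by simp
    \<comment> \<open>On the wall the removed image is that of the square of \<open>Psi_bar\<close>,
      so there the smallest admissible step back undoes \<open>Psi\<close> twice.\<close>
    define k :: nat where "k = (if fst \<kappa> = 0 then 2 else 1)"
    let ?\<kappa> = "\<kappa> - (0, int k)"
    obtain v where v: "v \<in> pre_strs ?\<kappa>" "str_Psi_pow k ?\<kappa> v = s"
    proof (cases "fst \<kappa> = 0")
      case True
      then show ?thesis using ex_str_Psi_pow_2[OF s(1) True pos] that by (auto simp: k_def)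
    next
      case False
      then have "0 < fst \<kappa>" using s(1) by (cases s) (auto simp: pre_strs_def strs_def)
      from ex_str_Psi[OF s this pos] obtain v where
        "v \<in> pre_strs (\<kappa> - (0, 1))" "str_Psi (\<kappa> - (0, 1)) v = s" by blast
      then show ?thesis using that[of v] False by (cases \<kappa>) (simp add: k_def)
    qed
    have dep: "depth \<kappa> s = depth ?\<kappa> v + int k"
      using depth_Psi_pow[OF v(1), of k] v(2) by (simp add: weight_diff_add k_def split: if_splits)
    have "low ?\<kappa> v" using str_wt_Psi_pow[of ?\<kappa> k v] v(2) s(2) by (simp add: low_def weight_diff_add)
    moreover have "nat (depth ?\<kappa> v) < nat (depth \<kappa> s)" using dep pos by (simp add: k_def split: if_splits)
    ultimately obtain u where u: "u \<in> pre_strs (?\<kappa> - (0, depth ?\<kappa> v))"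
      "depth (?\<kappa> - (0, depth ?\<kappa> v)) u = 0"
      "str_Psi_pow (nat (depth ?\<kappa> v)) (?\<kappa> - (0, depth ?\<kappa> v)) u = v"
      using less.hyps[of ?\<kappa> v] v(1) by blast
    have eq: "?\<kappa> - (0, depth ?\<kappa> v) = \<kappa> - (0, depth \<kappa> s)" using dep by (cases \<kappa>) simp
    have add: "str_Psi_pow (i + j) \<zeta> u = str_Psi_pow i (\<zeta> + (0, int j)) (str_Psi_pow j \<zeta> u)" for i j \<zeta>
    proof (induction i)
      case 0 then show ?case by simp
    next
      case (Suc i)
      have "\<zeta> + (0, int j) + (0, int i) = \<zeta> + (0, int (i + j))" by (cases \<zeta>) simp
      then show ?case by (simp only: str_Psi_pow.simps add_Suc Suc)
    qed
    have "nat (depth \<kappa> s) = k + nat (depth ?\<kappa> v)" using dep depth_nonneg[OF v(1)] by simp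
    moreover have "\<kappa> - (0, depth \<kappa> s) + (0, int (nat (depth ?\<kappa> v))) = ?\<kappa>"
      using dep depth_nonneg[OF v(1)] by (cases \<kappa>) simp
    ultimately have "str_Psi_pow (nat (depth \<kappa> s)) (\<kappa> - (0, depth \<kappa> s)) u = s"
      using u(3) v(2) by (simp only: add eq)
    then show ?thesis using u(1,2) unfolding eq by blast
  qed
qed

section \<open>The atom that contains a given element\<close>

text \<open>Undoing \<open>Phi\<close> once lowers each of the three arguments of the minimum by one.\<close>

fun Phi_depth :: "weight \<Rightarrow> str \<Rightarrow> int" where
  "Phi_depth (l, m) (a, b, c, d) = min d (min (l - d) (l - 2 * d + 2 * c - b))"

definition Psi_depth :: "weight \<Rightarrow> str \<Rightarrow> int" where
  "Psi_depth \<kappa> s = depth (\<kappa> - (2 * Phi_depth \<kappa> s, 0)) (shift (- Phi_depth \<kappa> s) s)"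

lemma Phi_depth_nonneg: "s \<in> strs \<kappa> \<Longrightarrow> 0 \<le> Phi_depth \<kappa> s"
  by (cases s; cases \<kappa>) (auto simp: strs_def)

lemma shift_Phi_depth_in_pre_strs:
  assumes "s \<in> strs \<kappa>"
  shows "shift (- Phi_depth \<kappa> s) s \<in> pre_strs (\<kappa> - (2 * Phi_depth \<kappa> s, 0))"
proof -
  obtain l m a b c d where eq: "\<kappa> = (l, m)" "s = (a, b, c, d)"
    by (cases \<kappa>; cases s) auto
  define p where "p = Phi_depth \<kappa> s"
  have p: "p \<le> d" "p \<le> l - d" "p \<le> l - 2 * d + 2 * c - b" "0 \<le> p"
    "p = d \<or> p = l - d \<or> p = l - 2 * d + 2 * c - b"
    using Phi_depth_nonneg[OF assms] by (auto simp: p_def eq)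
  show ?thesis unfolding p_def[symmetric]
    using assms p by (auto simp: eq pre_strs_def strs_def)
qed

lemma Phi_depth_shift:
  assumes "t \<in> pre_strs (\<kappa> - (2 * p, 0))" "0 \<le> p"
  shows "Phi_depth \<kappa> (shift p t) = p"
  using assms by (cases t; cases \<kappa>) (auto simp: pre_strs_def strs_def)

lemma str_wt_unshift: "str_wt (\<kappa> - (2 * p, 0)) (shift (- p) s) = str_wt \<kappa> s"
  using str_wt_shift[of "\<kappa> - (2 * p, 0)" p "shift (- p) s"]
  by (cases \<kappa>; cases s) simp

lemma shift_unshift: "shift p (shift (- p) s) = s"
  by (cases s) simp

lemma even_depth: "fst \<kappa> = 0 \<Longrightarrow> even (depth \<kappa> s)"
  by (cases \<kappa>; cases s) simp

text \<open>This evaluates the \<open>THE\<close> in \<open>atom_weight\<close>. Existence peels off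
  first \<open>Phi\<close>, then \<open>Psi\<close>, as often as possible. For uniqueness, in any
  presentation the inner preatom string has a tight inequality, which forces \<open>p\<close>, and
  the atom string has depth 0, which forces \<open>a\<close>.\<close>

lemma lies_in_atom_iff:
  assumes s: "s \<in> strs \<kappa>" "low \<kappa> s"
  shows "lies_in_atom \<kappa> (str_word \<kappa> (str_s1 \<kappa> s)) \<zeta> \<longleftrightarrow>
    \<zeta> = \<kappa> - (2 * Phi_depth \<kappa> s, Psi_depth \<kappa> s)"
    (is "?L \<longleftrightarrow> ?R")
proof
  let ?p = "Phi_depth \<kappa> s" and ?s0 = "shift (- Phi_depth \<kappa> s) s"
  let ?\<kappa>0 = "\<kappa> - (2 * Phi_depth \<kappa> s, 0)"
  let ?x = "Psi_depth \<kappa> s"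
  assume R: ?R
  have s0: "?s0 \<in> pre_strs ?\<kappa>0" using shift_Phi_depth_in_pre_strs[OF s(1)] .
  have low0: "low ?\<kappa>0 ?s0" using s(2) by (simp add: low_def str_wt_unshift)
  have \<zeta>: "\<zeta> = ?\<kappa>0 - (0, ?x)" using R by (cases \<kappa>) simp
  have x: "0 \<le> ?x" using depth_nonneg[OF s0] by (simp add: Psi_depth_def)
  obtain u where u: "u \<in> pre_strs \<zeta>" "depth \<zeta> u = 0" "str_Psi_pow (nat ?x) \<zeta> u = ?s0"
    using ex_str_Psi_pow_depth[OF s0 low0] unfolding \<zeta> Psi_depth_def by blast
  have dom: "dominant \<zeta>" using u(1) strs_dominant pre_strs_subset by blast
  have \<zeta>x: "\<zeta> + (0, int (nat ?x)) = ?\<kappa>0" using x by (simp add: \<zeta> weight_diff_add)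
  have wtu: "str_wt \<zeta> u = str_wt \<kappa> s"
    using str_wt_Psi_pow[of \<zeta> "nat ?x" u] by (simp only: \<zeta>x u(3) str_wt_unshift)
  then have lowu: "low \<zeta> u" using s(2) by (simp add: low_def)
  have atom: "str_word \<zeta> (str_s1 \<zeta> u) \<in> atom \<zeta>"
    using str_word_in_atom_iff[OF u(1) lowu] u(2) by simp
  have "fst (str_wt \<zeta> u) \<le> 0" using low_fst[OF lowu] .
  from Psi_bar_pow_str_word[OF dom u(1) this, of "nat ?x"]
  have "Psi_bar_pow (nat ?x) \<zeta> (str_word \<zeta> (str_s1 \<zeta> u)) = str_word ?\<kappa>0 (str_s1 ?\<kappa>0 ?s0)"
    by (simp only: \<zeta>x u(3))
  moreover have "Phi_pow (nat ?p) ?\<kappa>0 (str_word ?\<kappa>0 (str_s1 ?\<kappa>0 ?s0)) = str_word \<kappa> (str_s1 \<kappa> s)"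
  proof -
    have S0: "?s0 \<in> strs ?\<kappa>0" using s0 pre_strs_subset by blast
    have dom0: "dominant ?\<kappa>0" using strs_dominant[OF S0] .
    have "?\<kappa>0 + (2 * ?p, 0) = \<kappa>" by (simp add: weight_diff_add)
    then show ?thesis
      using Phi_pow_str_word[OF dom0 str_s1_in_strs[OF S0], of "nat ?p"] Phi_depth_nonneg[OF s(1)]
        str_s1_shift[of ?\<kappa>0 ?p ?s0]
      by (simp add: shift_unshift)
  qed
  moreover have "fst \<zeta> = 0 \<longrightarrow> even (nat ?x)"
    using even_depth[of ?\<kappa>0 ?s0] x by (auto simp: \<zeta> Psi_depth_def even_nat_iff)
  moreover have "\<kappa> - (2 * int (nat ?p), 0) = ?\<kappa>0" "\<zeta> = \<kappa> - (2 * int (nat ?p), int (nat ?x))"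
    using Phi_depth_nonneg[OF s(1)] x R by simp_all
  ultimately show ?L
    unfolding lies_in_atom_def using atom by metis
next
  assume ?L
  then obtain p a U where paU: "\<zeta> = \<kappa> - (2 * int p, int a)" "fst \<zeta> = 0 \<longrightarrow> even a" "U \<in> atom \<zeta>"
    "str_word \<kappa> (str_s1 \<kappa> s) = Phi_pow p (\<kappa> - (2 * int p, 0)) (Psi_bar_pow a \<zeta> U)"
    unfolding lies_in_atom_def by blast
  have U: "U \<in> preatom \<zeta>" using paU(3) by (auto simp: atom_def split: if_splits)
  then have dom: "dominant \<zeta>" by (rule preatom_dominant)
  let ?\<kappa>0 = "\<kappa> - (2 * int p, 0)"
  have \<zeta>a: "\<zeta> + (0, int a) = ?\<kappa>0" by (cases \<kappa>) (simp add: paU(1))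
  have \<kappa>0: "?\<kappa>0 + (2 * int p, 0) = \<kappa>" by (simp add: weight_diff_add)
  have dom0: "dominant ?\<kappa>0" using dom by (simp add: dominant_def paU(1))
  obtain u0 where u0: "u0 \<in> pre_strs \<zeta>" "U = str_word \<zeta> u0" using U preatom_eq[OF dom] by blast
  then have str0: "u0 \<in> strs \<zeta>" using pre_strs_subset by blast
  define u where "u = str_s1 \<zeta> u0"
  have u: "u \<in> pre_strs \<zeta>" "str_s1 \<zeta> u = u0"
    using str_s1_in_pre_strs[OF u0(1)] str_s1_s1[OF str0] by (simp_all add: u_def)
  obtain t where t: "t \<in> pre_strs ?\<kappa>0" "Psi_bar_pow a \<zeta> U = str_word ?\<kappa>0 t" "str_wt ?\<kappa>0 t = str_wt \<zeta> u0"
  proof -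
    have *: "Psi_bar_pow a \<zeta> U \<in> preatom ?\<kappa>0" "wt (Psi_bar_pow a \<zeta> U) = wt U"
      using Psi_bar_pow_in_preatom[OF dom U, of a] by (simp_all add: \<zeta>a)
    then obtain t where "t \<in> pre_strs ?\<kappa>0" "Psi_bar_pow a \<zeta> U = str_word ?\<kappa>0 t"
      using preatom_eq[OF dom0] by blast
    moreover from this have "t \<in> strs ?\<kappa>0" using pre_strs_subset by blast
    ultimately show ?thesis using that *(2) u0(2) wt_str_word str0 by metis
  qed
  have tS: "t \<in> strs ?\<kappa>0" using t(1) pre_strs_subset by blast
  have "str_word \<kappa> (str_s1 \<kappa> s) = str_word \<kappa> (shift (int p) t)"
    using paU(4) t(2) Phi_pow_str_word[OF dom0 tS, of p] by (simp add: \<kappa>0)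
  moreover have "shift (int p) t \<in> strs \<kappa>" using shift_in_strs[OF tS, of "int p"] by (simp add: \<kappa>0)
  ultimately have st: "str_s1 \<kappa> s = shift (int p) t"
    using inj_onD[OF inj_on_str_word] str_s1_in_strs[OF s(1)] by blast
  have "str_wt \<zeta> u0 = str_wt \<kappa> (str_s1 \<kappa> s)"
    using str_wt_shift[of ?\<kappa>0 "int p" t] by (simp add: st t(3) \<kappa>0)
  then have "str_wt \<zeta> u0 = refl1 (str_wt \<kappa> s)" using str_wt_s1[OF s(1)] by simp
  then have wtu: "str_wt \<zeta> u = str_wt \<kappa> s"
    using str_wt_s1[OF str0] by (cases "str_wt \<kappa> s") (simp add: u_def)
  then have low: "low \<zeta> u" using s(2) by (simp add: low_def)
  have 0: "depth \<zeta> u = 0"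
    using str_word_in_atom_iff[OF u(1) low] paU(3) by (simp add: u(2) u0(2))
  from Psi_bar_pow_str_word[OF dom u(1) low_fst[OF low], of a]
  have "str_word ?\<kappa>0 t = str_word ?\<kappa>0 (str_s1 ?\<kappa>0 (str_Psi_pow a \<zeta> u))"
    by (simp add: \<zeta>a u(2) flip: u0(2) t(2))
  moreover have P: "str_Psi_pow a \<zeta> u \<in> pre_strs ?\<kappa>0"
    using str_Psi_pow_in_pre_strs[OF u(1), of a] by (simp add: \<zeta>a)
  then have PS: "str_Psi_pow a \<zeta> u \<in> strs ?\<kappa>0" using pre_strs_subset by blast
  ultimately have "t = str_s1 ?\<kappa>0 (str_Psi_pow a \<zeta> u)"
    using inj_onD[OF inj_on_str_word] str_s1_in_strs tS by blast
  then have "str_s1 \<kappa> s = str_s1 \<kappa> (shift (int p) (str_Psi_pow a \<zeta> u))"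
    using st str_s1_shift[of ?\<kappa>0 "int p"] by (simp add: \<kappa>0)
  moreover have "shift (int p) (str_Psi_pow a \<zeta> u) \<in> strs \<kappa>"
    using shift_in_strs[OF PS, of "int p"] by (simp add: \<kappa>0)
  ultimately have sp: "s = shift (int p) (str_Psi_pow a \<zeta> u)"
    using str_s1_s1 s(1) by metis
  have p: "Phi_depth \<kappa> s = int p" using Phi_depth_shift[OF P] by (simp add: sp)
  have "shift (- int p) s = str_Psi_pow a \<zeta> u"
    by (cases "str_Psi_pow a \<zeta> u") (simp add: sp)
  then have "Psi_depth \<kappa> s = int a"
    using depth_Psi_pow[OF u(1) paU(2)] 0 by (simp add: Psi_depth_def p \<zeta>a)
  then show ?R by (simp add: p paU(1))
qed

subsection \<open>The dominance order\<close>

lemma refl_refl [simp]: "refl1 (refl1 \<mu>) = \<mu>" "refl2 (refl2 \<mu>) = \<mu>"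
  by (cases \<mu>; simp)+

lemma refl_comp [simp]:
  "refl1 \<circ> refl1 = id" "refl2 \<circ> refl2 = id"
  "refl1 \<circ> (refl1 \<circ> f) = f" "refl2 \<circ> (refl2 \<circ> f) = f"
  "refl2 \<circ> (refl1 \<circ> (refl2 \<circ> refl1)) = refl1 \<circ> (refl2 \<circ> (refl1 \<circ> refl2))"
  "refl2 \<circ> (refl1 \<circ> (refl2 \<circ> (refl1 \<circ> refl2))) = refl1 \<circ> (refl2 \<circ> refl1)"
  by (auto simp: fun_eq_iff)

lemma weyl_group_subset:
  "weyl_group \<subseteq> {id, refl1, refl2, refl1 \<circ> refl2, refl2 \<circ> refl1, refl1 \<circ> (refl2 \<circ> refl1),
     refl2 \<circ> (refl1 \<circ> refl2), refl1 \<circ> (refl2 \<circ> (refl1 \<circ> refl2))}"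
    (is "_ \<subseteq> ?W")
proof -
  have step: "r \<circ> w \<in> ?W" if "w \<in> ?W" "r = refl1 \<or> r = refl2" for r w
    using that by (elim disjE insertE emptyE)
      (simp_all only: insert_iff refl_comp comp_id simp_thms)
  have "foldr (\<circ>) ws id \<in> ?W" if "set ws \<subseteq> {refl1, refl2}" for ws
    using that
  proof (induction ws)
    case Nil then show ?case by simp
  next
    case (Cons r ws)
    have "foldr (\<circ>) (r # ws) id = r \<circ> foldr (\<circ>) ws id" by simp
    then show ?case using step[of "foldr (\<circ>) ws id" r] Cons by auto
  qed
  then show ?thesis unfolding weyl_group_def by blast
qed

text \<open>For a weight \<open>(x, y)\<close> the form \<open>x + y\<close> is the coefficient of
  \<open>\<alpha>1\<close>, and \<open>x + 2 * y\<close> is twice that of \<open>\<alpha>2\<close>.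
  Both are largest at the dominant member of an orbit.\<close>

lemma weyl_group_bounds:
  assumes "dominant \<zeta>" "w \<in> weyl_group"
  shows "fst (w \<zeta>) + snd (w \<zeta>) \<le> fst \<zeta> + snd \<zeta> \<and> fst (w \<zeta>) + 2 * snd (w \<zeta>) \<le> fst \<zeta> + 2 * snd \<zeta>"
  using subsetD[OF weyl_group_subset assms(2)] assms(1)
  by (cases \<zeta>) (auto simp: dominant_def)

lemma in_weyl_group:
  "id \<in> weyl_group" "refl1 \<in> weyl_group" "refl2 \<in> weyl_group"
  "refl1 \<circ> refl2 \<circ> refl1 \<circ> refl2 \<in> weyl_group"
proof -
  have "foldr (\<circ>) ws id \<in> weyl_group" if "set ws \<subseteq> {refl1, refl2}" for ws
    using that unfolding weyl_group_def by blast
  from this[of "[]"] this[of "[refl1]"] this[of "[refl2]"] this[of "[refl1, refl2, refl1, refl2]"]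
  show "id \<in> weyl_group" "refl1 \<in> weyl_group" "refl2 \<in> weyl_group"
    "refl1 \<circ> refl2 \<circ> refl1 \<circ> refl2 \<in> weyl_group"
    by (simp_all add: comp_assoc)
qed

lemma triangle_mem:
  fixes S :: "(real \<times> real) set"
  assumes "convex S" "0 \<in> S" "v \<in> S" "v' \<in> S" "0 \<le> s" "0 \<le> t" "s + t \<le> 1"
  shows "s *\<^sub>R v + t *\<^sub>R v' \<in> S"
proof -
  have "s *\<^sub>R v + t *\<^sub>R v' = (1 - s - t) *\<^sub>R 0 + s *\<^sub>R v + t *\<^sub>R v'" by simp
  then have "s *\<^sub>R v + t *\<^sub>R v' \<in> convex hull {0, v, v'}"
    unfolding convex_hull_3 using assms(5-7)
    by (intro CollectI exI[of _ "1 - s - t"] exI[of _ s] exI[of _ t]) simp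
  then show ?thesis
    using hull_minimal[of "{0, v, v'}" S convex] assms(1-4) by auto
qed

text \<open>Necessity holds because half-planes are convex and contain the orbit. For sufficiency,
  the dominant part of the hull is covered by two triangles with common vertices 0 and
  \<open>(z, w)\<close>; the third vertex is the midpoint of \<open>(z, w)\<close> with its image
  under \<open>refl2\<close> or \<open>refl1\<close>.\<close>

lemma weight_le_iff:
  assumes "dominant (x, y)" "dominant (z, w)"
  shows "weight_le (x, y) (z, w) \<longleftrightarrow> even (z - x) \<and> x + y \<le> z + w \<and> x + 2 * y \<le> z + 2 * w"
    (is "?L \<longleftrightarrow> ?R")
proof
  assume L: ?L
  have "weight_to_real ` (\<lambda>g. g (z, w)) ` weyl_group \<subseteq>
      {v. (1, 1) \<bullet> v \<le> z + w} \<inter> {v. (1, 2) \<bullet> v \<le> z + 2 * w}"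
    using weyl_group_bounds[OF assms(2)] by (fastforce simp: weight_to_real_def inner_prod_def)
  moreover have "convex ({v. (1, 1) \<bullet> v \<le> z + w} \<inter> {v :: real \<times> real. (1, 2) \<bullet> v \<le> z + 2 * w})"
    by (intro convex_Int convex_halfspace_le)
  ultimately have "weight_to_real (x, y) \<in>
      {v. (1, 1) \<bullet> v \<le> z + w} \<inter> {v. (1, 2) \<bullet> v \<le> z + 2 * w}"
    using L hull_minimal[of _ _ convex] unfolding weight_le_def by blast
  moreover from L obtain m n where "(x, y) = (z, w) + scale m \<alpha>1 + scale n \<alpha>2"
    unfolding weight_le_def by blast
  ultimately show ?R
    by (auto simp: weight_to_real_def inner_prod_def scale_def \<alpha>1_def \<alpha>2_def)
next
  assume R: ?R
  define S where "S = convex hull (weight_to_real ` (\<lambda>g. g (z, w)) ` weyl_group)"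
  have S: "weight_to_real (g (z, w)) \<in> S" if "g \<in> weyl_group" for g
    unfolding S_def using that by (intro hull_inc) auto
  have conv: "convex S" unfolding S_def by (rule convex_convex_hull)
  have mid: "(1 / 2) *\<^sub>R u + (1 / 2) *\<^sub>R v \<in> S" if "u \<in> S" "v \<in> S" for u v
    using convexD[OF conv that, of "1/2" "1/2"] by simp
  define X Y Z W :: real where "X = x" and "Y = y" and "Z = z" and "W = w"
  have v: "(Z, W) \<in> S" "(- Z, Z + W) \<in> S" "(Z + 2 * W, - W) \<in> S" "(- Z, - W) \<in> S"
    using S[OF in_weyl_group(1)] S[OF in_weyl_group(2)] S[OF in_weyl_group(3)] S[OF in_weyl_group(4)]
    by (simp_all add: weight_to_real_def Z_def W_def)
  have 0: "0 \<in> S" using mid[OF v(1,4)] by (simp add: zero_prod_def)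
  have "(1 / 2) *\<^sub>R (Z, W) + (1 / 2) *\<^sub>R (Z + 2 * W, - W) = (Z + W, 0)"
    by simp (simp add: field_simps)
  with mid[OF v(1,3)] have h: "(Z + W, 0) \<in> S" by simp
  have k: "(0, Z / 2 + W) \<in> S" using mid[OF v(1,2)] by (simp add: field_simps)
  have pos: "0 \<le> X" "0 \<le> Y" "0 \<le> Z" "0 \<le> W" "X + Y \<le> Z + W" "X + 2 * Y \<le> Z + 2 * W"
    using assms R by (simp_all add: dominant_def X_def Y_def Z_def W_def flip: of_int_add)
  have "(X, Y) \<in> S"
  \<comment> \<open>The ray through \<open>(Z, W)\<close> separates the two triangles. In each one
    \<open>s\<close> and \<open>t\<close> solve the linear system for \<open>(X, Y)\<close>; for
    \<open>W = 0\<close> the first triangle degenerates to a segment.\<close>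
  proof (cases "Y * Z \<le> X * W")
    case True
    show ?thesis
    proof (cases "W = 0")
      case True
      then have "Y * Z \<le> 0" using \<open>Y * Z \<le> X * W\<close> by simp
      moreover have "0 \<le> Y * Z" using pos by simp
      ultimately have "Y = 0 \<or> Z = 0" by simp
      then have Y: "Y = 0" using pos True by linarith
      show ?thesis
      proof (cases "Z = 0")
        case True
        then have "X = 0" using pos \<open>W = 0\<close> Y by simp
        then show ?thesis using 0 Y by (simp add: zero_prod_def)
      next
        case False
        have "0 *\<^sub>R (Z, W) + (X / Z) *\<^sub>R (Z + W, 0) \<in> S"
          using pos False Y \<open>W = 0\<close> by (intro triangle_mem[OF conv 0 v(1) h]) (auto simp: divide_simps)
        then show ?thesis using False Y \<open>W = 0\<close> by simp
      qed
    next
      case False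
      then have W: "0 < W" "0 < Z + W" using pos by auto
      define s t where "s = Y / W" and "t = (X - Y * Z / W) / (Z + W)"
      have "0 \<le> s" using pos by (simp add: s_def)
      moreover have "0 \<le> t"
        unfolding t_def using True W by (intro divide_nonneg_pos) (simp_all add: pos_divide_le_eq)
      moreover have "s * (Z + W) = Y * Z / W + Y" "t * (Z + W) = X - Y * Z / W"
        using W by (simp add: s_def distrib_left, simp add: t_def)
      then have "(s + t) * (Z + W) \<le> 1 * (Z + W)" using pos by (simp add: distrib_right)
      then have "s + t \<le> 1" using W(2) by (rule mult_right_le_imp_le)
      ultimately have "s *\<^sub>R (Z, W) + t *\<^sub>R (Z + W, 0) \<in> S"
        by (intro triangle_mem[OF conv 0 v(1) h])
      moreover have "s * Z + t * (Z + W) = X" "s * W = Y" using W by (simp_all add: s_def t_def)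
      ultimately show ?thesis by simp
    qed
  next
    case False
    then have "X * W < Y * Z" by simp
    then have Z: "0 < Z" using pos by (metis mult_zero_right mult_nonneg_nonneg less_le not_less)
    then have ZW: "0 < Z / 2 + W" using pos by simp
    define s t where "s = X / Z" and "t = (Y - X * W / Z) / (Z / 2 + W)"
    have "0 \<le> s" using pos by (simp add: s_def)
    moreover have "0 \<le> t"
      unfolding t_def using False Z ZW by (intro divide_nonneg_pos) (simp_all add: pos_divide_le_eq)
    moreover have "s * (Z / 2 + W) = X / 2 + X * W / Z" "t * (Z / 2 + W) = Y - X * W / Z"
      using Z ZW by (simp add: s_def distrib_left, simp add: t_def)
    then have "(s + t) * (Z / 2 + W) \<le> 1 * (Z / 2 + W)"
      using pos by (simp only: distrib_right[of s]) simp
    then have "s + t \<le> 1" using ZW by (rule mult_right_le_imp_le)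
    ultimately have "s *\<^sub>R (Z, W) + t *\<^sub>R (0, Z / 2 + W) \<in> S"
      by (intro triangle_mem[OF conv 0 v(1) k])
    moreover have "s * Z = X" "s * W + t * (Z / 2 + W) = Y" using Z ZW by (simp_all add: s_def t_def)
    ultimately show ?thesis by simp
  qed
  then have "weight_to_real (x, y) \<in> S" by (simp add: weight_to_real_def X_def Y_def)
  moreover obtain j where "z - x = 2 * j" using R by (blast elim: evenE)
  then have "(x, y) = (z, w) + scale (- (2 * j + w - y)) \<alpha>1 + scale (- (j + w - y)) \<alpha>2"
    by (simp add: scale_def \<alpha>1_def \<alpha>2_def)
  ultimately show ?L
    unfolding weight_le_def S_def by blast
qed

subsection \<open>Evaluation of the Kostka--Foulkes polynomials\<close>

text \<open>As \<open>\<alpha>12 = 2\<alpha>1 + \<alpha>2\<close> and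
  \<open>\<alpha>21 = \<alpha>1 + \<alpha>2\<close>, these are the possible multiplicities of
  \<open>\<alpha>12\<close> and \<open>\<alpha>21\<close> in a Kostant partition of
  \<open>M\<alpha>1 + N\<alpha>2\<close>; those of the simple roots are then forced.\<close>

definition root_pairs :: "int \<Rightarrow> int \<Rightarrow> (nat \<times> nat) set" where
  "root_pairs M N = {(i, j). 2 * int i + int j \<le> M \<and> int i + int j \<le> N}"

lemma finite_root_pairs: "finite (root_pairs M N)"
proof (rule finite_subset)
  show "root_pairs M N \<subseteq> {..nat N} \<times> {..nat N}" by (auto simp: root_pairs_def)
qed simp

lemma roots_distinct:
  "\<alpha>1 \<noteq> \<alpha>2" "\<alpha>1 \<noteq> \<alpha>12" "\<alpha>1 \<noteq> \<alpha>21" "\<alpha>2 \<noteq> \<alpha>1" "\<alpha>2 \<noteq> \<alpha>12" "\<alpha>2 \<noteq> \<alpha>21"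
  "\<alpha>12 \<noteq> \<alpha>1" "\<alpha>12 \<noteq> \<alpha>2" "\<alpha>12 \<noteq> \<alpha>21" "\<alpha>21 \<noteq> \<alpha>1" "\<alpha>21 \<noteq> \<alpha>2" "\<alpha>21 \<noteq> \<alpha>12"
  by (simp_all add: \<alpha>1_def \<alpha>2_def \<alpha>12_def \<alpha>21_def)

lemma sum_pos_roots: "(\<Sum>\<beta>\<in>pos_roots. f \<beta>) = f \<alpha>1 + (f \<alpha>2 + (f \<alpha>12 + (f \<alpha>21 :: 'a :: comm_monoid_add)))"
  by (simp add: pos_roots_def roots_distinct)

lemma kostant_partitions_iff:
  "k \<in> kostant_partitions (x, y) \<longleftrightarrow> (\<forall>\<beta>. \<beta> \<notin> pos_roots \<longrightarrow> k \<beta> = 0) \<and>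
     x = 2 * int (k \<alpha>1) - 2 * int (k \<alpha>2) + 2 * int (k \<alpha>12) \<and>
     y = - int (k \<alpha>1) + 2 * int (k \<alpha>2) + int (k \<alpha>21)"
  unfolding kostant_partitions_def sum_pos_roots
  by (auto simp: scale_def \<alpha>1_def \<alpha>2_def \<alpha>12_def \<alpha>21_def)

text \<open>The argument is \<open>M\<alpha>1 + N\<alpha>2\<close> in fundamental coordinates, and
  the number of parts is \<open>(M - 2i - j) + (N - i - j) + i + j\<close>.\<close>

lemma q_kostant_eq:
  "q_kostant (2 * M - 2 * N, 2 * N - M) =
     (\<Sum>(i, j)\<in>root_pairs M N. monom 1 (nat (M + N - 2 * int i - int j)))"
proof -
  define g where "g = (\<lambda>(i, j). (\<lambda>_ :: weight. 0 :: nat)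
     (\<alpha>1 := nat (M - 2 * int i - int j), \<alpha>2 := nat (N - int i - int j), \<alpha>12 := i, \<alpha>21 := j))"
  show ?thesis
    unfolding q_kostant_def
  proof (rule sum.reindex_bij_witness[where i = g and j = "\<lambda>k. (k \<alpha>12, k \<alpha>21)"])
    fix k assume k: "k \<in> kostant_partitions (2 * M - 2 * N, 2 * N - M)"
    then have e: "int (k \<alpha>1) = M - 2 * int (k \<alpha>12) - int (k \<alpha>21)"
      "int (k \<alpha>2) = N - int (k \<alpha>12) - int (k \<alpha>21)"
      unfolding kostant_partitions_iff by linarith+
    have z: "k \<beta> = 0" if "\<beta> \<notin> pos_roots" for \<beta>
      using k that unfolding kostant_partitions_iff by blast
    have n: "nat (M - 2 * int (k \<alpha>12) - int (k \<alpha>21)) = k \<alpha>1"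
      "nat (N - int (k \<alpha>12) - int (k \<alpha>21)) = k \<alpha>2"
      using e by linarith+
    show "g (k \<alpha>12, k \<alpha>21) = k"
    proof
      fix \<beta>
      consider "\<beta> = \<alpha>1" | "\<beta> = \<alpha>2" | "\<beta> = \<alpha>12" | "\<beta> = \<alpha>21" | "\<beta> \<notin> pos_roots"
        by (auto simp: pos_roots_def)
      then show "g (k \<alpha>12, k \<alpha>21) \<beta> = k \<beta>"
        by cases (simp_all add: g_def roots_distinct n z, auto simp: pos_roots_def)
    qed
    show "(k \<alpha>12, k \<alpha>21) \<in> root_pairs M N"
      using e by (simp add: root_pairs_def)
    show "(case (k \<alpha>12, k \<alpha>21) of (i, j) \<Rightarrow> monom 1 (nat (M + N - 2 * int i - int j))) =
        monom (1 :: int) (\<Sum>\<beta>\<in>pos_roots. k \<beta>)"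
    proof -
      have "nat (M + N - 2 * int (k \<alpha>12) - int (k \<alpha>21)) = (\<Sum>\<beta>\<in>pos_roots. k \<beta>)"
        unfolding sum_pos_roots using e by linarith
      then show ?thesis by simp
    qed
  next
    fix ij assume "ij \<in> root_pairs M N"
    then show "(g ij \<alpha>12, g ij \<alpha>21) = ij" "g ij \<in> kostant_partitions (2 * M - 2 * N, 2 * N - M)"
      by (auto simp: root_pairs_def g_def kostant_partitions_iff roots_distinct pos_roots_def)
  qed
qed

lemma q_kostant_eq_0:
  assumes "x + y < 0 \<or> x + 2 * y < 0"
  shows "q_kostant (x, y) = 0"
proof -
  have "k \<notin> kostant_partitions (x, y)" for k
    using assms unfolding kostant_partitions_iff by linarith
  then have "kostant_partitions (x, y) = {}" by blast
  then show ?thesis by (simp add: q_kostant_def)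
qed

section \<open>The alternating sum over the Weyl group\<close>

lemma refl_distinct: "refl1 \<noteq> id" "refl2 \<noteq> id" "refl1 \<noteq> refl2"
  by (auto dest: fun_cong[of _ _ "(1, 1)"])

lemma weyl_length_id: "weyl_length id = 0"
  unfolding weyl_length_def by (rule Least_eq_0) (intro exI[of _ "[]"]; simp)

lemma weyl_length_refl:
  assumes "r \<in> {refl1, refl2}"
  shows "weyl_length r = 1"
  unfolding weyl_length_def
proof (rule Least_equality)
  show "\<exists>ws. set ws \<subseteq> {refl1, refl2} \<and> length ws = 1 \<and> r = foldr (\<circ>) ws id"
    using assms by (intro exI[of _ "[r]"]) auto
next
  fix n assume "\<exists>ws. set ws \<subseteq> {refl1, refl2} \<and> length ws = n \<and> r = foldr (\<circ>) ws id"
  then show "1 \<le> n" using assms refl_distinct by (cases n) auto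
qed

text \<open>For the other Weyl group elements \<open>w\<close>, the weight \<open>w(\<kappa> + \<rho>) - (\<mu> + \<rho>)\<close> has a negative
  coefficient at some simple root.\<close>

lemma kostka_foulkes_eq_three_terms:
  assumes "dominant (l, m)" "dominant (u, v)"
  shows "kostka_foulkes (l, m) (u, v) =
    q_kostant (l - u, m - v) - q_kostant (- l - u - 2, l + m - v + 1) - q_kostant (l + 2 * m - u + 2, - m - v - 2)"
proof -
  let ?f = "\<lambda>w. (-1) ^ weyl_length w * q_kostant (w ((l, m) + \<rho>) - ((u, v) + \<rho>))"
  have dom: "0 \<le> l" "0 \<le> m" "0 \<le> u" "0 \<le> v" using assms by (simp_all add: dominant_def)
  have fin: "finite weyl_group" by (rule finite_subset[OF weyl_group_subset]) simp
  have "?f w = 0" if "w \<in> weyl_group - {id, refl1, refl2}" for w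
    using that subsetD[OF weyl_group_subset, of w] dom
    by (auto simp: \<rho>_def q_kostant_eq_0)
  then have "kostka_foulkes (l, m) (u, v) = sum ?f {id, refl1, refl2}"
    unfolding kostka_foulkes_def using in_weyl_group
    by (intro sum.mono_neutral_right[OF fin]) auto
  also have "\<dots> = ?f id + ?f refl1 + ?f refl2"
    using refl_distinct by (simp add: eq_commute)
  also have "\<dots> = q_kostant (l - u, m - v) - q_kostant (- l - u - 2, l + m - v + 1) - q_kostant (l + 2 * m - u + 2, - m - v - 2)"
    by (simp add: weyl_length_id weyl_length_refl \<rho>_def algebra_simps)
  finally show ?thesis .
qed

text \<open>With \<open>M\<close> and \<open>N\<close> the simple root coefficients of
  \<open>\<kappa> - \<mu>\<close>, membership says that \<open>\<zeta> = (l - 2i, m - j)\<close> is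
  dominant, that \<open>\<mu>\<close> lies below it, and that the parity condition holds on the
  wall.\<close>

definition valid_pairs :: "int \<Rightarrow> int \<Rightarrow> int \<Rightarrow> int \<Rightarrow> (nat \<times> nat) set" where
  "valid_pairs l m M N =
     {(i, j) \<in> root_pairs M N. 2 * int i \<le> l \<and> int j \<le> m \<and> (2 * int i = l \<longrightarrow> even j)}"

lemma kostka_foulkes_eq:
  assumes "dominant (l, m)" "dominant (u, v)"
    and M: "M = l - u + m - v" and N: "2 * N = l - u + 2 * (m - v)"
  shows "kostka_foulkes (l, m) (u, v) =
    (\<Sum>(i, j)\<in>valid_pairs l m M N. monom 1 (nat (M + N - 2 * int i - int j)))"
proof -
  let ?e = "\<lambda>(i :: nat, j :: nat). monom (1 :: int) (nat (M + N - 2 * int i - int j))"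
  have dom: "0 \<le> l" "0 \<le> m" "0 \<le> u" "0 \<le> v" using assms by (simp_all add: dominant_def)
  have e0: "2 * M - 2 * N = l - u" "2 * N - M = m - v" using M N by presburger+
  \<comment> \<open>\<open>refl1\<close> subtracts \<open>(l + 1)\<alpha>1\<close> from
    \<open>\<kappa> + \<rho>\<close> and \<open>refl2\<close> subtracts
    \<open>(m + 1)\<alpha>2\<close>, so \<open>M\<close> and \<open>N\<close> drop by
    \<open>l + 1\<close> and \<open>m + 1\<close> respectively.\<close>
  have e1: "2 * (M - l - 1) - 2 * N = - l - u - 2" "2 * N - (M - l - 1) = l + m - v + 1"
    using M N by presburger+
  have e2: "2 * M - 2 * (N - m - 1) = l + 2 * m - u + 2" "2 * (N - m - 1) - M = - m - v - 2"
    using M N by presburger+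
  \<comment> \<open>\<open>R1\<close> and \<open>R2\<close> are the parts of the sum that the terms of \<open>s\<^sub>1\<close> and \<open>s\<^sub>2\<close> cancel.\<close>
  define R1 where "R1 = {(i, j) \<in> root_pairs M N. l < 2 * int i \<or> 2 * int i = l \<and> odd j}"
  define R2 where "R2 = {(i, j) \<in> root_pairs M N. m < int j}"
  have "q_kostant (l - u, m - v) = sum ?e (root_pairs M N)"
    using q_kostant_eq[of M N] by (simp only: e0)
  moreover have "q_kostant (- l - u - 2, l + m - v + 1) = sum ?e R1"
  proof -
    define h where "h = l div 2"
    \<comment> \<open>To keep the exponent, \<open>2i + j\<close> has to grow by
      \<open>l + 1\<close>. For odd \<open>l\<close> the change of \<open>i\<close> absorbs this;
      for even \<open>l\<close> the parity of \<open>j\<close> must flip, whence the odd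
      \<open>j\<close> at \<open>2i = l\<close> in \<open>R1\<close>.\<close>
    define f where "f = (\<lambda>(i :: nat, j :: nat). if odd l then (i + nat (h + 1), j)
       else if even j then (i + nat h, j + 1) else (i + nat h + 1, j - 1))"
    define g where "g = (\<lambda>(i :: nat, j :: nat). if odd l then (i - nat (h + 1), j)
       else if odd j then (i - nat h, j - 1) else (i - nat h - 1, j + 1))"
    have h: "odd l \<Longrightarrow> l = 2 * h + 1" "even l \<Longrightarrow> l = 2 * h" "0 \<le> h"
      using dom by (auto simp: h_def)
    have "q_kostant (- l - u - 2, l + m - v + 1) =
        (\<Sum>(i, j)\<in>root_pairs (M - l - 1) N. monom 1 (nat (M - l - 1 + N - 2 * int i - int j)))"
      using q_kostant_eq[of "M - l - 1" N] by (simp only: e1)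
    also have "\<dots> = sum ?e R1"
    proof (rule sum.reindex_bij_witness[where i = g and j = f])
      fix ij assume ij: "ij \<in> root_pairs (M - l - 1) N"
      obtain i j where [simp]: "ij = (i, j)" by fastforce
      \<comment> \<open>The bound by \<open>M\<close> suffices: since
        \<open>2M - 2N = l - u \<le> l\<close>, it implies the bound by \<open>N\<close> for every
        pair with \<open>2i \<ge> l\<close>.\<close>
      have c: "2 * int i + int j \<le> M - l - 1" using ij by (simp add: root_pairs_def)
      consider (odd) "odd l" | (ee) "even l" "even j" | (eo) "even l" "odd j" by blast
      then have "g (f ij) = ij \<and> f ij \<in> R1 \<and>
          ?e (f ij) = monom 1 (nat (M - l - 1 + N - 2 * int i - int j))"
      proof cases
        case odd
        then show ?thesis using h c M N dom
          by (auto simp: f_def g_def R1_def root_pairs_def)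
            (auto intro!: arg_cong[of _ _ "monom 1"] arg_cong[of _ _ nat])
      next
        case ee
        then show ?thesis using h c M N dom
          by (auto simp: f_def g_def R1_def root_pairs_def)
            (auto intro!: arg_cong[of _ _ "monom 1"] arg_cong[of _ _ nat])
      next
        case eo
        then have "0 < j" by (cases j) auto
        with eo show ?thesis using h c M N dom
          by (auto simp: f_def g_def R1_def root_pairs_def)
            (auto intro!: arg_cong[of _ _ "monom 1"] arg_cong[of _ _ nat])
      qed
      then show "g (f ij) = ij" "f ij \<in> R1"
        "?e (f ij) = (case ij of (i, j) \<Rightarrow> monom 1 (nat (M - l - 1 + N - 2 * int i - int j)))"
        by simp_all
    next
      fix ij assume ij: "ij \<in> R1"
      obtain i j where [simp]: "ij = (i, j)" by fastforce
      have c: "2 * int i + int j \<le> M" "l < 2 * int i \<or> 2 * int i = l \<and> odd j"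
        using ij by (simp_all add: R1_def root_pairs_def)
      consider (odd) "odd l" | (eo) "even l" "odd j" | (ee) "even l" "even j" by blast
      then have "f (g ij) = ij \<and> g ij \<in> root_pairs (M - l - 1) N"
      proof cases
        case odd
        then have "l < 2 * int i" using c(2) by presburger
        with odd show ?thesis using h c(1) M N dom
          by (auto simp: f_def g_def root_pairs_def)
      next
        case eo
        then have "0 < j" by (cases j) auto
        with eo show ?thesis using h c M N dom
          by (auto simp: f_def g_def root_pairs_def)
      next
        case ee
        then show ?thesis using h c M N dom
          by (auto simp: f_def g_def root_pairs_def)
      qed
      then show "f (g ij) = ij" "g ij \<in> root_pairs (M - l - 1) N" by simp_all
    qed
    finally show ?thesis .
  qed
  moreover have "q_kostant (l + 2 * m - u + 2, - m - v - 2) = sum ?e R2"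
  proof -
    have "q_kostant (l + 2 * m - u + 2, - m - v - 2) =
        (\<Sum>(i, j)\<in>root_pairs M (N - m - 1). monom 1 (nat (M + (N - m - 1) - 2 * int i - int j)))"
      using q_kostant_eq[of M "N - m - 1"] by (simp only: e2)
    also have "\<dots> = sum ?e R2"
      \<comment> \<open>Here \<open>j\<close> absorbs the shift \<open>m + 1\<close>. Since
        \<open>2N - M = m - v \<le> m\<close>, the bound by \<open>N\<close> implies the one by
        \<open>M\<close> once \<open>j > m\<close>.\<close>
      by (rule sum.reindex_bij_witness[where j = "\<lambda>(i, j). (i, j + nat (m + 1))"
            and i = "\<lambda>(i, j). (i, j - nat (m + 1))"])
        (use dom M N in \<open>auto simp: root_pairs_def R2_def algebra_simps\<close>)
    finally show ?thesis .
  qed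
  moreover have "sum ?e (root_pairs M N) = sum ?e (valid_pairs l m M N) + (sum ?e R1 + sum ?e R2)"
  proof -
    have fin: "finite (valid_pairs l m M N)" "finite R1" "finite R2"
      unfolding valid_pairs_def R1_def R2_def
      by (rule finite_subset[OF _ finite_root_pairs[of M N]], blast)+
    have un: "root_pairs M N = valid_pairs l m M N \<union> (R1 \<union> R2)"
      by (auto simp: valid_pairs_def R1_def R2_def)
    have d1: "valid_pairs l m M N \<inter> (R1 \<union> R2) = {}"
      by (auto simp: valid_pairs_def R1_def R2_def)
    have d2: "R1 \<inter> R2 = {}"
      using dom M by (auto simp: R1_def R2_def root_pairs_def)
    show ?thesis
      unfolding un using fin d1 d2 by (simp add: sum.union_disjoint)
  qed
  ultimately show ?thesis
    using kostka_foulkes_eq_three_terms[OF assms(1,2)] by simp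
qed

subsection \<open>The charge in terms of the atom decomposition\<close>

text \<open>The three regimes of the string after \<open>Phi\<close> has been undone: on the wall,
  off the wall with last entry 0, and off the wall with positive last entry. In each,
  \<open>x\<close> is given by linear conditions, which leaves linear arithmetic to the uses
  below.\<close>

lemma depths_cases [consumes 3]:
  assumes s: "(a, b, c, d) \<in> strs (l, m)"
    and p: "p = Phi_depth (l, m) (a, b, c, d)" and x: "x = Psi_depth (l, m) (a, b, c, d)"
  obtains (zero) h where "l = 2 * p" "d = p" "x = 2 * h" "0 \<le> h"
      "2 * c - b - p = 2 * h \<or> 2 * c - b - p = 2 * h + 1"
  | (bottom) "2 * p < l" "d = p"
      "x = c - p \<and> c \<le> l - 2 * p + 2 * c - b \<or> x = l - 3 * p + 2 * c - b \<and> l - 2 * p + 2 * c - b \<le> c"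
  | (upper) "2 * p < l" "p < d" "d = l - p \<or> b = l - p - 2 * d + 2 * c" "x = l - 2 * p - d + 2 * c - b - 1"
proof -
  have "shift (- p) (a, b, c, d) \<in> pre_strs (l - 2 * p, m)"
    using shift_Phi_depth_in_pre_strs[OF s] p by simp
  then have pre: "d = p \<or> d = l - p \<or> b = l - p - 2 * d + 2 * c" "p \<le> d" "d \<le> l - p" "0 \<le> 2 * c - b - p \<or> l \<noteq> 2 * p"
    by (auto simp: pre_strs_def strs_def)
  have x': "x = depth (l - 2 * p, m) (a, b - p, c - p, d - p)"
    using x p by (simp add: Psi_depth_def)
  consider "l = 2 * p" | "2 * p < l" "d = p" | "2 * p < l" "p < d"
    using pre(2,3) by linarith
  then show ?thesis
  proof cases
    case 1
    define h where "h = (2 * c - b - p) div 2"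
    have "2 * (c - p) - (b - p) = 2 * c - b - p" by simp
    then have "x = 2 * h" using 1 x' by (simp add: h_def)
    moreover have "0 \<le> h" "2 * c - b - p = 2 * h \<or> 2 * c - b - p = 2 * h + 1"
      using pre(4) 1 by (auto simp: h_def)
    ultimately show ?thesis using zero 1 pre(2,3) by simp
  next
    case 2
    then show ?thesis using x' by (intro bottom) auto
  next
    case 3
    then show ?thesis using x' pre by (intro upper) auto
  qed
qed

text \<open>\<open>\<epsilon>\<^sub>1\<close> of the element is \<open>str_phi\<close> of
  \<open>s\<close> at \<open>I1\<close>, its \<open>eps12\<close> is
  \<open>str_eps I2 s = a\<close>, its \<open>\<epsilon>\<^sub>2\<close> results from raising
  \<open>s\<close> along the 1-string \<open>u\<close> times, and \<open>eps21_hat\<close> comes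
  from \<open>weight_le_iff\<close>. The second claim says that the pair \<open>(p, x)\<close> is
  valid.\<close>

lemma charge_str_word:
  assumes s: "s \<in> strs (l, m)" "low (l, m) s"
    and uv: "refl1 (str_wt (l, m) s) = (u, v)"
    and M: "M = l - u + m - v" and N: "2 * N = l - u + 2 * (m - v)"
  defines "p \<equiv> Phi_depth (l, m) s" and "x \<equiv> Psi_depth (l, m) s"
  shows "charge (l, m) (str_word (l, m) (str_s1 (l, m) s)) = M + N - 2 * p - x"
    and "0 \<le> p \<and> 0 \<le> x \<and> 2 * p + x \<le> M \<and> p + x \<le> N \<and> 2 * p \<le> l \<and> x \<le> m \<and> (2 * p = l \<longrightarrow> even x)"
proof -
  let ?T = "str_word (l, m) (str_s1 (l, m) s)"
  obtain a b c d where eq: "s = (a, b, c, d)" by (cases s) auto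
  have ineqs: "0 \<le> a" "0 \<le> d" "d \<le> c" "c \<le> b" "d \<le> l" "c \<le> m + d"
     "b \<le> l - 2 * d + 2 * c" "a \<le> m - 2 * c + b + d"
    using s(1) by (simp_all add: strs_def eq)
  have dom: "0 \<le> u" "0 \<le> v" using s(2) uv by (simp_all add: low_def dominant_def)
  have u: "u = 2 * (b + d) - l - 2 * (a + c)" and v: "v = l + m - b - d"
    using uv by (simp_all add: eq)
  have px_eq: "p = Phi_depth (l, m) (a, b, c, d)" "x = Psi_depth (l, m) (a, b, c, d)"
    by (simp_all only: p_def x_def eq)
  have N': "N = a + c" using N u v by presburger
  have p0: "0 \<le> p" using Phi_depth_nonneg[OF s(1)] by (simp add: p_def)
  have x0: "0 \<le> x"
    using depth_nonneg[OF shift_Phi_depth_in_pre_strs[OF s(1)]] by (simp add: x_def Psi_depth_def)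
  have pd: "p \<le> d" "p \<le> l - d" "p \<le> l - 2 * d + 2 * c - b" by (simp_all add: p_def eq)
  note facts = ineqs dom u v N' M p0 x0 pd
  have bounds: "2 * p + x \<le> M \<and> p + x \<le> N \<and> 2 * p \<le> l \<and> x \<le> m \<and> (2 * p = l \<longrightarrow> even x)"
    using s(1)[unfolded eq] px_eq
  proof (cases rule: depths_cases)
    case (zero h) then show ?thesis using facts by auto
  next
    case bottom then show ?thesis using facts by auto
  next
    case upper then show ?thesis using facts by auto
  qed
  then show "0 \<le> p \<and> 0 \<le> x \<and> 2 * p + x \<le> M \<and> p + x \<le> N \<and> 2 * p \<le> l \<and> x \<le> m \<and> (2 * p = l \<longrightarrow> even x)"
    using p0 x0 by simp
  have T: "str_s1 (l, m) s \<in> strs (l, m)" using str_s1_in_strs[OF s(1)] .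
  have wt: "wt ?T = (u, v)" using wt_str_word[OF T] str_wt_s1[OF s(1)] uv by simp
  have fst: "fst (str_wt (l, m) s) = - u" using u by (simp add: eq)
  have e1: "int (eps I1 ?T) = max d (max (2 * c - b) (b - 2 * a)) - u"
    using eps_str_word[OF T, of I1] str_eps_s1[OF s(1)] fst by (simp add: str_phi_I1 eq)
  have e2: "int (eps I2 ?T) = a + max 0 (u - max 0 (min (b - a - c) (b - 2 * a - d)))"
  proof -
    have "str_s1 (l, m) s = (str_raise I1 ^^ nat u) s"
      using fst dom by (auto simp: str_s1_def)
    then show ?thesis
      using eps_str_word[OF T, of I2] str_eps_I2_funpow_raise[of "nat u" a b c d] dom
      by (simp add: eq)
  qed
  have e12: "int (eps12 ?T) = a"
    using eps12_str_word[OF T] str_s1_s1[OF s(1)] by (simp add: eq)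
  have "(THE \<zeta>. lies_in_atom (l, m) ?T \<zeta>) = (l - 2 * p, m - x)"
    using lies_in_atom_iff[OF s] by (simp add: p_def x_def)
  then have at: "atom_weight (l, m) ?T = (l - 2 * p, m - x)" by (simp add: atom_weight_def)
  define k0 where "k0 = min (M - 2 * p - x) (N - p - x)"
  have "(GREATEST k. weight_le (u, v + k) (l - 2 * p, m - x)) = k0"
  proof (rule Greatest_equality)
    have dom': "dominant (l - 2 * p, m - x)" using bounds by (simp add: dominant_def)
    have ev: "even (l - 2 * p - u)" unfolding u by simp
    \<comment> \<open>\<open>weight_le_iff\<close> asks for a dominant weight, so only
      \<open>k \<ge> 0\<close> is treated; a negative \<open>k\<close> is at most \<open>k0\<close>
      because \<open>k0 \<ge> 0\<close>.\<close>
    have le: "weight_le (u, v + k) (l - 2 * p, m - x) \<longleftrightarrow> k \<le> k0" if "0 \<le> k" for k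
      using dom that M N ev weight_le_iff[OF _ dom', of u "v + k"]
      by (auto simp: dominant_def k0_def)
    have k0: "0 \<le> k0" using bounds by (simp add: k0_def)
    show "weight_le (u, v + k0) (l - 2 * p, m - x)" using le k0 by simp
    show "k \<le> k0" if "weight_le (u, v + k) (l - 2 * p, m - x)" for k
      using le[of k] that k0 by linarith
  qed
  then have e21: "eps21_hat (l, m) ?T = min (M - 2 * p - x) (N - p - x)"
    by (simp add: eps21_hat_def at wt \<alpha>21_def scale_def k0_def)
  show "charge (l, m) ?T = M + N - 2 * p - x"
    unfolding charge_def e1 e2 e12 e21
    using s(1)[unfolded eq] px_eq
  proof (cases rule: depths_cases)
    case (zero h)
    then show "max d (max (2 * c - b) (b - 2 * a)) - u +
      (a + max 0 (u - max 0 (min (b - a - c) (b - 2 * a - d)))) + a +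
      min (M - 2 * p - x) (N - p - x) = M + N - 2 * p - x"
      using facts by (smt (z3))
  next
    case bottom
    then show "max d (max (2 * c - b) (b - 2 * a)) - u +
      (a + max 0 (u - max 0 (min (b - a - c) (b - 2 * a - d)))) + a +
      min (M - 2 * p - x) (N - p - x) = M + N - 2 * p - x"
      using facts by (smt (z3))
  next
    case upper
    then show "max d (max (2 * c - b) (b - 2 * a)) - u +
      (a + max 0 (u - max 0 (min (b - a - c) (b - 2 * a - d)))) + a +
      min (M - 2 * p - x) (N - p - x) = M + N - 2 * p - x"
      using facts by (smt (z3))
  qed
qed

section \<open>Strings of a given weight and valid pairs\<close>

text \<open>The element of given weight \<open>(u, v)\<close> in the copy of the atom indexed by \<open>(p, x)\<close>, through the
  string of its image under \<open>s1\<close>.\<close>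

definition atom_str :: "int \<Rightarrow> int \<Rightarrow> int \<Rightarrow> int \<Rightarrow> int \<Rightarrow> int \<Rightarrow> str" where
  "atom_str l m v N p x =
     (let \<delta> = m - v;
        (c, d) = (if \<delta> \<le> x then (x + p, p)
          else if even (x - \<delta>) then ((x + \<delta>) div 2 + p, p)
          else ((x + 1 + \<delta>) div 2 + p, min (x + 1) (l - 2 * p) + p))
      in (N - c, l + m - v - d, c, d))"

text \<open>The weight fixes \<open>a + c = N\<close> and \<open>b + d = l + m - v\<close>. Of the
  two remaining parameters, \<open>c\<close> is recovered from \<open>x\<close>, and
  \<open>d\<close> from the inequality that is tight in the preatom.\<close>

lemma atom_str_depths:
  assumes s: "s \<in> strs (l, m)" "low (l, m) s"
    and uv: "refl1 (str_wt (l, m) s) = (u, v)"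
    and N: "2 * N = l - u + 2 * (m - v)"
  shows "atom_str l m v N (Phi_depth (l, m) s) (Psi_depth (l, m) s) = s"
proof -
  define p x where "p = Phi_depth (l, m) s" and "x = Psi_depth (l, m) s"
  define \<delta> where "\<delta> = m - v"
  obtain a b c d where eq: "s = (a, b, c, d)" by (cases s) auto
  have ineqs: "0 \<le> a" "0 \<le> d" "d \<le> c" "c \<le> b" "d \<le> l" "c \<le> m + d"
     "b \<le> l - 2 * d + 2 * c" "a \<le> m - 2 * c + b + d"
    using s(1) by (simp_all add: strs_def eq)
  have dom: "0 \<le> u" "0 \<le> v" using s(2) uv by (simp_all add: low_def dominant_def)
  have u: "u = 2 * (b + d) - l - 2 * (a + c)" and v: "v = l + m - b - d"
    using uv by (simp_all add: eq)
  have px_eq: "p = Phi_depth (l, m) (a, b, c, d)" "x = Psi_depth (l, m) (a, b, c, d)"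
    by (simp_all only: p_def x_def eq)
  have N': "N = a + c" using N u v by presburger
  have \<delta>: "b = l + \<delta> - d" using v by (simp add: \<delta>_def)
  have pd: "p \<le> d" "p \<le> l - d" "p \<le> l - 2 * d + 2 * c - b" by (simp_all add: p_def eq)
  have "(if \<delta> \<le> x then (x + p, p)
          else if even (x - \<delta>) then ((x + \<delta>) div 2 + p, p)
          else ((x + 1 + \<delta>) div 2 + p, min (x + 1) (l - 2 * p) + p)) = (c, d)"
    using s(1)[unfolded eq] px_eq
  proof (cases rule: depths_cases)
    case (zero h)
    \<comment> \<open>The alternatives are the parities of \<open>\<delta>\<close>, as
      \<open>x\<close> is even. In the odd one the last branch of \<open>atom_str\<close> applies,
      with its minimum equal to 0.\<close>
    then have "x + \<delta> = 2 * (c - p) \<or> x + \<delta> + 1 = 2 * (c - p)" "x \<le> \<delta>" "x = \<delta> \<longrightarrow> c = x + p"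
      using ineqs dom u v pd \<delta> by auto
    then show ?thesis using zero by (auto simp: algebra_simps)
  next
    case bottom
    then have "\<delta> \<le> x \<and> c = x + p \<or> x < \<delta> \<and> x + \<delta> = 2 * (c - p)"
      using ineqs dom u v pd \<delta> by auto
    then show ?thesis using bottom by auto
  next
    case upper
    then have "x < \<delta>" "x + 1 + \<delta> = 2 * (c - p)" "d = min (x + 1) (l - 2 * p) + p"
      using ineqs dom u v pd \<delta> by auto
    moreover from this have "odd (x - \<delta>)" "(x + 1 + \<delta>) div 2 = c - p" by presburger+
    ultimately show ?thesis by simp
  qed
  then show ?thesis
    unfolding atom_str_def Let_def p_def[symmetric] x_def[symmetric] \<delta>_def[symmetric]
    using N' v by (simp add: eq)
qed

lemma Psi_depth_eq:
  "Phi_depth (l, m) (a, b, c, d) = p \<Longrightarrow>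
     Psi_depth (l, m) (a, b, c, d) = depth (l - 2 * p, m) (a, b - p, c - p, d - p)"
  by (simp add: Psi_depth_def del: Phi_depth.simps)

text \<open>Every valid pair occurs: the cases follow the branches of \<open>atom_str\<close>, the
  odd one being split according to whether \<open>l = 2 * p\<close>.\<close>

lemma depths_atom_str:
  assumes dom: "0 \<le> l" "0 \<le> m" "0 \<le> u" "0 \<le> v"
    and M: "M = l - u + m - v" and N: "2 * N = l - u + 2 * (m - v)"
    and px: "0 \<le> p" "0 \<le> x" "2 * p + x \<le> M" "p + x \<le> N" "2 * p \<le> l" "x \<le> m" "2 * p = l \<longrightarrow> even x"
  defines "s \<equiv> atom_str l m v N p x"
  shows "s \<in> strs (l, m) \<and> refl1 (str_wt (l, m) s) = (u, v) \<and>
    Phi_depth (l, m) s = p \<and> Psi_depth (l, m) s = x"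
proof -
  define \<delta> where "\<delta> = m - v"
  have facts: "0 \<le> l" "0 \<le> m" "0 \<le> u" "\<delta> \<le> m" "u = l + 2 * \<delta> - 2 * N" "M = 2 * N - \<delta>"
    using dom M N by (simp_all add: \<delta>_def)
  consider (1) "\<delta> \<le> x" | (2) j where "x < \<delta>" "x + \<delta> = 2 * j"
    | (3) j where "x < \<delta>" "x + 1 + \<delta> = 2 * j" "2 * p < l"
    | (4) j where "x < \<delta>" "x + 1 + \<delta> = 2 * j" "2 * p = l"
  proof (cases "even (x + \<delta>)")
    case True
    then obtain j where j: "x + \<delta> = 2 * j" by (rule evenE)
    show ?thesis using that(1) that(2)[OF _ j] by (meson not_le)
  next
    case False
    then have "even (x + 1 + \<delta>)" by simp
    then obtain j where j: "x + 1 + \<delta> = 2 * j" by (rule evenE)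
    show ?thesis using that(1) that(3,4)[OF _ j] px(5) by (meson not_le order_antisym)
  qed
  then show ?thesis
  proof cases
    case 1
    then have s: "s = (N - x - p, l + \<delta> - p, x + p, p)"
      by (simp add: s_def atom_str_def \<delta>_def)
    have "s \<in> strs (l, m)" using 1 facts px by (simp add: s strs_def)
    moreover have "refl1 (str_wt (l, m) s) = (u, v)" using facts by (simp add: s \<delta>_def)
    moreover have Phi: "Phi_depth (l, m) s = p" using 1 facts px by (simp add: s)
    moreover have "depth (l - 2 * p, m) (N - x - p, l + \<delta> - p - p, x + p - p, p - p) = x"
    proof (cases "l = 2 * p")
      case True
      \<comment> \<open>On the wall \<open>p + x \<le> N\<close> and \<open>0 \<le> u\<close> give
        \<open>x \<le> \<delta>\<close>, so equality holds, and the rounding in \<open>depth\<close>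
        has no effect on an even number.\<close>
      then have "x = \<delta>" "even x" using 1 facts px by simp_all
      with True show ?thesis by simp
    next
      case False
      with 1 show ?thesis by simp
    qed
    ultimately show ?thesis using Psi_depth_eq[OF Phi[unfolded s]] by (simp only: s)
  next
    case (2 j)
    then have s: "s = (N - j - p, l + \<delta> - p, j + p, p)"
      by (simp add: s_def atom_str_def \<delta>_def[symmetric] Let_def)
    have j: "x \<le> j" "j < \<delta>" using 2 by linarith+
    have "s \<in> strs (l, m)" using 2 j facts px by (simp add: s strs_def)
    moreover have "refl1 (str_wt (l, m) s) = (u, v)" using facts by (simp add: s \<delta>_def)
    moreover have Phi: "Phi_depth (l, m) s = p" using 2 j facts px by (simp add: s)
    moreover have "depth (l - 2 * p, m) (N - j - p, l + \<delta> - p - p, j + p - p, p - p) = x"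
    proof (cases "l = 2 * p")
      case True
      then have "even x" using px by simp
      moreover have "2 * j - \<delta> = x" using 2 by simp
      ultimately show ?thesis using True by simp
    next
      case False
      with 2 j show ?thesis by simp
    qed
    ultimately show ?thesis using Psi_depth_eq[OF Phi[unfolded s]] by (simp only: s)
  next
    case (3 j)
    define d where "d = min (x + 1) (l - 2 * p)"
    have d: "1 \<le> d" "d \<le> x + 1" "d \<le> l - 2 * p" "d = x + 1 \<or> d = l - 2 * p"
      using 3 px by (auto simp: d_def)
    have odd: "odd (x - \<delta>)" using 3(2) by presburger
    have s: "s = (N - j - p, l + \<delta> - d - p, j + p, d + p)"
      using 3 odd by (simp add: s_def atom_str_def \<delta>_def[symmetric] d_def[symmetric] Let_def)
    have j: "x < j" "j \<le> \<delta>" using 3 by linarith+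
    have "s \<in> strs (l, m)" using 3 j facts px d by (simp add: s strs_def)
    moreover have "refl1 (str_wt (l, m) s) = (u, v)" using facts by (simp add: s \<delta>_def)
    moreover have Phi: "Phi_depth (l, m) s = p" using 3 j facts px d by (auto simp: s)
    moreover have "depth (l - 2 * p, m) (N - j - p, l + \<delta> - d - p - p, j + p - p, d + p - p) = x"
      using 3 d by simp
    ultimately show ?thesis using Psi_depth_eq[OF Phi[unfolded s]] by (simp only: s)
  next
    case (4 j)
    have odd: "odd (x - \<delta>)" using 4(2) by presburger
    have s: "s = (N - j - p, l + \<delta> - p, j + p, p)"
      using 4 odd px by (simp add: s_def atom_str_def \<delta>_def[symmetric] Let_def)
    have j: "x < j" "j \<le> \<delta>" using 4 by linarith+
    have "even x" using px(7) 4(3) by simp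
    have "s \<in> strs (l, m)" using 4 j facts px by (simp add: s strs_def)
    moreover have "refl1 (str_wt (l, m) s) = (u, v)" using facts by (simp add: s \<delta>_def)
    moreover have Phi: "Phi_depth (l, m) s = p" using 4 j facts px by (simp add: s)
    moreover have "depth (l - 2 * p, m) (N - j - p, l + \<delta> - p - p, j + p - p, p - p) = x"
    proof -
      \<comment> \<open>The rounding in \<open>depth\<close> takes the odd number
        \<open>x + 1\<close> down to \<open>x\<close>.\<close>
      have "2 * j - \<delta> = x + 1" using 4 by simp
      then show ?thesis using 4(3) \<open>even x\<close> by simp
    qed
    ultimately show ?thesis using Psi_depth_eq[OF Phi[unfolded s]] by (simp only: s)
  qed
qed

theorem mainTheorem3:
  fixes \<kappa> :: weight
  assumes "dominant \<kappa>"
  shows "charge_statistic \<kappa> (charge \<kappa>)"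
proof -
  obtain l m where \<kappa>: "\<kappa> = (l, m)" by fastforce
  have lm: "0 \<le> l" "0 \<le> m" using assms by (simp_all add: \<kappa> dominant_def)
  have preimage: "\<exists>s \<in> strs \<kappa>. T = str_word \<kappa> (str_s1 \<kappa> s) \<and> refl1 (str_wt \<kappa> s) = wt T"
    if T: "T \<in> crystal \<kappa>" for T
  proof -
    obtain t where t: "t \<in> strs \<kappa>" "T = str_word \<kappa> t" using T crystal_eq[OF assms] by blast
    then show ?thesis
      using str_s1_in_strs[OF t(1)] str_s1_s1[OF t(1)] str_wt_s1[OF t(1)] wt_str_word[OF t(1)]
      by (intro bexI[of _ "str_s1 \<kappa> t"]) auto
  qed
  have nonneg: "0 \<le> charge \<kappa> T" if T: "T \<in> crystal_dom \<kappa>" for T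
  proof -
    obtain s where s: "s \<in> strs \<kappa>" "T = str_word \<kappa> (str_s1 \<kappa> s)" "refl1 (str_wt \<kappa> s) = wt T"
      using preimage[of T] T unfolding crystal_dom_def by blast
    obtain u v where uv: "wt T = (u, v)" by fastforce
    have low: "low (l, m) s" using T s by (simp add: low_def crystal_dom_def \<kappa>)
    obtain a b c d where "s = (a, b, c, d)" by (cases s) auto
    then have N: "2 * (a + c) = l - u + 2 * (m - v)" using s(3) uv by (auto simp: \<kappa>)
    have "refl1 (str_wt (l, m) s) = (u, v)" using s(3) uv by (simp add: \<kappa>)
    note c = charge_str_word[OF s(1)[unfolded \<kappa>] low this refl N]
    show ?thesis unfolding s(2) \<kappa> c(1) using c(2) by linarith
  qed
  have sum: "kostka_foulkes \<kappa> \<mu> = (\<Sum>T | T \<in> crystal \<kappa> \<and> wt T = \<mu>. monom 1 (nat (charge \<kappa> T)))"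
    if \<mu>: "dominant \<mu>" "weight_le \<mu> \<kappa>" for \<mu>
  proof -
    obtain u v where uv: "\<mu> = (u, v)" by fastforce
    have dom: "0 \<le> u" "0 \<le> v" using \<mu>(1) by (simp_all add: uv dominant_def)
    have "even (l - u)" using \<mu> assms by (simp add: uv \<kappa> weight_le_iff)
    then obtain j where j: "l - u = 2 * j" by (rule evenE)
    define M N where "M = l - u + m - v" and "N = j + m - v"
    have N: "2 * N = l - u + 2 * (m - v)" using j by (simp add: N_def)
    \<comment> \<open>These are the strings of \<open>s1 T\<close> for \<open>T\<close> of weight
      \<open>\<mu>\<close>; they mediate between the valid pairs and the elements
      \<open>T\<close>.\<close>
    define L where "L = {s \<in> strs \<kappa>. refl1 (str_wt \<kappa> s) = \<mu>}"
    have low: "low (l, m) s" if "s \<in> L" for s using that \<mu>(1) by (simp add: L_def low_def \<kappa>)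
    have ch: "charge \<kappa> (str_word \<kappa> (str_s1 \<kappa> s)) = M + N - 2 * Phi_depth \<kappa> s - Psi_depth \<kappa> s"
      "0 \<le> Phi_depth \<kappa> s" "0 \<le> Psi_depth \<kappa> s"
      "(nat (Phi_depth \<kappa> s), nat (Psi_depth \<kappa> s)) \<in> valid_pairs l m M N"
      "atom_str l m v N (Phi_depth \<kappa> s) (Psi_depth \<kappa> s) = s" if s: "s \<in> L" for s
    proof -
      have s': "s \<in> strs (l, m)" "refl1 (str_wt (l, m) s) = (u, v)" using s by (simp_all add: L_def \<kappa> uv)
      show "charge \<kappa> (str_word \<kappa> (str_s1 \<kappa> s)) = M + N - 2 * Phi_depth \<kappa> s - Psi_depth \<kappa> s"
        "0 \<le> Phi_depth \<kappa> s" "0 \<le> Psi_depth \<kappa> s"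
        "(nat (Phi_depth \<kappa> s), nat (Psi_depth \<kappa> s)) \<in> valid_pairs l m M N"
        using charge_str_word[OF s'(1) low[OF s] s'(2) M_def N]
        by (auto simp: \<kappa> valid_pairs_def root_pairs_def even_nat_iff)
      show "atom_str l m v N (Phi_depth \<kappa> s) (Psi_depth \<kappa> s) = s"
        using atom_str_depths[OF s'(1) low[OF s] s'(2) N] by (simp add: \<kappa>)
    qed
    have "kostka_foulkes \<kappa> \<mu> =
        (\<Sum>(i, j)\<in>valid_pairs l m M N. monom 1 (nat (M + N - 2 * int i - int j)))"
      using kostka_foulkes_eq[OF _ _ M_def N] assms \<mu>(1) by (simp add: \<kappa> uv)
    also have "\<dots> = (\<Sum>s\<in>L. monom 1 (nat (charge \<kappa> (str_word \<kappa> (str_s1 \<kappa> s)))))"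
    proof (rule sum.reindex_bij_witness[symmetric, where
          i = "\<lambda>(i, j). atom_str l m v N (int i) (int j)" and
          j = "\<lambda>s. (nat (Phi_depth \<kappa> s), nat (Psi_depth \<kappa> s))"])
      fix s assume "s \<in> L"
      from ch[OF this] show
        "(case (nat (Phi_depth \<kappa> s), nat (Psi_depth \<kappa> s)) of (i, j) \<Rightarrow> atom_str l m v N (int i) (int j)) = s"
        "(nat (Phi_depth \<kappa> s), nat (Psi_depth \<kappa> s)) \<in> valid_pairs l m M N"
        "(case (nat (Phi_depth \<kappa> s), nat (Psi_depth \<kappa> s)) of (i, j) \<Rightarrow>
           monom 1 (nat (M + N - 2 * int i - int j))) =
         monom (1 :: int) (nat (charge \<kappa> (str_word \<kappa> (str_s1 \<kappa> s))))"
        by simp_all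
    next
      fix ij assume ij: "ij \<in> valid_pairs l m M N"
      obtain i j where [simp]: "ij = (i, j)" by fastforce
      have v: "2 * int i + int j \<le> M" "int i + int j \<le> N" "2 * int i \<le> l" "int j \<le> m"
        "2 * int i = l \<longrightarrow> even (int j)"
        using ij by (auto simp: valid_pairs_def root_pairs_def)
      show "(\<lambda>s. (nat (Phi_depth \<kappa> s), nat (Psi_depth \<kappa> s)))
          (case ij of (i, j) \<Rightarrow> atom_str l m v N (int i) (int j)) = ij"
        "(case ij of (i, j) \<Rightarrow> atom_str l m v N (int i) (int j)) \<in> L"
        using depths_atom_str[OF lm dom M_def N _ _ v] by (simp_all add: L_def \<kappa> uv)
    qed
    also have "\<dots> = (\<Sum>T | T \<in> crystal \<kappa> \<and> wt T = \<mu>. monom 1 (nat (charge \<kappa> T)))"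
    proof (rule sum.reindex_cong[symmetric, where l = "\<lambda>s. str_word \<kappa> (str_s1 \<kappa> s)"])
      show "inj_on (\<lambda>s. str_word \<kappa> (str_s1 \<kappa> s)) L"
      proof (rule inj_onI)
        fix s s' assume ss: "s \<in> L" "s' \<in> L" "str_word \<kappa> (str_s1 \<kappa> s) = str_word \<kappa> (str_s1 \<kappa> s')"
        then have S: "s \<in> strs \<kappa>" "s' \<in> strs \<kappa>" by (simp_all add: L_def)
        have "str_s1 \<kappa> s = str_s1 \<kappa> s'"
          using inj_onD[OF inj_on_str_word ss(3)] S str_s1_in_strs by blast
        then show "s = s'" using S str_s1_s1 by metis
      qed
      show "{T. T \<in> crystal \<kappa> \<and> wt T = \<mu>} = (\<lambda>s. str_word \<kappa> (str_s1 \<kappa> s)) ` L"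
        using preimage by (auto simp: L_def crystal_eq[OF assms] wt_str_word str_s1_in_strs str_wt_s1)
    qed simp
    finally show ?thesis .
  qed
  show ?thesis using nonneg sum by (auto simp: charge_statistic_def)
qed

end
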